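(* Let $R$ and $\mu$ be as in the context, and assume that $R(u,v)=R(u,0)R(0,v)$ for all $u,v\in\mathbb Z$. Then the function $$r(x):=\sum_{k=-\infty}^\infty R(k,0)e^{-\mathrm ikx},\quad -\pi\le x\le\pi,$$ is well defined, that is, the sum on the right-hand side converges absolutely, and its range is contained in $[0,\infty)$. Furthermore, $$\mu=\mu_r\boxtimes\mu_s,$$ where $\mu_r$ is the law of $r(U)$ with $U$ uniformly distributed on $(-\pi,\pi)$, $\mu_s$ is the Wigner semicircle law $\mu_s(dx)=\frac{\sqrt{4-x^2}}{2\pi}\mathbf 1(|x|\le2)\,dx$, and $\boxtimes$ denotes free multiplicative convolution.
   Context: Let $(Y_{i,j}:i,j\in\mathbb Z)$ be a weakly stationary real process with $E(Y_{i,j})=0$, $E(Y_{i,j}^2)=1$ and $E(Y_{i,j}Y_{i-u,j+v})=R(u,v)$ for all $i,j,u,v\in\mathbb Z$. Assume $R(u,v)=R(v,u)$ for all $u,v\in\mathbb Z$ and $\sum_{u,v\in\mathbb Z}|R(u,v)|<\infty$. For $m\ge1$, $NC_2(2m)$ is the set of non-crossing pair partitions of $\{1,\dots,2m\}$. For $\sigma\in NC_2(2m)$, its Kreweras complement is the maximal (coarsest) partition $\overline\sigma$ of $\{\overline1,\dots,\overline{2m}\}$ such that $\sigma\cup\overline\sigma$ is a non-crossing partition of the ordered set $1<\overline1<2<\overline2<\dots<2m<\overline{2m}$. It has $m+1$ blocks $V_1,\dots,V_{m+1}$, regarded (dropping bars) as subsets of $\{1,\dots,2m\}$. Define $S(\sigma):=\{k\in\mathbb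 Z^{2m}:\sum_{j\in V_s}k_j=0,\ s=1,\dots,m+1\}$ and $\beta_{2m}:=\sum_{\sigma\in NC_2(2m)}\sum_{k\in S(\sigma)}\prod_{(u,v)\in\sigma}R(k_u,k_v)$ for $m\ge1$ (absolutely convergent). Let $\mu$ be the unique even probability measure on $\mathbb R$ whose $2m$-th moment equals $\beta_{2m}$ for all $m\ge1$ (such a $\mu$ exists and is unique). For compactly supported probability measures $\nu_1$ on $[0,\infty)$ and $\nu_2$ on $\mathbb R$, $\nu_1\boxtimes\nu_2=\nu_2\boxtimes\nu_1$ is the distribution of $a^{1/2}ba^{1/2}$, where $a\ge0$ and $b$ are freely independent self-adjoint elements, with distributions $\nu_1$ and $\nu_2$, of a von Neumann algebra with faithful normal tracial state. *)

theory Defs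
  imports
    "HOL-Probability.Probability"
    "HOL-Library.Disjoint_Sets"
begin

section \<open>The complex Hilbert space of square-summable families\<close>

typedef 'i ell2 = "{x :: 'i \<Rightarrow> complex. (\<lambda>i. (cmod (x i))\<^sup>2) summable_on UNIV}"
  morphisms coord Abs_ell2
  by (rule exI[of _ "\<lambda>_. 0"]) simp

setup_lifting type_definition_ell2

lemma summable_coord: "(\<lambda>i. (cmod (coord x i))\<^sup>2) summable_on UNIV"
  using coord[of x] by simp

lemma summable_add_square:
  fixes x y :: "'i \<Rightarrow> complex"
  assumes "(\<lambda>i. (cmod (x i))\<^sup>2) summable_on UNIV" "(\<lambda>i. (cmod (y i))\<^sup>2) summable_on UNIV"
  shows "(\<lambda>i. (cmod (x i + y i))\<^sup>2) summable_on UNIV"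
proof (rule summable_on_comparison_test)
  show "(\<lambda>i. 2 * ((cmod (x i))\<^sup>2 + (cmod (y i))\<^sup>2)) summable_on UNIV"
    by (intro summable_on_cmult_right summable_on_add assms)
  fix i
  have "(cmod (x i + y i))\<^sup>2 \<le> (cmod (x i) + cmod (y i))\<^sup>2"
    by (intro power_mono norm_triangle_ineq) simp
  also have "\<dots> \<le> 2 * ((cmod (x i))\<^sup>2 + (cmod (y i))\<^sup>2)"
    using sum_squares_bound[of "cmod (x i)" "cmod (y i)"] by (simp add: power2_sum)
  finally show "(cmod (x i + y i))\<^sup>2 \<le> 2 * ((cmod (x i))\<^sup>2 + (cmod (y i))\<^sup>2)" .
qed auto

lemma summable_scale_square:
  fixes x :: "'i \<Rightarrow> complex"
  assumes "(\<lambda>i. (cmod (x i))\<^sup>2) summable_on UNIV"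
  shows "(\<lambda>i. (cmod (c * x i))\<^sup>2) summable_on UNIV"
  using summable_on_cmult_right[OF assms, of "(cmod c)\<^sup>2"]
  by (simp add: norm_mult power_mult_distrib)

instantiation ell2 :: (type) ab_group_add
begin
lift_definition zero_ell2 :: "'a ell2" is "\<lambda>_. 0" by simp
lift_definition plus_ell2 :: "'a ell2 \<Rightarrow> 'a ell2 \<Rightarrow> 'a ell2" is "\<lambda>x y i. x i + y i"
  using summable_add_square by auto
lift_definition uminus_ell2 :: "'a ell2 \<Rightarrow> 'a ell2" is "\<lambda>x i. - x i" by simp
lift_definition minus_ell2 :: "'a ell2 \<Rightarrow> 'a ell2 \<Rightarrow> 'a ell2" is "\<lambda>x y i. x i - y i"
  subgoal for x y using summable_add_square[of x "\<lambda>i. - y i"] by simp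
  done
instance by (standard; transfer; auto)
end

lift_definition scaleC :: "complex \<Rightarrow> 'i ell2 \<Rightarrow> 'i ell2" (infixr "*\<^sub>C" 75) is "\<lambda>c x i. c * x i"
  using summable_scale_square by auto

lift_definition cinner :: "'i ell2 \<Rightarrow> 'i ell2 \<Rightarrow> complex" is
  "\<lambda>x y. \<Sum>\<^sub>\<infinity>i. cnj (x i) * y i" .

lemma summable_cinner: "(\<lambda>i. cnj (coord x i) * coord y i) summable_on UNIV"
proof -
  have "(\<lambda>i. norm (cnj (coord x i) * coord y i)) summable_on UNIV"
    by (rule abs_summable_product)
      (use summable_coord[of x] summable_coord[of y] in
        \<open>simp_all add: norm_mult power2_eq_square\<close>)
  thus ?thesis by (rule abs_summable_summable)
qed

lemma cinner_add_left: "cinner (x + y) z = cinner x z + cinner y z"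
  by (simp add: cinner.rep_eq plus_ell2.rep_eq ring_distribs infsum_add summable_cinner)

lemma cinner_commute: "cinner x y = cnj (cinner y x)"
  by (simp add: cinner.rep_eq mult.commute flip: infsum_cnj)

lemma cinner_scaleC_left: "cinner (c *\<^sub>C x) y = cnj c * cinner x y"
  by (simp add: cinner.rep_eq scaleC.rep_eq mult.assoc infsum_cmult_right summable_cinner)

lemma cinner_self: "cinner x x = of_real (\<Sum>\<^sub>\<infinity>i. (cmod (coord x i))\<^sup>2)"
proof -
  have "((\<lambda>i. complex_of_real ((cmod (coord x i))\<^sup>2)) has_sum
      of_real (\<Sum>\<^sub>\<infinity>i. (cmod (coord x i))\<^sup>2)) UNIV"
    by (intro has_sum_of_real has_sum_infsum summable_coord)
  from infsumI[OF this] show ?thesis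
    by (simp add: cinner.rep_eq complex_norm_square mult.commute del: of_real_power)
qed

instantiation ell2 :: (type) real_inner
begin
definition scaleR_ell2 :: "real \<Rightarrow> 'a ell2 \<Rightarrow> 'a ell2" where
  "scaleR_ell2 c x = complex_of_real c *\<^sub>C x"
definition inner_ell2 :: "'a ell2 \<Rightarrow> 'a ell2 \<Rightarrow> real" where
  "inner_ell2 x y = Re (cinner x y)"
definition norm_ell2 :: "'a ell2 \<Rightarrow> real" where
  "norm_ell2 x = sqrt (inner x x)"
definition sgn_ell2 :: "'a ell2 \<Rightarrow> 'a ell2" where
  "sgn_ell2 x = inverse (norm x) *\<^sub>R x"
definition dist_ell2 :: "'a ell2 \<Rightarrow> 'a ell2 \<Rightarrow> real" where
  "dist_ell2 x y = norm (x - y)"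
definition uniformity_ell2 :: "('a ell2 \<times> 'a ell2) filter" where
  "uniformity_ell2 = (INF e\<in>{0 <..}. principal {(x, y). dist x y < e})"
definition open_ell2 :: "'a ell2 set \<Rightarrow> bool" where
  "open_ell2 U \<longleftrightarrow> (\<forall>x\<in>U. eventually (\<lambda>(x', y). x' = x \<longrightarrow> y \<in> U) uniformity)"
instance
proof
  fix x y z :: "'a ell2" and a b :: real
  show "a *\<^sub>R (x + y) = a *\<^sub>R x + a *\<^sub>R y"
    unfolding scaleR_ell2_def by transfer (simp add: ring_distribs)
  show "(a + b) *\<^sub>R x = a *\<^sub>R x + b *\<^sub>R x"
    unfolding scaleR_ell2_def by transfer (simp add: ring_distribs)
  show "a *\<^sub>R b *\<^sub>R x = (a * b) *\<^sub>R x"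
    unfolding scaleR_ell2_def by transfer (simp add: mult.assoc)
  show "1 *\<^sub>R x = x"
    unfolding scaleR_ell2_def by transfer simp
  show "inner x y = inner y x"
    unfolding inner_ell2_def by (subst cinner_commute) simp
  show "inner (x + y) z = inner x z + inner y z"
    by (simp add: inner_ell2_def cinner_add_left)
  show "inner (a *\<^sub>R x) y = a * inner x y"
    by (simp add: inner_ell2_def scaleR_ell2_def cinner_scaleC_left)
  show "0 \<le> inner x x"
    by (simp add: inner_ell2_def cinner_self infsum_nonneg)
  show "inner x x = 0 \<longleftrightarrow> x = 0"
  proof
    assume "inner x x = 0"
    hence "(\<Sum>\<^sub>\<infinity>i. (cmod (coord x i))\<^sup>2) = 0"
      by (simp add: inner_ell2_def cinner_self)
    hence "(cmod (coord x i))\<^sup>2 = 0" for i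
      using nonneg_infsum_le_0D[of "\<lambda>i. (cmod (coord x i))\<^sup>2" UNIV i] summable_coord[of x] by auto
    thus "x = 0" by transfer (simp add: fun_eq_iff)
  next
    assume "x = 0"
    thus "inner x x = 0" by (simp add: inner_ell2_def cinner_self zero_ell2.rep_eq)
  qed
qed (simp_all add: norm_ell2_def sgn_ell2_def dist_ell2_def uniformity_ell2_def open_ell2_def)
end

lemma norm_ell2_square: "(norm x)\<^sup>2 = (\<Sum>\<^sub>\<infinity>i. (cmod (coord x i))\<^sup>2)"
  by (simp add: power2_norm_eq_inner inner_ell2_def cinner_self)

lemma sum_coord_le: "finite F \<Longrightarrow> (\<Sum>i\<in>F. (cmod (coord x i))\<^sup>2) \<le> (norm x)\<^sup>2"
  unfolding norm_ell2_square by (rule finite_sum_le_infsum) (auto simp: summable_coord)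

instance ell2 :: (type) complete_space
proof
  fix X :: "nat \<Rightarrow> 'a ell2"
  assume X: "Cauchy X"
  have le: "cmod (coord x i) \<le> norm x" for x :: "'a ell2" and i
    using sum_coord_le[of "{i}" x] by (simp add: abs_le_square_iff)
  have "Cauchy (\<lambda>n. coord (X n) i)" for i
  proof (rule metric_CauchyI)
    fix e :: real assume "e > 0"
    then obtain N where N: "\<forall>m\<ge>N. \<forall>n\<ge>N. dist (X m) (X n) < e"
      using X metric_CauchyD by blast
    have "dist (coord (X m) i) (coord (X n) i) \<le> dist (X m) (X n)" for m n
      using le[of "X m - X n" i] by (simp add: dist_norm minus_ell2.rep_eq)
    thus "\<exists>M. \<forall>m\<ge>M. \<forall>n\<ge>M. dist (coord (X m) i) (coord (X n) i) < e"
      using N by (meson le_less_trans)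
  qed
  hence "\<forall>i. \<exists>l. (\<lambda>n. coord (X n) i) \<longlonglongrightarrow> l"
    using Cauchy_convergent convergent_def by blast
  then obtain a where a: "\<And>i. (\<lambda>n. coord (X n) i) \<longlonglongrightarrow> a i" by metis
  have bd: "(\<Sum>i\<in>F. (cmod (a i - coord (X n) i))\<^sup>2) \<le> e\<^sup>2"
    if "finite F" "\<forall>m\<ge>N. \<forall>n\<ge>N. dist (X m) (X n) < e" "n \<ge> N" for F e N n
  proof (rule tendsto_upperbound)
    show "(\<lambda>m. \<Sum>i\<in>F. (cmod (coord (X m) i - coord (X n) i))\<^sup>2)
            \<longlonglongrightarrow> (\<Sum>i\<in>F. (cmod (a i - coord (X n) i))\<^sup>2)"
      by (intro tendsto_intros a)
    show "\<forall>\<^sub>F m in sequentially. (\<Sum>i\<in>F. (cmod (coord (X m) i - coord (X n) i))\<^sup>2) \<le> e\<^sup>2"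
      using eventually_ge_at_top[of N]
    proof eventually_elim
      case (elim m)
      have "(\<Sum>i\<in>F. (cmod (coord (X m - X n) i))\<^sup>2) \<le> (norm (X m - X n))\<^sup>2"
        by (rule sum_coord_le) fact
      also have "\<dots> \<le> e\<^sup>2"
        using that(2)[rule_format, of m n] that(3) elim
        by (intro power_mono) (auto simp: dist_norm)
      finally show ?case by (simp add: minus_ell2.rep_eq)
    qed
  qed simp
  have sm: "(\<lambda>i. (cmod (a i - coord (X n) i))\<^sup>2) summable_on UNIV"
    if "\<forall>m\<ge>N. \<forall>n\<ge>N. dist (X m) (X n) < e" "n \<ge> N" for e N n
    by (rule nonneg_bdd_above_summable_on) (auto intro!: bdd_aboveI2[of _ _ "e\<^sup>2"] bd[OF _ that])
  obtain N1 where N1: "\<forall>m\<ge>N1. \<forall>n\<ge>N1. dist (X m) (X n) < 1"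
    using X metric_CauchyD[of X 1] by auto
  have "(\<lambda>i. (cmod (a i))\<^sup>2) summable_on UNIV"
    using summable_add_square[OF sm[OF N1 order_refl] summable_coord[of "X N1"]] by simp
  hence La: "coord (Abs_ell2 a) = a" by (simp add: Abs_ell2_inverse)
  have "X \<longlonglongrightarrow> Abs_ell2 a"
  proof (rule metric_LIMSEQ_I)
    fix e :: real assume "e > 0"
    then obtain N where N: "\<forall>m\<ge>N. \<forall>n\<ge>N. dist (X m) (X n) < e / 2"
      using X metric_CauchyD[of X "e / 2"] by auto
    have "dist (X n) (Abs_ell2 a) < e" if "n \<ge> N" for n
    proof -
      have "(norm (Abs_ell2 a - X n))\<^sup>2 \<le> (e / 2)\<^sup>2"
        unfolding norm_ell2_square minus_ell2.rep_eq La
        by (rule infsum_le_finite_sums[OF sm[OF N that]]) (rule bd[OF _ N that])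
      hence "norm (Abs_ell2 a - X n) \<le> e / 2"
        using \<open>e > 0\<close> by (simp add: abs_le_square_iff)
      thus ?thesis using \<open>e > 0\<close> by (simp add: dist_norm norm_minus_commute)
    qed
    thus "\<exists>N. \<forall>n\<ge>N. dist (X n) (Abs_ell2 a) < e" by blast
  qed
  thus "convergent X" by (auto simp: convergent_def)
qed

section \<open>Von Neumann algebras with a faithful normal tracial state\<close>

text \<open>Operators are plain functions: the product is \<^term>\<open>(\<circ>)\<close>, the unit is \<^term>\<open>id\<close>, and powers are
  iterates \<open>T ^^ n\<close>.  Every complex Hilbert space is isomorphic to \<open>'i ell2\<close> for a suitable \<open>'i\<close>.\<close>

type_synonym 'i op = "'i ell2 \<Rightarrow> 'i ell2"

definition bounded_op :: "'i op \<Rightarrow> bool" where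
  "bounded_op T \<longleftrightarrow> bounded_linear T \<and> (\<forall>c x. T (c *\<^sub>C x) = c *\<^sub>C T x)"

definition is_adjoint :: "'i op \<Rightarrow> 'i op \<Rightarrow> bool" where
  "is_adjoint T S \<longleftrightarrow> bounded_op T \<and> bounded_op S \<and> (\<forall>x y. cinner (T x) y = cinner x (S y))"

definition self_adjoint :: "'i op \<Rightarrow> bool" where
  "self_adjoint T \<longleftrightarrow> is_adjoint T T"

definition positive_op :: "'i op \<Rightarrow> bool" where
  "positive_op T \<longleftrightarrow> bounded_op T \<and> (\<forall>x. cinner x (T x) \<in> \<real>\<^sub>\<ge>\<^sub>0)"

definition op_le :: "'i op \<Rightarrow> 'i op \<Rightarrow> bool" where
  "op_le S T \<longleftrightarrow> positive_op (\<lambda>x. T x - S x)"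

definition op_lub :: "'i op set \<Rightarrow> 'i op \<Rightarrow> bool" where
  "op_lub D T \<longleftrightarrow> self_adjoint T \<and> (\<forall>S\<in>D. op_le S T) \<and>
     (\<forall>T'. self_adjoint T' \<and> (\<forall>S\<in>D. op_le S T') \<longrightarrow> op_le T T')"

definition commutant :: "'i op set \<Rightarrow> 'i op set" where
  "commutant A = {T. bounded_op T \<and> (\<forall>S\<in>A. S \<circ> T = T \<circ> S)}"

definition von_neumann_algebra :: "'i op set \<Rightarrow> bool" where
  "von_neumann_algebra M \<longleftrightarrow>
     (\<forall>T\<in>M. bounded_op T) \<and> (\<forall>T\<in>M. \<exists>S\<in>M. is_adjoint T S) \<and> commutant (commutant M) = M"

definition state_on :: "'i op set \<Rightarrow> ('i op \<Rightarrow> complex) \<Rightarrow> bool" where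
  "state_on M \<tau> \<longleftrightarrow>
     (\<forall>S\<in>M. \<forall>T\<in>M. \<tau> (\<lambda>x. S x + T x) = \<tau> S + \<tau> T) \<and>
     (\<forall>T\<in>M. \<forall>c. \<tau> (\<lambda>x. c *\<^sub>C T x) = c * \<tau> T) \<and>
     (\<forall>T\<in>M. positive_op T \<longrightarrow> \<tau> T \<in> \<real>\<^sub>\<ge>\<^sub>0) \<and>
     \<tau> id = 1"

text \<open>The least upper bound of a bounded upward directed family of self-adjoint elements of \<open>M\<close> is
  its strong limit and lies in \<open>M\<close>, so it does not matter that \<^const>\<open>op_lub\<close> is taken among all
  self-adjoint operators.\<close>

definition normal_on :: "'i op set \<Rightarrow> ('i op \<Rightarrow> complex) \<Rightarrow> bool" where
  "normal_on M \<tau> \<longleftrightarrow>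
     (\<forall>D T. D \<subseteq> M \<and> D \<noteq> {} \<and> (\<forall>S\<in>D. self_adjoint S) \<and>
        (\<forall>S\<in>D. \<forall>S'\<in>D. \<exists>S''\<in>D. op_le S S'' \<and> op_le S' S'') \<and> op_lub D T \<longrightarrow>
        Re (\<tau> T) = (SUP S\<in>D. Re (\<tau> S)))"

definition faithful_on :: "'i op set \<Rightarrow> ('i op \<Rightarrow> complex) \<Rightarrow> bool" where
  "faithful_on M \<tau> \<longleftrightarrow> (\<forall>T\<in>M. positive_op T \<and> \<tau> T = 0 \<longrightarrow> T = (\<lambda>_. 0))"

definition tracial_on :: "'i op set \<Rightarrow> ('i op \<Rightarrow> complex) \<Rightarrow> bool" where
  "tracial_on M \<tau> \<longleftrightarrow> (\<forall>S\<in>M. \<forall>T\<in>M. \<tau> (S \<circ> T) = \<tau> (T \<circ> S))"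

definition tracial_vN_algebra :: "'i op set \<Rightarrow> ('i op \<Rightarrow> complex) \<Rightarrow> bool" where
  "tracial_vN_algebra M \<tau> \<longleftrightarrow> von_neumann_algebra M \<and>
     state_on M \<tau> \<and> normal_on M \<tau> \<and> faithful_on M \<tau> \<and> tracial_on M \<tau>"

section \<open>Free independence and free multiplicative convolution\<close>

definition generated_algebra :: "'i op \<Rightarrow> 'i op set" where
  "generated_algebra T = {\<lambda>x. \<Sum>k\<le>n. c k *\<^sub>C (T ^^ k) x | (n :: nat) (c :: nat \<Rightarrow> complex). True}"

definition freely_independent :: "('i op \<Rightarrow> complex) \<Rightarrow> ('j \<Rightarrow> 'i op set) \<Rightarrow> bool" where
  "freely_independent \<tau> A \<longleftrightarrow>
     (\<forall>n (j :: nat \<Rightarrow> 'j) (T :: nat \<Rightarrow> 'i op).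
        n \<ge> 1 \<and> (\<forall>k<n. T k \<in> A (j k) \<and> \<tau> (T k) = 0) \<and> (\<forall>k. Suc k < n \<longrightarrow> j k \<noteq> j (Suc k)) \<longrightarrow>
        \<tau> (foldr (\<circ>) (map T [0..<n]) id) = 0)"

definition free_pair :: "('i op \<Rightarrow> complex) \<Rightarrow> 'i op \<Rightarrow> 'i op \<Rightarrow> bool" where
  "free_pair \<tau> a b \<longleftrightarrow>
     freely_independent \<tau> (\<lambda>left :: bool. generated_algebra (if left then a else b))"

definition compactly_supported :: "real measure \<Rightarrow> bool" where
  "compactly_supported \<nu> \<longleftrightarrow> (\<exists>K. AE x in \<nu>. \<bar>x\<bar> \<le> K)"

text \<open>The distribution of a self-adjoint element is the unique compactly supported probability
  measure on the line with the same moments.\<close>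

definition has_distribution :: "('i op \<Rightarrow> complex) \<Rightarrow> 'i op \<Rightarrow> real measure \<Rightarrow> bool" where
  "has_distribution \<tau> T \<nu> \<longleftrightarrow>
     prob_space \<nu> \<and> sets \<nu> = sets borel \<and> compactly_supported \<nu> \<and>
     (\<forall>n. \<tau> (T ^^ n) = complex_of_real (\<integral>x. x ^ n \<partial>\<nu>))"

text \<open>The operator \<open>c\<close> below is the positive square root of \<open>a\<close>; it lies in \<open>M\<close>
  automatically.  The result depends only on \<open>\<nu>\<^sub>1\<close> and \<open>\<nu>\<^sub>2\<close>, and compactly supported measures can
  always be realised on a separable Hilbert space (amplified to an infinite-dimensional one if
  necessary), so that nothing is lost by working on \<open>nat ell2\<close>.\<close>

definition free_mult_conv :: "real measure \<Rightarrow> real measure \<Rightarrow> real measure" (infixl "\<boxtimes>" 70) where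
  "\<nu>\<^sub>1 \<boxtimes> \<nu>\<^sub>2 = (THE \<nu>. \<exists>(M :: nat op set) \<tau> a b c.
      tracial_vN_algebra M \<tau> \<and> a \<in> M \<and> b \<in> M \<and> c \<in> M \<and>
      positive_op a \<and> self_adjoint b \<and> free_pair \<tau> a b \<and>
      has_distribution \<tau> a \<nu>\<^sub>1 \<and> has_distribution \<tau> b \<nu>\<^sub>2 \<and>
      positive_op c \<and> c \<circ> c = a \<and> has_distribution \<tau> (c \<circ> b \<circ> c) \<nu>)"

section \<open>Non-crossing pair partitions and the moment sequence\<close>

definition noncrossing :: "nat set set \<Rightarrow> bool" where
  "noncrossing P \<longleftrightarrow>
     \<not> (\<exists>A\<in>P. \<exists>B\<in>P. A \<noteq> B \<and> (\<exists>a\<in>A. \<exists>b\<in>B. \<exists>c\<in>A. \<exists>d\<in>B. a < b \<and> b < c \<and> c < d))"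

definition NC2 :: "nat \<Rightarrow> nat set set set" where
  "NC2 n = {\<sigma>. partition_on {1..n} \<sigma> \<and> (\<forall>B\<in>\<sigma>. card B = 2) \<and> noncrossing \<sigma>}"

text \<open>The ordered set of points and barred points is embedded into the naturals by sending \<open>i\<close> to
  \<open>2 * i\<close> and \<open>i\<close> barred to \<open>2 * i + 1\<close>.\<close>

definition interleave :: "nat set set \<Rightarrow> nat set set \<Rightarrow> nat set set" where
  "interleave \<sigma> \<pi> = (\<lambda>B. (\<lambda>i. 2 * i) ` B) ` \<sigma> \<union> (\<lambda>B. (\<lambda>i. 2 * i + 1) ` B) ` \<pi>"

definition kreweras :: "nat \<Rightarrow> nat set set \<Rightarrow> nat set set" where
  "kreweras n \<sigma> = (THE \<pi>. partition_on {1..n} \<pi> \<and> noncrossing (interleave \<sigma> \<pi>) \<and>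
     (\<forall>\<pi>'. partition_on {1..n} \<pi>' \<and> noncrossing (interleave \<sigma> \<pi>') \<longrightarrow> refines {1..n} \<pi>' \<pi>))"

text \<open>Vectors indexed by \<open>{1..n}\<close> are extensional functions, so that each one is counted once.
  The order in which the two elements of a pair are fed to \<open>R\<close> is immaterial, \<open>R\<close> being symmetric.\<close>

definition S_set :: "nat \<Rightarrow> nat set set \<Rightarrow> (nat \<Rightarrow> int) set" where
  "S_set n \<sigma> = {k \<in> {1..n} \<rightarrow>\<^sub>E (UNIV :: int set). \<forall>V\<in>kreweras n \<sigma>. (\<Sum>j\<in>V. k j) = 0}"

definition beta :: "(int \<Rightarrow> int \<Rightarrow> real) \<Rightarrow> nat \<Rightarrow> real" where
  "beta R n = (\<Sum>\<sigma>\<in>NC2 n. \<Sum>\<^sub>\<infinity>k\<in>S_set n \<sigma>. \<Prod>B\<in>\<sigma>. R (k (Min B)) (k (Max B)))"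

section \<open>The spectral density and the two laws\<close>

definition r_fun :: "(int \<Rightarrow> int \<Rightarrow> real) \<Rightarrow> real \<Rightarrow> complex" where
  "r_fun R x = (\<Sum>\<^sub>\<infinity>k\<in>(UNIV :: int set). complex_of_real (R k 0) * exp (- \<i> * of_int k * of_real x))"

definition mu_r :: "(int \<Rightarrow> int \<Rightarrow> real) \<Rightarrow> real measure" where
  "mu_r R = distr (uniform_measure lborel {-pi<..<pi}) borel (\<lambda>x. Re (r_fun R x))"

definition mu_s :: "real measure" where
  "mu_s = density lborel (\<lambda>x. ennreal (sqrt (4 - x\<^sup>2) / (2 * pi) * indicator {x. \<bar>x\<bar> \<le> 2} x))"

end

theory Submission
  imports Defs "HOL-Computational_Algebra.Polynomial"
begin

text \<open>Write \<open>p k = R k 0\<close>, so that \<open>R u v = p u * p v\<close>, where \<open>p\<close> is the covariance function of a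
  stationary process and hence positive definite; this gives \<open>r \<ge> 0\<close>.

  A concrete free pair is realised on the Fock space with the words over \<open>\<int>\<close> as orthonormal basis:
  \<open>a\<close> is convolution with \<open>p\<close> on the first letter, which has the law of \<open>r(U)\<close>, and \<open>b\<close> is the sum of
  the creation and annihilation operators, which is semicircular and free from \<open>a\<close>.  The ambient von
  Neumann algebra is the commutant of the analogous operators acting on the last letter; they commute
  with \<open>a\<close> and \<open>b\<close>, and the vacuum is cyclic for them, so that the vacuum state is a faithful normal
  trace.

  The moments of \<open>b a\<close> expand into sums over \<open>k\<close> of vacuum expectations of words in \<open>b\<close> and the shifts
  by \<open>k\<^sub>i\<close>.  Since the commutator of \<open>b\<close> with right annihilation is the vacuum projection, these
  expectations satisfy a Schwinger-Dyson recursion, and splitting a non-crossing pairing at the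
  partner of its first point shows that the number of pairings whose Kreweras blocks have sum zero
  satisfies the same recursion.  Hence the moments are those of \<open>\<mu>\<close>.  Freeness determines the joint
  moments in every realisation, and a compactly supported measure is determined by its moments, so
  that the description in the definition of \<open>\<boxtimes>\<close> singles out \<open>\<mu>\<close>.\<close>

section \<open>Operators on square-summable families\<close>

text \<open>With \<open>R u v = p u * p v\<close> the weight of a vector \<open>k\<close> is the
  product of all \<open>p (k i)\<close>, the same for every pairing. So \<open>beta R n\<close> is a
  weighted sum over \<open>k\<close> of the number of pairings that admit \<open>k\<close>, and this
  number has to match a vacuum expectation. Both quantities carry an extra integer \<open>c\<close>,
  the sum already collected by the outer block; without it the recursion does not close.

  The convolution is a definite description, so one realisation must satisfy every axiom of a
  tracial von Neumann algebra. Taking the algebra to be a commutant makes bicommutant closure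
  formal, at the price that its elements are known only through their commutation with the right
  operators; the trace property and faithfulness are derived from this.

  The description involves the square root of \<open>a\<close>. The trace property replaces the
  moments of the sandwiched product by those of \<open>b\<close> times \<open>a\<close>, so the root
  enters only through its existence in the algebra.

  Finally \<open>\<mu>\<close> is given by its symmetry and its even moments alone. That it has
  compact support is deduced from a norm bound for the sandwiched operator; both the description and
  the uniqueness argument require it.\<close>

instance ell2 :: (type) banach ..

lemma ell2_eqI: "(\<And>i. coord x i = coord y i) \<Longrightarrow> x = y"
  by (simp add: coord_inject[symmetric] fun_eq_iff)

section \<open>Vector space structure and inner product in coordinates\<close>

lemma coord_simps [simp]:
  "coord 0 i = 0" "coord (x + y) i = coord x i + coord y i"
  "coord (x - y) i = coord x i - coord y i" "coord (- x) i = - coord x i"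
  "coord (c *\<^sub>C x) i = c * coord x i" "coord (r *\<^sub>R x) i = of_real r * coord x i"
  by (simp_all add: zero_ell2.rep_eq plus_ell2.rep_eq minus_ell2.rep_eq uminus_ell2.rep_eq
      scaleC.rep_eq scaleR_ell2_def)

lemma coord_sum [simp]: "coord (sum f A) i = (\<Sum>a\<in>A. coord (f a) i)"
  by (induction A rule: infinite_finite_induct) simp_all

lemma scaleC_simps [simp]:
  "1 *\<^sub>C x = x" "0 *\<^sub>C x = 0" "c *\<^sub>C 0 = 0" "c *\<^sub>C d *\<^sub>C x = (c * d) *\<^sub>C x"
  "c *\<^sub>C (- x) = - (c *\<^sub>C x)" "(- c) *\<^sub>C x = - (c *\<^sub>C x)"
  by (rule ell2_eqI; simp)+

lemma scaleC_distribs: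
  "c *\<^sub>C (x + y) = c *\<^sub>C x + c *\<^sub>C y" "c *\<^sub>C (x - y) = c *\<^sub>C x - c *\<^sub>C y"
  "(c + d) *\<^sub>C x = c *\<^sub>C x + d *\<^sub>C x" "(c - d) *\<^sub>C x = c *\<^sub>C x - d *\<^sub>C x"
  by (rule ell2_eqI; simp add: algebra_simps)+

lemma scaleR_scaleC: "r *\<^sub>R x = of_real r *\<^sub>C x"
  by (simp add: scaleR_ell2_def)

lemma scaleC_sum: "c *\<^sub>C sum f A = (\<Sum>a\<in>A. c *\<^sub>C f a)"
  by (rule ell2_eqI) (simp add: sum_distrib_left)

lemma cinner_simps [simp]:
  "cinner (x + y) z = cinner x z + cinner y z" "cinner z (x + y) = cinner z x + cinner z y"
  "cinner (c *\<^sub>C x) y = cnj c * cinner x y" "cinner x (c *\<^sub>C y) = c * cinner x y"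
  subgoal by (rule cinner_add_left)
  subgoal by (subst (1 2 3) cinner_commute) (simp add: cinner_add_left)
  subgoal by (rule cinner_scaleC_left)
  subgoal by (subst (1 2) cinner_commute) (simp add: cinner_scaleC_left)
  done

lemma cinner_zero [simp]: "cinner 0 x = 0" "cinner x 0 = 0"
  using cinner_simps(3)[of 0 0 x] cinner_simps(4)[of x 0 0] by simp_all

lemma cinner_minus [simp]:
  "cinner (- x) y = - cinner x y" "cinner x (- y) = - cinner x y"
  "cinner (x - y) z = cinner x z - cinner y z" "cinner z (x - y) = cinner z x - cinner z y"
proof -
  show *: "cinner (- x) y = - cinner x y" "cinner x (- y) = - cinner x y" for x y
    using cinner_simps(3)[of "-1" x y] cinner_simps(4)[of x "-1" y] by simp_all
  show "cinner (x - y) z = cinner x z - cinner y z" "cinner z (x - y) = cinner z x - cinner z y"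
    using cinner_simps(1)[of x "- y" z] cinner_simps(2)[of z x "- y"] by (simp_all add: *)
qed

lemma cinner_sum: 
  "cinner (sum f A) y = (\<Sum>a\<in>A. cinner (f a) y)" "cinner y (sum f A) = (\<Sum>a\<in>A. cinner y (f a))"
  by (induction A rule: infinite_finite_induct) simp_all

lemma cinner_self_norm: "cinner x x = of_real ((norm x)\<^sup>2)"
  by (simp add: cinner_self norm_ell2_square)

lemma cnj_cinner [simp]: "cnj (cinner x y) = cinner y x"
  using cinner_commute[of y x] by simp

lemma cmod_power2_mult: "z * cnj z = complex_of_real (cmod z) * complex_of_real (cmod z)"
  using complex_norm_square[of z] by (simp add: power2_eq_square)

lemma norm_scaleC: "norm (c *\<^sub>C x) = cmod c * norm x"
proof -
  have "complex_of_real ((norm (c *\<^sub>C x))\<^sup>2) = of_real ((cmod c * norm x)\<^sup>2)"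
    by (simp add: cinner_self_norm[symmetric] power_mult_distrib complex_norm_square del: of_real_power)
  hence "(norm (c *\<^sub>C x))\<^sup>2 = (cmod c * norm x)\<^sup>2" using of_real_eq_iff by blast
  thus ?thesis by (simp add: power2_eq_iff_nonneg)
qed

lemma cmod_cinner_le: "cmod (cinner x y) \<le> norm x * norm y"
proof -
  let ?z = "cinner x y"
  \<comment> \<open>Rotating \<open>x\<close> by the phase of the inner product makes it real and
    nonnegative, so that the real Cauchy-Schwarz inequality of the type class applies.\<close>
  have "cnj (sgn ?z) * ?z = of_real (cmod ?z)"
    by (cases "?z = 0")
      (simp_all add: sgn_eq cmod_power2_mult divide_simps mult.commute[of "cnj _"] del: cnj_cinner)
  hence "cmod ?z = Re (cinner (sgn ?z *\<^sub>C x) y)" by simp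
  also have "\<dots> = inner (sgn ?z *\<^sub>C x) y" by (simp add: inner_ell2_def)
  also have "\<dots> \<le> norm (sgn ?z *\<^sub>C x) * norm y" by (rule norm_cauchy_schwarz)
  also have "\<dots> \<le> norm x * norm y"
    by (intro mult_right_mono) (auto simp: norm_scaleC norm_sgn)
  finally show ?thesis .
qed

lemma bounded_linear_cinner: "bounded_linear (cinner x)" "bounded_linear (\<lambda>x. cinner x y)"
proof -
  show "bounded_linear (cinner x)"
    by (rule bounded_linear_intro[where K = "norm x"])
      (auto simp: scaleR_scaleC scaleR_conv_of_real mult.commute[of _ "norm x"] cmod_cinner_le)
  show "bounded_linear (\<lambda>x. cinner x y)"
    by (rule bounded_linear_intro[where K = "norm y"])
      (auto simp: scaleR_scaleC scaleR_conv_of_real cmod_cinner_le)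
qed

lemma bounded_linear_scaleC: "bounded_linear (scaleC c)"
  by (rule bounded_linear_intro[where K = "cmod c"])
    (auto simp: scaleR_scaleC scaleC_distribs norm_scaleC mult.commute)

lemma cinner_eqI: "(\<And>y. cinner y x = cinner y x') \<Longrightarrow> x = x'"
  using cinner_self_norm[of "x - x'"] by simp

section \<open>The standard orthonormal basis\<close>

definition ket :: "'i \<Rightarrow> 'i ell2" where
  "ket i = Abs_ell2 (\<lambda>j. if j = i then 1 else 0)"

lemma coord_ket: "coord (ket i) j = (if j = i then 1 else 0)"
proof -
  have "(\<lambda>j. (cmod (if j = i then 1 else 0))\<^sup>2) summable_on (UNIV :: 'a set)"
    by (rule finite_nonzero_values_imp_summable_on) (rule finite_subset[of _ "{i}"], auto)
  thus ?thesis by (simp add: ket_def Abs_ell2_inverse)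
qed

lemma cinner_ket: "cinner (ket i) x = coord x i"
proof -
  have "cinner (ket i) x = (\<Sum>\<^sub>\<infinity>j\<in>{i}. cnj (coord (ket i) j) * coord x j)"
    unfolding cinner.rep_eq by (rule infsum_cong_neutral) (auto simp: coord_ket)
  thus ?thesis by (simp add: coord_ket)
qed

lemma cinner_ket_right: "cinner x (ket i) = cnj (coord x i)"
  by (subst cinner_commute) (simp add: cinner_ket del: cnj_cinner)

text \<open>Pythagoras: the squared distance from \<open>x\<close> to its partial sum over
  \<open>F\<close> is the remainder of a convergent series of squares.\<close>

lemma ket_has_sum: "((\<lambda>i. coord x i *\<^sub>C ket i) has_sum x) UNIV"
  unfolding has_sum_def tendsto_iff
proof (intro allI impI)
  fix e :: real assume "e > 0"
  define P where "P F = (\<Sum>i\<in>F. coord x i *\<^sub>C ket i)" for F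
  have P: "(norm (x - P F))\<^sup>2 = (norm x)\<^sup>2 - (\<Sum>i\<in>F. (cmod (coord x i))\<^sup>2)" if "finite F" for F
  proof -
    have co: "coord (P F) i = (if i \<in> F then coord x i else 0)" for i
      using that by (simp add: P_def coord_ket if_distrib cong: if_cong)
    have "cinner (P F) y = (\<Sum>i\<in>F. cnj (coord x i) * coord y i)" for y
      by (simp add: P_def cinner_sum cinner_ket)
    hence 1: "cinner (P F) x = of_real (\<Sum>i\<in>F. (cmod (coord x i))\<^sup>2)"
        and 2: "cinner (P F) (P F) = of_real (\<Sum>i\<in>F. (cmod (coord x i))\<^sup>2)"
      by (auto simp: complex_norm_square co mult.commute simp del: of_real_power intro!: sum.cong)
    have 3: "cinner x (P F) = of_real (\<Sum>i\<in>F. (cmod (coord x i))\<^sup>2)"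
      by (subst cinner_commute, subst 1) simp
    have "complex_of_real ((norm (x - P F))\<^sup>2) = 
       of_real ((norm x)\<^sup>2 - (\<Sum>i\<in>F. (cmod (coord x i))\<^sup>2))"
      unfolding cinner_self_norm[symmetric] by (simp add: 1 2 3) (simp add: cinner_self_norm)
    thus ?thesis using of_real_eq_iff by blast
  qed
  have "((\<lambda>i. (cmod (coord x i))\<^sup>2) has_sum (norm x)\<^sup>2) UNIV"
    unfolding norm_ell2_square by (rule has_sum_infsum[OF summable_coord])
  from this[unfolded has_sum_def tendsto_iff, rule_format, of "e\<^sup>2"] \<open>e > 0\<close>
  have "\<forall>\<^sub>F F in finite_subsets_at_top UNIV. dist (\<Sum>i\<in>F. (cmod (coord x i))\<^sup>2) ((norm x)\<^sup>2) < e\<^sup>2"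
    by simp
  moreover have "\<forall>\<^sub>F F in finite_subsets_at_top (UNIV :: 'a set). finite F"
    using eventually_finite_subsets_at_top_weakI by blast
  ultimately show "\<forall>\<^sub>F F in finite_subsets_at_top UNIV. dist (\<Sum>i\<in>F. coord x i *\<^sub>C ket i) x < e"
  proof eventually_elim
    case (elim F)
    have "(norm (x - P F))\<^sup>2 < e\<^sup>2" using elim P[of F] by (simp add: dist_real_def)
    hence "norm (x - P F) < e" using \<open>e > 0\<close> by (simp add: power2_less_imp_less)
    thus ?case by (simp add: dist_norm norm_minus_commute P_def)
  qed
qed

section \<open>Bounded operators and adjoints\<close>

lemma bounded_opI:
  assumes "\<And>x y. T (x + y) = T x + T y" "\<And>c x. T (c *\<^sub>C x) = c *\<^sub>C T x" "\<And>x. norm (T x) \<le> K * norm x"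
  shows "bounded_op T"
  unfolding bounded_op_def using assms
  by (auto intro!: bounded_linear_intro[of _ K] simp: scaleR_scaleC mult.commute)

lemma bounded_opD:
  assumes "bounded_op T"
  shows "T (x + y) = T x + T y" "T (c *\<^sub>C x) = c *\<^sub>C T x" "T (x - y) = T x - T y" "T (- x) = - T x"
    "T 0 = 0" "T (sum f A) = (\<Sum>a\<in>A. T (f a))" "bounded_linear T" "linear T"
proof -
  have bl: "bounded_linear T" using assms by (simp add: bounded_op_def)
  show "linear T" using bl by (rule bounded_linear.linear)
  from linear_add[OF this] linear_diff[OF this] linear_sum[OF this] linear_0[OF this] linear_neg[OF this]
  show "T (x + y) = T x + T y" "T (x - y) = T x - T y" "T (- x) = - T x" "T 0 = 0"
    "T (sum f A) = (\<Sum>a\<in>A. T (f a))" by simp_all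
qed (use assms in \<open>auto simp: bounded_op_def\<close>)

lemma bounded_op_bound:
  assumes "bounded_op T" obtains K where "K > 0" "\<And>x. norm (T x) \<le> K * norm x"
proof -
  obtain K where "K > 0" "\<And>x. norm (T x) \<le> norm x * K"
    using bounded_linear.pos_bounded[OF bounded_opD(7)[OF assms]] by auto
  thus ?thesis using that[of K] by (simp add: mult.commute)
qed

lemma bounded_op_id [simp]: "bounded_op id" "bounded_op (\<lambda>x. x)"
  by (rule bounded_opI[where K = 1]; simp)+

lemma bounded_op_zero [simp]: "bounded_op (\<lambda>_. 0)"
  by (rule bounded_opI[where K = 1]; simp)

lemma bounded_op_compose: "bounded_op S \<Longrightarrow> bounded_op T \<Longrightarrow> bounded_op (S \<circ> T)"
  unfolding bounded_op_def using bounded_linear_compose[of S T] by (auto simp: o_def)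

lemma bounded_op_add: "bounded_op S \<Longrightarrow> bounded_op T \<Longrightarrow> bounded_op (\<lambda>x. S x + T x)"
  unfolding bounded_op_def by (auto intro: bounded_linear_add simp: scaleC_distribs)

lemma bounded_op_diff: "bounded_op S \<Longrightarrow> bounded_op T \<Longrightarrow> bounded_op (\<lambda>x. S x - T x)"
  unfolding bounded_op_def by (auto intro: bounded_linear_sub simp: scaleC_distribs)

lemma bounded_op_scaleC: "bounded_op T \<Longrightarrow> bounded_op (\<lambda>x. c *\<^sub>C T x)"
  unfolding bounded_op_def
  using bounded_linear_compose[OF bounded_linear_scaleC[of c], of T] by (auto simp: mult.commute)

lemma bounded_op_funpow: "bounded_op T \<Longrightarrow> bounded_op (T ^^ n)"
  by (induction n) (auto intro: bounded_op_compose simp del: comp_apply)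

lemma is_adjoint_sym: "is_adjoint T S \<Longrightarrow> is_adjoint S T"
  unfolding is_adjoint_def by (metis cinner_commute)

lemma is_adjointD: "is_adjoint T S \<Longrightarrow> cinner (T x) y = cinner x (S y)"
  "is_adjoint T S \<Longrightarrow> cinner x (T y) = cinner (S x) y" 
  "is_adjoint T S \<Longrightarrow> bounded_op T" "is_adjoint T S \<Longrightarrow> bounded_op S"
  unfolding is_adjoint_def by (simp_all, metis cinner_commute)

lemma is_adjoint_compose: "is_adjoint S S' \<Longrightarrow> is_adjoint T T' \<Longrightarrow> is_adjoint (S \<circ> T) (T' \<circ> S')"
  unfolding is_adjoint_def by (auto intro: bounded_op_compose)

lemma is_adjoint_add: "is_adjoint S S' \<Longrightarrow> is_adjoint T T' \<Longrightarrow> is_adjoint (\<lambda>x. S x + T x) (\<lambda>x. S' x + T' x)"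
  unfolding is_adjoint_def by (auto intro: bounded_op_add)

lemma is_adjoint_id [simp]: "is_adjoint id id"
  unfolding is_adjoint_def by auto

lemma is_adjoint_funpow: "is_adjoint T S \<Longrightarrow> is_adjoint (T ^^ n) (S ^^ n)"
proof (induction n)
  case (Suc n)
  show ?case using is_adjoint_compose[OF Suc.prems Suc.IH[OF Suc.prems]]
    by (simp only: funpow.simps(2)[of n T] funpow_Suc_right[of n S])
qed auto

text \<open>The value of the adjoint at \<open>y\<close> must have the coefficients
  \<open>f y i\<close>, and the point is their square summability. For the finite vector
  \<open>v\<close> with these coefficients the squared norm of \<open>v\<close> equals
  \<open>cinner (T v) y\<close>, whose modulus is at most
  \<open>K * norm v * norm y\<close>.\<close>

lemma adjoint_exists:
  fixes T :: "'i op"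
  assumes T: "bounded_op T"
  shows "\<exists>S. is_adjoint T S"
proof -
  obtain K where K: "K > 0" "\<And>x. norm (T x) \<le> K * norm x" using bounded_op_bound[OF T] by blast
  define f where "f y i = cinner (T (ket i)) y" for y i
  have bd: "(\<Sum>i\<in>F. (cmod (f y i))\<^sup>2) \<le> (K * norm y)\<^sup>2" if "finite F" for F y
  proof -
    define v where "v = (\<Sum>i\<in>F. f y i *\<^sub>C ket i)"
    define s where "s = (\<Sum>i\<in>F. (cmod (f y i))\<^sup>2)"
    have s0: "s \<ge> 0" unfolding s_def by (rule sum_nonneg) simp
    have co: "coord v i = (if i \<in> F then f y i else 0)" for i
      using that by (simp add: v_def coord_ket if_distrib cong: if_cong)
    have "cinner v v = of_real s"
      by (subst (1) v_def) (auto simp: cinner_sum cinner_ket s_def co complex_norm_square 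
          mult.commute simp del: of_real_power intro!: sum.cong)
    hence nv: "(norm v)\<^sup>2 = s" unfolding cinner_self_norm using of_real_eq_iff by blast
    have "cinner (T v) y = of_real s"
      by (auto simp: v_def bounded_opD[OF T] cinner_sum f_def[symmetric] s_def complex_norm_square
          mult.commute simp del: of_real_power intro!: sum.cong)
    hence "s = cmod (cinner (T v) y)" using s0 by simp
    also have "\<dots> \<le> norm (T v) * norm y" by (rule cmod_cinner_le)
    also have "\<dots> \<le> (K * norm v) * norm y" by (intro mult_right_mono K) auto
    finally have "norm v * norm v \<le> (K * norm y) * norm v"
      using nv by (simp add: power2_eq_square mult_ac)
    hence "norm v \<le> K * norm y"
      using K(1) by (cases "norm v = 0") (auto dest: mult_right_le_imp_le)
    hence "(norm v)\<^sup>2 \<le> (K * norm y)\<^sup>2" by (intro power_mono) auto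
    thus ?thesis using nv s_def by simp
  qed
  have sm: "(\<lambda>i. (cmod (f y i))\<^sup>2) summable_on UNIV" for y
    by (rule nonneg_bdd_above_summable_on) (auto intro!: bdd_aboveI2 bd)
  define S where "S y = Abs_ell2 (f y)" for y
  have co: "coord (S y) i = f y i" for y i
    unfolding S_def using sm[of y] by (simp add: Abs_ell2_inverse)
  have S: "bounded_op S"
  proof (rule bounded_opI[where K = K])
    show "S (x + y) = S x + S y" "S (c *\<^sub>C x) = c *\<^sub>C S x" for x y c
      by (rule ell2_eqI; simp add: co f_def)+
    fix x
    have "(norm (S x))\<^sup>2 \<le> (K * norm x)\<^sup>2"
      unfolding norm_ell2_square co by (rule infsum_le_finite_sums[OF sm bd]) auto
    thus "norm (S x) \<le> K * norm x" using K by (simp add: abs_le_square_iff[symmetric])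
  qed
  have "cinner (T x) y = cinner x (S y)" for x y
  proof -
    have "((\<lambda>i. cinner (T (coord x i *\<^sub>C ket i)) y) has_sum cinner (T x) y) UNIV"
      using has_sum_bounded_linear[OF bounded_linear_compose[OF bounded_linear_cinner(2) bounded_opD(7)[OF T]]
          ket_has_sum] .
    moreover have "((\<lambda>i. cinner (coord x i *\<^sub>C ket i) (S y)) has_sum cinner x (S y)) UNIV"
      by (rule has_sum_bounded_linear[OF bounded_linear_cinner(2) ket_has_sum])
    ultimately show ?thesis
      by (simp add: bounded_opD[OF T] cinner_ket co f_def has_sum_unique)
  qed
  thus ?thesis using S T unfolding is_adjoint_def by blast
qed

lemma op_eq_zeroI:
  assumes T: "bounded_op T" and "\<And>i. T (ket i) = 0"
  shows "T = (\<lambda>_. 0)"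
proof
  fix x
  have "((\<lambda>i. T (coord x i *\<^sub>C ket i)) has_sum T x) UNIV"
    by (rule has_sum_bounded_linear[OF bounded_opD(7)[OF T] ket_has_sum])
  thus "T x = 0" using assms by (simp add: bounded_opD[OF T] has_sum_unique[OF _ has_sum_0])
qed

subsection \<open>Positive operators\<close>

text \<open>Polarisation: reality of the form at \<open>x + y\<close> controls the imaginary part of
  the mixed terms, reality at \<open>x + \<i> *\<^sub>C y\<close> their real part.\<close>

lemma positive_op_self_adjoint:
  assumes "positive_op T" shows "self_adjoint T"
  unfolding self_adjoint_def is_adjoint_def
proof (intro conjI allI)
  show T: "bounded_op T" using assms by (simp add: positive_op_def)
  thus "bounded_op T" .
  fix x y
  define q where "q u v = cinner u (T v)" for u v
  have re: "Im (q v v) = 0" for v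
    using assms by (auto simp: positive_op_def q_def complex_nonneg_Reals_iff)
  have q: "q (u + v) w = q u w + q v w" "q w (u + v) = q w u + q w v" 
    "q (c *\<^sub>C u) w = cnj c * q u w" "q u (c *\<^sub>C w) = c * q u w" for u v w c
    by (simp_all add: q_def bounded_opD[OF T])
  have "Im (q x y + q y x) = 0" using re[of "x + y"] re[of x] re[of y] by (simp add: q)
  moreover have "Re (q x y - q y x) = 0"
    using re[of "x + \<i> *\<^sub>C y"] re[of x] re[of y] by (simp add: q)
  ultimately have "cnj (q y x) = q x y" by (simp add: complex_eq_iff)
  thus "cinner (T x) y = cinner x (T y)" by (simp add: q_def)
qed

lemma positive_op_Re: "positive_op T \<Longrightarrow> cinner x (T x) = of_real (Re (cinner x (T x)))"
  "positive_op T \<Longrightarrow> 0 \<le> Re (cinner x (T x))"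
  by (auto simp: positive_op_def complex_nonneg_Reals_iff complex_eq_iff)

lemma positive_op_cauchy_schwarz:
  assumes T: "positive_op T"
  shows "(cmod (cinner x (T y)))\<^sup>2 \<le> Re (cinner x (T x)) * Re (cinner y (T y))"
proof -
  define a b d where "a = Re (cinner x (T x))" and "b = (cmod (cinner x (T y)))\<^sup>2"
    and "d = Re (cinner y (T y))"
  have nn: "a \<ge> 0" "d \<ge> 0" "b \<ge> 0" using positive_op_Re[OF T] by (auto simp: a_def b_def d_def)
  have T': "bounded_op T" using T by (simp add: positive_op_def)
  have sa: "cinner y (T x) = cnj (cinner x (T y))"
    using is_adjointD(1)[OF positive_op_self_adjoint[OF T, unfolded self_adjoint_def], of y x] by simp
  have q: "a - 2 * t * b + t\<^sup>2 * b * d \<ge> 0" for t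
  proof -
    \<comment> \<open>This phase makes the form at \<open>x + c *\<^sub>C y\<close> a real quadratic
      polynomial in \<open>t\<close>.\<close>
    define c where "c = - of_real t * cnj (cinner x (T y))"
    have "cinner (x + c *\<^sub>C y) (T (x + c *\<^sub>C y)) =
        cinner x (T x) + c * cinner x (T y) + cnj (c * cinner x (T y)) + (c * cnj c) * cinner y (T y)"
      by (simp add: bounded_opD[OF T'] sa algebra_simps del: cnj_cinner)
    also have "c * cinner x (T y) = of_real (- t * b)"
      by (simp add: c_def b_def complex_norm_square mult_ac del: of_real_power cnj_cinner)
    also have "c * cnj c = of_real (t\<^sup>2 * b)"
      by (simp add: c_def b_def cmod_power2_mult mult_ac power2_eq_square del: cnj_cinner)
    finally have "Re (cinner (x + c *\<^sub>C y) (T (x + c *\<^sub>C y))) = a - 2 * t * b + t\<^sup>2 * b * d"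
      by (simp add: a_def d_def)
    thus ?thesis using positive_op_Re(2)[OF T, of "x + c *\<^sub>C y"] by simp
  qed
  have "b \<le> a * d"
  proof (cases "d = 0")
    case True
    show ?thesis
    proof (cases "b = 0")
      case False
      \<comment> \<open>For \<open>d = 0\<close> the polynomial is affine in \<open>t\<close>, and
        this \<open>t\<close> gives it the value -1.\<close>
      with q[of "(a + 1) / (2 * b)"] True nn show ?thesis by simp
    qed (use nn in auto)
  next
    case False
    with q[of "1 / d"] nn have "0 \<le> a - b / d"
      by (simp add: power2_eq_square divide_simps split: if_splits)
    thus ?thesis using False nn by (simp add: field_simps)
  qed
  thus ?thesis by (simp add: a_def b_def d_def)
qed

lemma positive_op_null: "positive_op T \<Longrightarrow> Re (cinner x (T x)) = 0 \<Longrightarrow> T x = 0"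
  using positive_op_cauchy_schwarz[of T "T x" x] by (simp add: cinner_self_norm)

text \<open>Cauchy-Schwarz for the form of \<open>T\<close>, with \<open>T x\<close> as one of the
  vectors, bounds the fourth power of \<open>norm (T x)\<close>. The version that keeps
  \<open>cinner x (T x)\<close> turns small quadratic forms into small vectors, as needed for
  normality.\<close>

lemma positive_op_norm_le:
  assumes T: "positive_op T" and K: "\<And>x. Re (cinner x (T x)) \<le> K * (norm x)\<^sup>2" "K \<ge> 0"
  shows "(norm (T x))\<^sup>2 \<le> K * Re (cinner x (T x))" "norm (T x) \<le> K * norm x"
proof -
  let ?y = "T x"
  have "((norm ?y)\<^sup>2)\<^sup>2 = (cmod (cinner ?y (T x)))\<^sup>2"
    by (simp only: cinner_self_norm norm_of_real) simp
  also have "\<dots> \<le> Re (cinner ?y (T ?y)) * Re (cinner x (T x))" by (rule positive_op_cauchy_schwarz[OF T])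
  also have "\<dots> \<le> K * (norm ?y)\<^sup>2 * Re (cinner x (T x))"
    by (intro mult_right_mono K positive_op_Re(2)[OF T])
  finally have "(norm ?y)\<^sup>2 * (norm ?y)\<^sup>2 \<le> (K * Re (cinner x (T x))) * (norm ?y)\<^sup>2"
    by (simp add: power2_eq_square mult_ac)
  thus 1: "(norm ?y)\<^sup>2 \<le> K * Re (cinner x (T x))"
    using K(2) positive_op_Re(2)[OF T, of x] mult_right_le_imp_le[of "(norm ?y)\<^sup>2" "(norm ?y)\<^sup>2"]
    by (cases "?y = 0") auto
  also have "\<dots> \<le> K * (K * (norm x)\<^sup>2)" by (intro mult_left_mono K)
  finally have "(norm ?y)\<^sup>2 \<le> (K * norm x)\<^sup>2" by (simp add: power2_eq_square mult_ac)
  thus "norm ?y \<le> K * norm x" using K(2) by (simp add: abs_le_square_iff[symmetric])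
qed

text \<open>Serves both the binomial series of the square root and convolution by a summable
  sequence. The sum is taken at each vector, where it converges absolutely if \<open>q\<close> is
  absolutely summable and the \<open>T k\<close> are contractions.\<close>

definition op_series :: "('k \<Rightarrow> real) \<Rightarrow> ('k \<Rightarrow> 'i op) \<Rightarrow> 'i op" where
  "op_series q T x = (\<Sum>\<^sub>\<infinity>k. of_real (q k) *\<^sub>C T k x)"

context
  fixes q :: "'k \<Rightarrow> real" and T :: "'k \<Rightarrow> 'i op"
  assumes q: "(\<lambda>k. \<bar>q k\<bar>) summable_on UNIV"
    and bT: "\<And>k. bounded_op (T k)" and contr: "\<And>k x. norm (T k x) \<le> norm x"
begin

lemma op_series_abs_summable: "(\<lambda>k. norm (of_real (q k) *\<^sub>C T k x)) summable_on UNIV"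
  by (rule summable_on_comparison_test[OF summable_on_cmult_left[OF q, of "norm x"]])
    (auto simp: norm_scaleC intro!: mult_left_mono contr)

lemma op_series_has_sum: "((\<lambda>k. of_real (q k) *\<^sub>C T k x) has_sum op_series q T x) UNIV"
  unfolding op_series_def by (rule has_sum_infsum[OF abs_summable_summable[OF op_series_abs_summable]])

lemma bounded_op_series: "bounded_op (op_series q T)"
proof (rule bounded_opI[where K = "\<Sum>\<^sub>\<infinity>k. \<bar>q k\<bar>"])
  show "op_series q T (x + y) = op_series q T x + op_series q T y" for x y
    using has_sum_unique[OF op_series_has_sum[of "x + y"]] has_sum_add[OF op_series_has_sum[of x] op_series_has_sum[of y]]
    by (simp add: bounded_opD[OF bT] scaleC_distribs)
  show "op_series q T (c *\<^sub>C x) = c *\<^sub>C op_series q T x" for c x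
    using has_sum_unique[OF op_series_has_sum[of "c *\<^sub>C x"]]
      has_sum_bounded_linear[OF bounded_linear_scaleC op_series_has_sum[of x], of c]
    by (simp add: bounded_opD[OF bT] mult.commute)
  show "norm (op_series q T x) \<le> (\<Sum>\<^sub>\<infinity>k. \<bar>q k\<bar>) * norm x" for x
  proof -
    have "norm (op_series q T x) \<le> (\<Sum>\<^sub>\<infinity>k. norm (of_real (q k) *\<^sub>C T k x))"
      unfolding op_series_def by (rule norm_infsum_bound[OF op_series_abs_summable])
    also have "\<dots> \<le> (\<Sum>\<^sub>\<infinity>k. \<bar>q k\<bar> * norm x)"
      by (intro infsum_mono op_series_abs_summable summable_on_cmult_left q)
        (auto simp: norm_scaleC intro!: mult_left_mono contr)
    finally show ?thesis using q by (simp add: infsum_cmult_left)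
  qed
qed

lemma cinner_op_series: "((\<lambda>k. of_real (q k) * cinner y (T k x)) has_sum cinner y (op_series q T x)) UNIV"
  using has_sum_bounded_linear[OF bounded_linear_cinner(1) op_series_has_sum, of y x] by simp

lemma op_series_commute:
  assumes S: "bounded_op S" "\<And>k x. S (T k x) = T k (S x)"
  shows "S (op_series q T x) = op_series q T (S x)"
  using has_sum_unique[OF has_sum_bounded_linear[OF bounded_opD(7)[OF S(1)] op_series_has_sum[of x]]]
    op_series_has_sum[of "S x"] by (simp add: bounded_opD[OF S(1)] S(2))

end

section \<open>The square root of a positive operator\<close>

lemma positive_op_funpow_self_adjoint:
  "positive_op T \<Longrightarrow> cinner ((T ^^ n) x) y = cinner x ((T ^^ n) y)"
  using is_adjoint_funpow[OF positive_op_self_adjoint[unfolded self_adjoint_def]] is_adjointD(1) by blast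

text \<open>These are the coefficients of \<open>sqrt (1 - t)\<close>. All but the first are
  nonpositive, so their absolute values add up to 1 minus a partial sum at \<open>t = 1\<close>, and
  that partial sum is \<open>pochhammer (1/2) N / fact N\<close>.\<close>

lemma sum_abs_binomial_half:
  "(\<Sum>n\<in>{1..N}. \<bar>(-1) ^ n * ((1/2::real) gchoose n)\<bar>) \<le> 1"
  "n \<ge> 1 \<Longrightarrow> (-1) ^ n * ((1/2::real) gchoose n) \<le> 0"
proof -
  have *: "(-1) ^ n * (a gchoose n) = pochhammer (- a) n / fact n" for a :: real and n
    by (simp add: gbinomial_pochhammer mult.assoc[symmetric] power_mult_distrib[symmetric])
  have neg: "(-1) ^ n * ((1/2::real) gchoose n) \<le> 0" if "n \<ge> 1" for n
  proof -
    have m: "n = Suc (n - 1)" using that by simp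
    define m where "m = n - 1"
    note m = m[folded m_def]
    have "pochhammer (1/2 :: real) m \<ge> 0" by (simp add: pochhammer_nonneg)
    thus ?thesis unfolding * m pochhammer_rec by (simp add: field_simps)
  qed
  show "n \<ge> 1 \<Longrightarrow> (-1) ^ n * ((1/2::real) gchoose n) \<le> 0" by (rule neg)
  have "(\<Sum>n\<in>{1..N}. \<bar>(-1) ^ n * ((1/2::real) gchoose n)\<bar>) = - (\<Sum>n\<in>{1..N}. (-1) ^ n * ((1/2::real) gchoose n))"
    unfolding sum_negf[symmetric] by (intro sum.cong refl abs_of_nonpos neg) simp
  also have "\<dots> = 1 - (\<Sum>n\<le>N. ((1/2::real) gchoose n) * (-1) ^ n)"
    by (subst atMost_atLeast0, subst sum.atLeast_Suc_atMost) (simp_all add: mult.commute)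
  also have "(\<Sum>n\<le>N. ((1/2::real) gchoose n) * (-1) ^ n) = (-1) ^ N * ((1/2 - 1) gchoose N)"
    by (rule gbinomial_sum_lower_neg)
  also have "\<dots> = pochhammer (1/2) N / fact N" by (subst *) simp
  also have "1 - \<dots> \<le> 1" by (simp add: pochhammer_nonneg)
  finally show "(\<Sum>n\<in>{1..N}. \<bar>(-1) ^ n * ((1/2::real) gchoose n)\<bar>) \<le> 1" .
qed

text \<open>The series of \<open>sqrt (1 - t)\<close> squares to \<open>1 - t\<close>; Vandermonde's
  identity reduces the coefficients to binomials of exponent 1.\<close>

lemma binomial_half_convolution:
  "(\<Sum>k\<le>n. ((-1) ^ k * ((1/2::real) gchoose k)) * ((-1) ^ (n - k) * ((1/2) gchoose (n - k)))) =
     (if n = 0 then 1 else if n = 1 then - 1 else 0)"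
proof -
  have "(\<Sum>k\<le>n. ((-1) ^ k * ((1/2::real) gchoose k)) * ((-1) ^ (n - k) * ((1/2) gchoose (n - k)))) =
     (-1) ^ n * (\<Sum>k\<le>n. ((1/2::real) gchoose k) * ((1/2) gchoose (n - k)))"
    unfolding sum_distrib_left
  proof (rule sum.cong)
    fix k assume "k \<in> {..n}"
    hence "(-1 :: real) ^ n = (-1) ^ k * (-1) ^ (n - k)" by (simp flip: power_add)
    thus "((-1) ^ k * ((1/2::real) gchoose k)) * ((-1) ^ (n - k) * ((1/2) gchoose (n - k))) =
        (-1) ^ n * (((1/2::real) gchoose k) * ((1/2) gchoose (n - k)))" by simp
  qed simp
  also have "\<dots> = (-1) ^ n * (1 gchoose n)"
    using gbinomial_Vandermonde[of "1/2::real" "1/2" n] by (simp add: atMost_atLeast0)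
  also have "(1 :: real) gchoose n = of_nat (1 choose n)"
    by (simp add: binomial_gbinomial)
  finally show ?thesis by (auto simp: binomial_eq_0)
qed

text \<open>The square root is given by the binomial series of \<open>sqrt (1 - t)\<close> at \<open>t = 1 - T / K\<close>, whose
  coefficients are absolutely summable.\<close>

lemma positive_op_sqrt:
  fixes T :: "'i op"
  assumes T: "positive_op T"
  obtains c where "positive_op c" "c \<circ> c = T" 
    "\<And>S. bounded_op S \<Longrightarrow> S \<circ> T = T \<circ> S \<Longrightarrow> S \<circ> c = c \<circ> S"
proof -
  have bT: "bounded_op T" using T by (simp add: positive_op_def)
  obtain K where K: "K > 0" "\<And>x. norm (T x) \<le> K * norm x" using bounded_op_bound[OF bT] by blast
  \<comment> \<open>The choice of \<open>K\<close> places \<open>B\<close> between 0 and 1, hence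
    its powers are contractions.\<close>
  define B where "B x = x - of_real (1 / K) *\<^sub>C T x" for x
  have bB: "bounded_op B"
    unfolding B_def by (intro bounded_op_diff bounded_op_scaleC bounded_op_id bT)
  have cT: "Re (cinner x (T x)) \<le> K * (norm x)\<^sup>2" for x
  proof -
    have "Re (cinner x (T x)) \<le> cmod (cinner x (T x))" by (rule complex_Re_le_cmod)
    also have "\<dots> \<le> norm x * (K * norm x)"
      by (rule order.trans[OF cmod_cinner_le]) (intro mult_left_mono K, simp)
    finally show ?thesis by (simp add: power2_eq_square mult_ac)
  qed
  have qB: "cinner x (B x) = of_real ((norm x)\<^sup>2 - Re (cinner x (T x)) / K)" for x
    by (simp add: B_def cinner_self_norm) (subst positive_op_Re(1)[OF T, of x], simp)
  have pB: "positive_op B"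
    unfolding positive_op_def qB using bB cT K(1)
    by (auto simp: complex_nonneg_Reals_iff divide_le_eq mult.commute simp del: of_real_diff)
  have nB: "norm (B x) \<le> norm x" for x
  proof -
    have "Re (cinner y (B y)) \<le> 1 * (norm y)\<^sup>2" for y
      using K(1) positive_op_Re(2)[OF T, of y] by (simp add: qB)
    from positive_op_norm_le(2)[OF pB this, of x] show ?thesis by simp
  qed
  have nBn: "norm ((B ^^ n) x) \<le> norm x" for n x
    by (induction n) (auto intro: order.trans[OF nB])
  define d where "d n = (-1) ^ n * ((1/2::real) gchoose n)" for n
  have sd: "(\<lambda>n. \<bar>d n\<bar>) summable_on UNIV"
  proof (rule nonneg_bdd_above_summable_on)
    have "sum (\<lambda>n. \<bar>d n\<bar>) F \<le> 2" if "finite F" for F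
    proof -
      obtain N where "\<forall>n\<in>F. n \<le> N" using \<open>finite F\<close> unfolding finite_nat_set_iff_bounded_le by blast
      hence "F \<subseteq> {0..N}" by auto
      hence "sum (\<lambda>n. \<bar>d n\<bar>) F \<le> sum (\<lambda>n. \<bar>d n\<bar>) {0..N}" by (intro sum_mono2) auto
      also have "\<dots> = 1 + sum (\<lambda>n. \<bar>d n\<bar>) {1..N}" by (subst sum.atLeast_Suc_atMost) (auto simp: d_def)
      also have "\<dots> \<le> 2" using sum_abs_binomial_half(1)[of N] by (simp add: d_def)
      finally show ?thesis .
    qed
    thus "bdd_above (sum (\<lambda>n. \<bar>d n\<bar>) ` {F. F \<subseteq> UNIV \<and> finite F})"
      by (intro bdd_aboveI2[where M = 2]) auto
  qed auto
  define D where "D = op_series d (\<lambda>n. B ^^ n)"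
  note series = sd bounded_op_funpow[OF bB] nBn
  have bD: "bounded_op D" unfolding D_def by (rule bounded_op_series[OF series])
  have hsi: "((\<lambda>n. of_real (d n) * cinner y ((B ^^ n) x)) has_sum cinner y (D x)) UNIV" for x y
    unfolding D_def by (rule cinner_op_series[OF series])
  have DD: "D (D x) = of_real (1 / K) *\<^sub>C T x" for x
  proof (rule cinner_eqI)
    fix y
    define \<beta> where "\<beta> n = cinner y ((B ^^ n) x)" for n
    have \<beta>: "cmod (\<beta> n) \<le> norm y * norm x" for n
      unfolding \<beta>_def by (rule order.trans[OF cmod_cinner_le]) (intro mult_left_mono nBn, simp)
    have abs: "(\<lambda>(m, n). norm (of_real (d m * d n) * \<beta> (m + n))) summable_on UNIV \<times> UNIV"
    proof (rule summable_on_comparison_test)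
      show "(\<lambda>(m, n). (\<bar>d m\<bar> * \<bar>d n\<bar>) * (norm y * norm x)) summable_on UNIV \<times> UNIV"
        unfolding case_prod_unfold
      proof (intro summable_on_cmult_left)
        have "(\<lambda>(m, n). \<bar>d m\<bar> * \<bar>d n\<bar>) summable_on UNIV \<times> UNIV"
          by (rule summable_on_SigmaI[where g = "\<lambda>m. \<bar>d m\<bar> * (\<Sum>\<^sub>\<infinity>n. \<bar>d n\<bar>)"])
            (auto intro!: has_sum_cmult_right has_sum_infsum sd summable_on_cmult_left)
        thus "(\<lambda>z. \<bar>d (fst z)\<bar> * \<bar>d (snd z)\<bar>) summable_on UNIV \<times> UNIV"
          by (simp add: case_prod_unfold)
      qed
    qed (use \<beta> in \<open>auto simp: norm_mult abs_mult intro!: mult_left_mono\<close>)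
    have "cinner y (D (D x)) = (\<Sum>\<^sub>\<infinity>m. of_real (d m) * cinner ((B ^^ m) y) (D x))"
      using infsumI[OF hsi[of y "D x"]] by (simp add: positive_op_funpow_self_adjoint[OF pB])
    also have "\<dots> = (\<Sum>\<^sub>\<infinity>m. \<Sum>\<^sub>\<infinity>n. of_real (d m * d n) * \<beta> (m + n))"
    proof (rule infsum_cong)
      fix m
      have "((\<lambda>n. of_real (d m) * (of_real (d n) * cinner ((B ^^ m) y) ((B ^^ n) x))) has_sum
          of_real (d m) * cinner ((B ^^ m) y) (D x)) UNIV"
        by (rule has_sum_cmult_right[OF hsi])
      from infsumI[OF this] show "of_real (d m) * cinner ((B ^^ m) y) (D x) = 
          (\<Sum>\<^sub>\<infinity>n. of_real (d m * d n) * \<beta> (m + n))"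
        by (simp add: \<beta>_def positive_op_funpow_self_adjoint[OF pB] funpow_add mult_ac)
    qed
    also have "\<dots> = (\<Sum>\<^sub>\<infinity>(m, n)\<in>UNIV \<times> UNIV. of_real (d m * d n) * \<beta> (m + n))"
      by (rule infsum_Sigma'_banach) (use abs in \<open>auto intro!: abs_summable_summable simp: case_prod_unfold\<close>)
    \<comment> \<open>Regrouping along \<open>k = m + n\<close> turns the inner sum into the Cauchy
      square of the coefficients.\<close>
    also have "\<dots> = (\<Sum>\<^sub>\<infinity>(k, m)\<in>Sigma UNIV (\<lambda>k. {..k}). of_real (d m * d (k - m)) * \<beta> k)"
      by (rule infsum_reindex_bij_witness[of _ "\<lambda>(k, m). (m, k - m)" "\<lambda>(m, n). (m + n, m)"]) auto
    also have "\<dots> = (\<Sum>\<^sub>\<infinity>k. \<Sum>\<^sub>\<infinity>m\<in>{..k}. of_real (d m * d (k - m)) * \<beta> k)"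
    proof (rule infsum_Sigma'_banach[symmetric])
      show "(\<lambda>(k, m). of_real (d m * d (k - m)) * \<beta> k) summable_on Sigma UNIV (\<lambda>k. {..k})"
        using abs by (subst summable_on_reindex_bij_witness[of _ "\<lambda>(m, n). (m + n, m)" "\<lambda>(k, m). (m, k - m)"
            "UNIV \<times> UNIV" "\<lambda>(m, n). of_real (d m * d n) * \<beta> (m + n)"])
          (auto intro!: abs_summable_summable simp: case_prod_unfold)
    qed
    also have "\<dots> = (\<Sum>\<^sub>\<infinity>k. of_real (\<Sum>m\<le>k. d m * d (k - m)) * \<beta> k)"
      by (simp add: sum_distrib_right)
    also have "\<dots> = (\<Sum>\<^sub>\<infinity>k\<in>{0, 1}. of_real (\<Sum>m\<le>k. d m * d (k - m)) * \<beta> k)"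
      by (rule infsum_cong_neutral) (auto simp: d_def binomial_half_convolution simp flip: of_real_mult of_real_sum)
    also have "\<dots> = \<beta> 0 - \<beta> 1"
      by (simp add: d_def binomial_half_convolution del: of_real_sum of_real_mult)
    also have "\<dots> = cinner y (of_real (1 / K) *\<^sub>C T x)" by (simp add: \<beta>_def B_def)
    finally show "cinner y (D (D x)) = cinner y (of_real (1 / K) *\<^sub>C T x)" .
  qed
  have reB: "cinner x ((B ^^ n) x) = of_real (Re (cinner x ((B ^^ n) x)))" for x n
  proof -
    have "cnj (cinner x ((B ^^ n) x)) = cinner x ((B ^^ n) x)"
      by (simp add: positive_op_funpow_self_adjoint[OF pB])
    thus ?thesis by (simp add: complex_eq_iff del: cnj_cinner)
  qed
  have pD: "positive_op D"
    unfolding positive_op_def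
  proof (intro conjI bD allI)
    fix x
    define e where "e n = Re (cinner x ((B ^^ n) x))" for n
    have e: "\<bar>e n\<bar> \<le> (norm x)\<^sup>2" for n
    proof -
      have "\<bar>e n\<bar> \<le> cmod (cinner x ((B ^^ n) x))" unfolding e_def by (rule abs_Re_le_cmod)
      also have "\<dots> \<le> norm x * norm x"
        by (rule order.trans[OF cmod_cinner_le]) (intro mult_left_mono nBn, simp)
      finally show ?thesis by (simp add: power2_eq_square)
    qed
    have h: "((\<lambda>n. complex_of_real (d n * e n)) has_sum cinner x (D x)) UNIV"
      using hsi[of x x] reB[of x] by (simp add: e_def)
    have h': "((\<lambda>n. d n * e n) has_sum Re (cinner x (D x))) UNIV"
      using has_sum_Re[OF h] by simp
    have "Im (cinner x (D x)) = 0"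
      using has_sum_unique[OF has_sum_Im[OF h], of 0] by simp
    moreover have "Re (cinner x (D x)) \<ge> 0"
    proof (rule tendsto_lowerbound[OF has_sum_imp_sums[OF h', unfolded sums_def_le]])
      show "\<forall>\<^sub>F N in sequentially. 0 \<le> (\<Sum>n\<le>N. d n * e n)"
      proof (intro always_eventually allI)
        fix N
        \<comment> \<open>The term at 0 is the full squared norm of \<open>x\<close>; the others
          cannot outweigh it, their coefficients having absolute sum at most 1.\<close>
        have "(\<Sum>n\<in>{1..N}. d n * e n) \<ge> (\<Sum>n\<in>{1..N}. - (\<bar>d n\<bar> * (norm x)\<^sup>2))"
        proof (rule sum_mono)
          fix n
          have "\<bar>d n * e n\<bar> \<le> \<bar>d n\<bar> * (norm x)\<^sup>2"
            unfolding abs_mult by (intro mult_left_mono e) auto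
          thus "- (\<bar>d n\<bar> * (norm x)\<^sup>2) \<le> d n * e n" by linarith
        qed
        moreover have "(\<Sum>n\<in>{1..N}. \<bar>d n\<bar> * (norm x)\<^sup>2) \<le> (norm x)\<^sup>2"
          unfolding sum_distrib_right[symmetric]
          using mult_right_mono[OF sum_abs_binomial_half(1)[of N], of "(norm x)\<^sup>2"] by (simp add: d_def)
        moreover have "d 0 * e 0 = (norm x)\<^sup>2" by (simp add: d_def e_def cinner_self_norm)
        moreover have "(\<Sum>n\<le>N. d n * e n) = d 0 * e 0 + (\<Sum>n\<in>{1..N}. d n * e n)"
          by (subst atMost_atLeast0, subst sum.atLeast_Suc_atMost) simp_all
        ultimately show "0 \<le> (\<Sum>n\<le>N. d n * e n)" by (simp add: sum_negf)
      qed
    qed simp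
    ultimately show "cinner x (D x) \<in> \<real>\<^sub>\<ge>\<^sub>0" by (simp add: complex_nonneg_Reals_iff)
  qed
  define c where "c x = of_real (sqrt K) *\<^sub>C D x" for x
  show thesis
  proof (rule that[of c])
    show "positive_op c"
      using pD K(1) unfolding positive_op_def c_def
      by (auto intro!: bounded_op_scaleC simp: complex_nonneg_Reals_iff)
    show "c \<circ> c = T"
    proof
      fix x
      have "complex_of_real (sqrt K) * (complex_of_real (sqrt K)) = of_real K"
        using K(1) by (simp flip: of_real_mult)
      thus "(c \<circ> c) x = T x" using K(1) by (simp add: c_def bounded_opD[OF bD] DD mult.assoc[symmetric])
    qed
    fix S :: "'i op" assume S: "bounded_op S" "S \<circ> T = T \<circ> S"
    have ST: "S (T x) = T (S x)" for x using S(2) by (metis comp_apply)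
    have SB: "S ((B ^^ n) x) = (B ^^ n) (S x)" for n x
      by (induction n arbitrary: x) (auto simp: B_def bounded_opD[OF S(1)] ST)
    show "S \<circ> c = c \<circ> S"
    proof
      fix x
      have "S (D x) = D (S x)"
        unfolding D_def by (rule op_series_commute[OF series S(1) SB])
      thus "(S \<circ> c) x = (c \<circ> S) x" by (simp add: c_def bounded_opD[OF S(1)])
    qed
  qed
qed

subsection \<open>Commutants and vector states\<close>

lemma commutantD: "T \<in> commutant A \<Longrightarrow> bounded_op T" "T \<in> commutant A \<Longrightarrow> S \<in> A \<Longrightarrow> S (T x) = T (S x)"
  unfolding commutant_def by (auto simp: fun_eq_iff)

lemma commutantI: "bounded_op T \<Longrightarrow> (\<And>S x. S \<in> A \<Longrightarrow> S (T x) = T (S x)) \<Longrightarrow> T \<in> commutant A"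
  unfolding commutant_def by (auto simp: fun_eq_iff)

lemma commutant_id: "id \<in> commutant A"
  by (rule commutantI) auto

lemma commutant_compose: "S \<in> commutant A \<Longrightarrow> T \<in> commutant A \<Longrightarrow> S \<circ> T \<in> commutant A"
proof (rule commutantI)
  assume ST: "S \<in> commutant A" "T \<in> commutant A"
  thus "bounded_op (S \<circ> T)" by (intro bounded_op_compose commutantD(1))
  fix R x assume R: "R \<in> A"
  show "R ((S \<circ> T) x) = (S \<circ> T) (R x)"
    by (simp add: commutantD(2)[OF ST(1) R] commutantD(2)[OF ST(2) R])
qed

lemma commutant_adjoint:
  assumes A: "\<And>S. S \<in> A \<Longrightarrow> \<exists>S'\<in>A. is_adjoint S S'" and T: "T \<in> commutant A" and T': "is_adjoint T T'"
  shows "T' \<in> commutant A"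
proof (rule commutantI)
  show "bounded_op T'" using T' by (rule is_adjointD)
  fix S x assume S: "S \<in> A"
  obtain S' where S': "S' \<in> A" "is_adjoint S S'" using A[OF S] by blast
  show "S (T' x) = T' (S x)"
  proof (rule cinner_eqI)
    fix y
    have "cinner y (S (T' x)) = cinner (T (S' y)) x"
      by (simp add: is_adjointD(2)[OF S'(2)] is_adjointD(1)[OF T'])
    also have "\<dots> = cinner (S' (T y)) x" using commutantD(2)[OF T S'(1)] by simp
    also have "\<dots> = cinner y (T' (S x))"
      by (simp add: is_adjointD(2)[OF S'(2), symmetric] is_adjointD(1)[OF T', symmetric])
    finally show "cinner y (S (T' x)) = cinner y (T' (S x))" .
  qed
qed

text \<open>Bicommutant closure is the formal identity of the third commutant with the
  first.\<close>

lemma von_neumann_algebra_commutant: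
  assumes A: "\<And>S. S \<in> A \<Longrightarrow> bounded_op S" "\<And>S. S \<in> A \<Longrightarrow> \<exists>S'\<in>A. is_adjoint S S'"
  shows "von_neumann_algebra (commutant A)"
  unfolding von_neumann_algebra_def
proof (intro conjI ballI)
  show "bounded_op T" if "T \<in> commutant A" for T using that by (rule commutantD)
  show "\<exists>S\<in>commutant A. is_adjoint T S" if "T \<in> commutant A" for T
    using adjoint_exists[OF commutantD(1)[OF that]] commutant_adjoint[OF A(2) that] by blast
  show "commutant (commutant (commutant A)) = commutant A"
    using A(1) unfolding commutant_def by auto
qed

text \<open>Normality of vector states: if the supremum of a bounded increasing net \<open>S\<close> in the state given
  by \<open>w\<close> were too small, the vectors \<open>(T - S) w\<close> would converge to some \<open>v \<noteq> 0\<close>, and by the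
  Cauchy-Schwarz inequality a multiple of the projection onto \<open>v\<close> could be subtracted from the upper
  bound \<open>T\<close>.\<close>

lemma normal_on_vector_state: "normal_on M (\<lambda>T. cinner w (T w))"
  unfolding normal_on_def
proof (intro allI impI, elim conjE)
  fix D :: "'a op set" and T
  assume D: "D \<subseteq> M" "D \<noteq> {}" "\<forall>S\<in>D. self_adjoint S"
    "\<forall>S\<in>D. \<forall>S'\<in>D. \<exists>S''\<in>D. op_le S S'' \<and> op_le S' S''" and lub: "op_lub D T"
  have T: "self_adjoint T" "\<And>S. S \<in> D \<Longrightarrow> op_le S T"
    "\<And>T'. self_adjoint T' \<Longrightarrow> (\<And>S. S \<in> D \<Longrightarrow> op_le S T') \<Longrightarrow> op_le T T'"
    using lub by (auto simp: op_lub_def)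
  define q where "q S x = Re (cinner x (T x)) - Re (cinner x (S x))" for S x
  have pos: "positive_op (\<lambda>x. T x - S x)" if "S \<in> D" for S using T(2)[OF that] by (simp add: op_le_def)
  have q0: "q S x \<ge> 0" if "S \<in> D" for S x
    using positive_op_Re(2)[OF pos[OF that], of x] by (simp add: q_def)
  have mono: "q S' x \<le> q S x" if "op_le S S'" for S S' x
    using positive_op_Re(2)[OF that[unfolded op_le_def], of x] by (simp add: q_def)
  define \<alpha> where "\<alpha> = (INF S\<in>D. q S w)"
  have bdd: "bdd_below ((\<lambda>S. q S w) ` D)" using q0 by (auto intro!: bdd_belowI2)
  have \<alpha>0: "\<alpha> \<ge> 0" unfolding \<alpha>_def using D(2) q0 by (intro cINF_greatest) auto
  have \<alpha>_le: "\<alpha> \<le> q S w" if "S \<in> D" for S unfolding \<alpha>_def by (rule cINF_lower[OF bdd that])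
  have "\<alpha> = 0"
  proof (rule ccontr)
    assume "\<alpha> \<noteq> 0"
    hence \<alpha>: "\<alpha> > 0" using \<alpha>0 by simp
    have ex: "\<exists>S\<in>D. q S w < \<alpha> + e" if "e > 0" for e
      using cINF_less_iff[OF D(2) bdd, of "\<alpha> + e"] that by (simp add: \<alpha>_def)
    \<comment> \<open>Beyond a fixed member \<open>S0\<close> all differences are dominated by
      \<open>T - S0\<close>, so one constant \<open>K\<close> serves in every norm estimate.\<close>
    obtain S0 where S0: "S0 \<in> D" using D(2) by blast
    obtain K where K: "K > 0" "\<And>x. norm (T x - S0 x) \<le> K * norm x"
      using bounded_op_bound[of "\<lambda>x. T x - S0 x"] pos[OF S0] by (auto simp: positive_op_def)
    have qK: "q S0 x \<le> K * (norm x)\<^sup>2" for x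
    proof -
      have "q S0 x = Re (cinner x (T x - S0 x))" by (simp add: q_def)
      also have "\<dots> \<le> norm x * norm (T x - S0 x)" by (rule order.trans[OF complex_Re_le_cmod cmod_cinner_le])
      also have "\<dots> \<le> norm x * (K * norm x)" by (intro mult_left_mono K) auto
      finally show ?thesis by (simp add: power2_eq_square mult_ac)
    qed
    have close: "(norm (S' w - S w))\<^sup>2 \<le> K * (q S w - q S' w)" 
      if "S \<in> D" "S' \<in> D" "op_le S0 S" "op_le S S'" for S S'
    proof -
      have "(norm ((\<lambda>x. S' x - S x) w))\<^sup>2 \<le> K * Re (cinner w (S' w - S w))"
      proof (rule positive_op_norm_le)
        show "positive_op (\<lambda>x. S' x - S x)" using that by (simp add: op_le_def)
        show "Re (cinner x (S' x - S x)) \<le> K * (norm x)\<^sup>2" for x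
          using qK[of x] mono[OF that(3), of x] q0[OF that(2), of x] by (simp add: q_def)
      qed (use K in auto)
      thus ?thesis by (simp add: q_def)
    qed
    have "\<exists>S. S \<in> D \<and> op_le S0 S \<and> q S w < \<alpha> + e" if e: "e > 0" for e
    proof -
      obtain S1 where S1: "S1 \<in> D" "q S1 w < \<alpha> + e" using ex[OF e] by blast
      obtain S2 where "S2 \<in> D" "op_le S0 S2" "op_le S1 S2" using D(4) S0 S1 by blast
      thus ?thesis using S1 mono[of S1 S2 w] by force
    qed
    hence "\<exists>S. S \<in> D \<and> op_le S0 S \<and> q S w < \<alpha> + 1 / Suc n" for n by simp
    then obtain S where S: "\<And>n. S n \<in> D" "\<And>n. op_le S0 (S n)" "\<And>n::nat. q (S n) w < \<alpha> + 1 / Suc n" by metis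
    have cl: "norm (S' w - S n w) \<le> sqrt (K / Suc n)" if "S' \<in> D" "op_le (S n) S'" for S' n
    proof -
      have "(norm (S' w - S n w))\<^sup>2 \<le> K * (q (S n) w - q S' w)"
        by (rule close[OF S(1) that(1) S(2) that(2)])
      also have "\<dots> \<le> K * (1 / Suc n)"
        using K(1) \<alpha>_le[OF that(1)] S(3)[of n] by (intro mult_left_mono) auto
      finally show ?thesis by (simp add: real_le_rsqrt)
    qed
    have lim: "(\<lambda>n. sqrt (K / Suc n)) \<longlonglongrightarrow> 0"
      using tendsto_real_sqrt[OF LIMSEQ_Suc[OF lim_const_over_n[of K]]] by simp
    have "Cauchy (\<lambda>n. S n w)"
    proof (rule metric_CauchyI)
      fix e :: real assume "e > 0"
      then obtain N where N: "\<And>n. n \<ge> N \<Longrightarrow> sqrt (K / Suc n) < e / 2"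
        using LIMSEQ_D[OF lim, of "e / 2"] by (metis half_gt_zero diff_0_right real_norm_def abs_less_iff)
      have "dist (S m w) (S n w) < e" if "m \<ge> N" "n \<ge> N" for m n
      proof -
        obtain S' where "S' \<in> D" "op_le (S m) S'" "op_le (S n) S'" using D(4) S(1) by blast
        hence "dist (S m w) (S' w) < e / 2" "dist (S n w) (S' w) < e / 2"
          using cl[of S' m] cl[of S' n] N[OF that(1)] N[OF that(2)] 
          by (simp_all add: dist_norm norm_minus_commute)
        thus ?thesis by (metis dist_commute dist_triangle_half_r)
      qed
      thus "\<exists>M. \<forall>m\<ge>M. \<forall>n\<ge>M. dist (S m w) (S n w) < e" by blast
    qed
    then obtain z where z: "(\<lambda>n. S n w) \<longlonglongrightarrow> z" using Cauchy_convergent convergent_def by blast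
    define v where "v = T w - z"
    have tc: "(\<lambda>n. cinner x (f n)) \<longlonglongrightarrow> cinner x y" if "f \<longlonglongrightarrow> y" for x y :: "'a ell2" and f
      using bounded_linear.tendsto[OF bounded_linear_cinner(1) that] .
    \<comment> \<open>Along members \<open>S' n\<close> above both \<open>S n\<close> and
      \<open>S1\<close> the Cauchy-Schwarz inequality for \<open>T - S' n\<close> passes to the
      limit: one factor is at most \<open>q S1 x\<close>, the other at most
      \<open>\<alpha> + 1 / Suc n\<close>.\<close>
    have cv: "(cmod (cinner x v))\<^sup>2 \<le> \<alpha> * q S1 x" if S1: "S1 \<in> D" for x S1
    proof -
      have "\<exists>S'. S' \<in> D \<and> op_le (S n) S' \<and> op_le S1 S'" for n using D(4) S(1) S1 by blast
      then obtain S' where S': "\<And>n. S' n \<in> D" "\<And>n. op_le (S n) (S' n)" "\<And>n. op_le S1 (S' n)" by metis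
      have "(\<lambda>n. S' n w - S n w) \<longlonglongrightarrow> 0"
        by (rule Lim_null_comparison[OF always_eventually lim]) (use cl[OF S'(1,2)] in blast)
      from tendsto_add[OF this z] have "(\<lambda>n. S' n w) \<longlonglongrightarrow> z" by simp
      hence "(\<lambda>n. T w - S' n w) \<longlonglongrightarrow> v" unfolding v_def by (intro tendsto_intros)
      hence l1: "(\<lambda>n. (cmod (cinner x (T w - S' n w)))\<^sup>2) \<longlonglongrightarrow> (cmod (cinner x v))\<^sup>2"
        by (intro tendsto_intros tc)
      have l2: "(\<lambda>n. q S1 x * (\<alpha> + 1 / Suc n)) \<longlonglongrightarrow> q S1 x * (\<alpha> + 0)"
        by (intro tendsto_intros LIMSEQ_Suc[OF lim_const_over_n[of 1]])
      have "(cmod (cinner x (T w - S' n w)))\<^sup>2 \<le> q S1 x * (\<alpha> + 1 / Suc n)" for n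
      proof -
        have "(cmod (cinner x (T w - S' n w)))\<^sup>2 \<le> q (S' n) x * q (S' n) w"
          using positive_op_cauchy_schwarz[OF pos[OF S'(1)[of n]], of x w] by (simp add: q_def)
        also have "\<dots> \<le> q S1 x * (\<alpha> + 1 / Suc n)"
          using mono[OF S'(3)[of n], of x] mono[OF S'(2)[of n], of w] S(3)[of n] q0[OF S'(1)[of n]] q0[OF S1]
          by (intro mult_mono) (auto intro: less_imp_le order.trans)
        finally show ?thesis .
      qed
      hence "(cmod (cinner x v))\<^sup>2 \<le> q S1 x * (\<alpha> + 0)"
        by (intro LIMSEQ_le[OF l1 l2]) blast
      thus ?thesis by (simp add: mult.commute)
    qed
    \<comment> \<open>By the bound just proved, this multiple of the projection onto
      \<open>v\<close> lies below \<open>T - S1\<close> for every \<open>S1\<close> in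
      \<open>D\<close>.\<close>
    define P where "P x = of_real (1 / \<alpha>) *\<^sub>C cinner v x *\<^sub>C v" for x
    have P: "is_adjoint P P" unfolding is_adjoint_def
    proof (intro conjI allI)
      show "bounded_op P"
      proof (rule bounded_opI[where K = "1 / \<alpha> * (norm v * norm v)"])
        fix x
        have "norm (P x) = 1 / \<alpha> * (cmod (cinner v x) * norm v)" using \<alpha> by (simp add: P_def norm_scaleC norm_mult norm_divide)
        also have "\<dots> \<le> 1 / \<alpha> * ((norm v * norm x) * norm v)" using \<alpha> by (intro mult_left_mono mult_right_mono cmod_cinner_le) auto
        finally show "norm (P x) \<le> 1 / \<alpha> * (norm v * norm v) * norm x" by (simp add: mult_ac)
      qed (auto simp: P_def scaleC_distribs algebra_simps)
      thus "bounded_op P" .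
      show "cinner (P x) y = cinner x (P y)" for x y by (simp add: P_def mult_ac)
    qed
    have qP: "cinner x (P x) = of_real ((cmod (cinner x v))\<^sup>2 / \<alpha>)" for x
      using cmod_power2_mult[of "cinner x v"] by (simp add: P_def power2_eq_square mult.commute)
    have "op_le T (\<lambda>x. T x - P x)"
    proof (rule T(3))
      show "self_adjoint (\<lambda>x. T x - P x)"
        using T(1) P unfolding self_adjoint_def is_adjoint_def by (auto intro: bounded_op_diff)
      fix S1 assume S1: "S1 \<in> D"
      have "cinner x (T x - P x - S1 x) \<in> \<real>\<^sub>\<ge>\<^sub>0" for x
      proof -
        have "cinner x (T x - P x - S1 x) = cinner x (T x - S1 x) - cinner x (P x)" by simp
        also have "\<dots> = of_real (q S1 x - (cmod (cinner x v))\<^sup>2 / \<alpha>)"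
          by (subst positive_op_Re(1)[OF pos[OF S1], of x]) (simp add: qP q_def)
        finally show ?thesis using cv[OF S1, of x] \<alpha>
          by (simp add: complex_nonneg_Reals_iff divide_le_eq mult.commute)
      qed
      moreover have "bounded_op (\<lambda>x. (T x - P x) - S1 x)"
        using T(1) D(3) S1 P by (intro bounded_op_diff) (auto simp: self_adjoint_def is_adjoint_def)
      ultimately show "op_le S1 (\<lambda>x. T x - P x)" by (simp add: op_le_def positive_op_def)
    qed
    \<comment> \<open>\<open>T\<close> would lie below \<open>T - P\<close>, so the form of
      \<open>P\<close> vanishes at \<open>w\<close>; but \<open>cinner w v\<close> is a limit of
      gaps whose real parts are at least \<open>\<alpha>\<close>.\<close>
    from positive_op_Re(2)[OF this[unfolded op_le_def], of w] have "cinner w v = 0"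
      using \<alpha> by (simp add: qP field_simps)
    moreover have "\<alpha> \<le> Re (cinner w v)"
    proof (rule LIMSEQ_le_const)
      show "(\<lambda>n. Re (cinner w (T w - S n w))) \<longlonglongrightarrow> Re (cinner w v)"
        unfolding v_def by (intro tendsto_intros tc z)
      show "\<exists>N. \<forall>n\<ge>N. \<alpha> \<le> Re (cinner w (T w - S n w))" using \<alpha>_le[OF S(1)] by (simp add: q_def)
    qed
    ultimately show False using \<alpha> by simp
  qed
  show "Re (cinner w (T w)) = (SUP S\<in>D. Re (cinner w (S w)))"
  proof (rule antisym)
    have up: "Re (cinner w (S w)) \<le> Re (cinner w (T w))" if "S \<in> D" for S using q0[OF that, of w] by (simp add: q_def)
    have bd: "bdd_above ((\<lambda>S. Re (cinner w (S w))) ` D)" using up by (auto intro!: bdd_aboveI2)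
    show "(SUP S\<in>D. Re (cinner w (S w))) \<le> Re (cinner w (T w))" using D(2) up by (intro cSUP_least) auto
    show "Re (cinner w (T w)) \<le> (SUP S\<in>D. Re (cinner w (S w)))"
    proof (rule field_le_epsilon)
      fix e :: real assume "e > 0"
      then obtain S where S: "S \<in> D" "q S w < e"
        using cINF_less_iff[OF D(2) bdd, of e] \<open>\<alpha> = 0\<close> by (auto simp: \<alpha>_def)
      show "Re (cinner w (T w)) \<le> (SUP S\<in>D. Re (cinner w (S w))) + e"
        using cSUP_upper[OF S(1) bd] S(2) by (simp add: q_def)
    qed
  qed
qed

section \<open>A Fock space over the integers\<close>

text \<open>The orthonormal basis of the Fock space consists of the nonempty words over \<open>\<int>\<close>: it is the
  full Fock space of the \<open>L(\<int>)\<close>-bimodule \<open>L(\<int>) \<otimes> L(\<int>)\<close>.  The function \<open>dec\<close> enumerates the basis,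
  and \<open>wc x w\<close> is the coefficient of \<open>x\<close> at \<open>w\<close>.\<close>

definition dec :: "nat \<Rightarrow> int list" where
  "dec = (SOME f. bij_betw f UNIV {w. w \<noteq> []})"

definition enc :: "int list \<Rightarrow> nat" where
  "enc = inv_into UNIV dec"

lemma bij_dec: "bij_betw dec UNIV {w. w \<noteq> []}"
proof -
  have "inj (\<lambda>n. replicate (Suc n) (0::int))" by (auto simp: inj_on_def replicate_eq_replicate)
  hence "infinite (range (\<lambda>n. replicate (Suc n) (0::int)))" using range_inj_infinite by blast
  hence "infinite {w :: int list. w \<noteq> []}" by (rule infinite_super[rotated]) auto
  hence "\<exists>f. bij_betw f (UNIV :: nat set) {w :: int list. w \<noteq> []}"
    using bij_betw_from_nat_into[OF countableI_type] by (intro exI)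
  thus ?thesis unfolding dec_def by (rule someI_ex)
qed

lemma dec_nonempty [simp]: "dec i \<noteq> []"
  using bij_dec by (auto simp: bij_betw_def)

lemma dec_enc [simp]: "w \<noteq> [] \<Longrightarrow> dec (enc w) = w"
  unfolding enc_def using bij_betw_inv_into_right[OF bij_dec] by auto

lemma enc_dec [simp]: "enc (dec i) = i"
  unfolding enc_def using bij_betw_inv_into_left[OF bij_dec] by auto

definition wc :: "nat ell2 \<Rightarrow> int list \<Rightarrow> complex" where
  "wc x w = coord x (enc w)"

definition kw :: "int list \<Rightarrow> nat ell2" where
  "kw w = ket (enc w)"

lemma wc_eqI: "(\<And>w. w \<noteq> [] \<Longrightarrow> wc x w = wc y w) \<Longrightarrow> x = y"
  by (rule ell2_eqI) (metis wc_def dec_nonempty enc_dec)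

lemma wc_simps [simp]: "wc 0 w = 0" "wc (x + y) w = wc x w + wc y w" "wc (x - y) w = wc x w - wc y w"
  "wc (c *\<^sub>C x) w = c * wc x w"
  by (simp_all add: wc_def)

lemma wc_kw: "v \<noteq> [] \<Longrightarrow> w \<noteq> [] \<Longrightarrow> wc (kw v) w = (if w = v then 1 else 0)"
  by (auto simp: wc_def kw_def coord_ket) (metis dec_enc)

lemma cinner_kw: "cinner (kw w) x = wc x w" "cinner x (kw w) = cnj (wc x w)"
  by (simp_all add: wc_def kw_def cinner_ket cinner_ket_right)

lemma cinner_wc: "cinner x y = (\<Sum>\<^sub>\<infinity>w\<in>{w. w \<noteq> []}. cnj (wc x w) * wc y w)"
  unfolding cinner.rep_eq wc_def
  by (subst infsum_reindex_bij_betw[OF bij_dec, symmetric]) simp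

text \<open>Such maps act on the basis as partial isometries, so boundedness and adjoints of the
  Fock operators reduce to combinatorics of words. The empty word is left out since it is not a
  basis index.\<close>

definition partial_injection :: "(int list \<Rightarrow> int list option) \<Rightarrow> bool" where
  "partial_injection g \<longleftrightarrow> (\<forall>w v. w \<noteq> [] \<longrightarrow> g w = Some v \<longrightarrow> v \<noteq> []) \<and>
     (\<forall>w w' v. w \<noteq> [] \<longrightarrow> w' \<noteq> [] \<longrightarrow> g w = Some v \<longrightarrow> g w' = Some v \<longrightarrow> w = w')"

definition pull :: "(int list \<Rightarrow> int list option) \<Rightarrow> nat op" where
  "pull g x = Abs_ell2 (\<lambda>i. case g (dec i) of None \<Rightarrow> 0 | Some v \<Rightarrow> wc x v)"

lemma pull_aux:
  assumes g: "partial_injection g" and F: "finite F"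
  shows "(\<Sum>i\<in>F. (cmod (case g (dec i) of None \<Rightarrow> 0 | Some v \<Rightarrow> wc x v))\<^sup>2) \<le> (norm x)\<^sup>2"
proof -
  define F' where "F' = {i\<in>F. g (dec i) \<noteq> None}"
  have "(\<Sum>i\<in>F. (cmod (case g (dec i) of None \<Rightarrow> 0 | Some v \<Rightarrow> wc x v))\<^sup>2) =
      (\<Sum>i\<in>F'. (cmod (coord x (enc (the (g (dec i))))))\<^sup>2)"
  proof (rule sum.mono_neutral_cong_right[OF F])
    show "F' \<subseteq> F" by (auto simp: F'_def)
  qed (auto simp: F'_def wc_def)
  also have "\<dots> = (\<Sum>j\<in>(\<lambda>i. enc (the (g (dec i)))) ` F'. (cmod (coord x j))\<^sup>2)"
  proof (subst sum.reindex)
    show "inj_on (\<lambda>i. enc (the (g (dec i)))) F'"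
    proof (rule inj_onI)
      fix i j assume ij: "i \<in> F'" "j \<in> F'" "enc (the (g (dec i))) = enc (the (g (dec j)))"
      then obtain v v' where v: "g (dec i) = Some v" "g (dec j) = Some v'" by (auto simp: F'_def)
      have "v \<noteq> []" "v' \<noteq> []" using v g dec_nonempty unfolding partial_injection_def by blast+
      hence "v = v'" using ij(3) v by (metis dec_enc option.sel)
      hence "dec i = dec j" using v g dec_nonempty unfolding partial_injection_def by blast
      thus "i = j" by (metis enc_dec)
    qed
  qed simp
  also have "\<dots> \<le> (norm x)\<^sup>2" by (rule sum_coord_le) (use F in \<open>auto simp: F'_def\<close>)
  finally show ?thesis .
qed

lemma wc_pull:
  assumes "partial_injection g" "w \<noteq> []"
  shows "wc (pull g x) w = (case g w of None \<Rightarrow> 0 | Some v \<Rightarrow> wc x v)"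
proof -
  have "(\<lambda>i. (cmod (case g (dec i) of None \<Rightarrow> 0 | Some v \<Rightarrow> wc x v))\<^sup>2) summable_on UNIV"
    by (rule nonneg_bdd_above_summable_on) (auto intro!: bdd_aboveI2 pull_aux assms)
  thus ?thesis using assms(2) by (simp add: pull_def wc_def[of "Abs_ell2 _"] Abs_ell2_inverse)
qed

lemma norm_pull_le:
  assumes "partial_injection g" shows "norm (pull g x) \<le> norm x"
proof -
  have *: "(case g (dec i) of None \<Rightarrow> 0 | Some v \<Rightarrow> wc x v) = coord (pull g x) i" for i
    using wc_pull[OF assms, of "dec i" x] by (simp add: wc_def)
  have "(norm (pull g x))\<^sup>2 \<le> (norm x)\<^sup>2"
    unfolding norm_ell2_square[of "pull g x"]
    by (rule infsum_le_finite_sums[OF summable_coord]) (use pull_aux[OF assms, of _ x] in \<open>simp add: *\<close>)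
  thus ?thesis by (simp add: abs_le_square_iff[symmetric])
qed

lemma bounded_op_pull: "partial_injection g \<Longrightarrow> bounded_op (pull g)"
  by (rule bounded_opI[where K = 1])
    (auto intro!: wc_eqI simp: wc_pull norm_pull_le split: option.splits)

lemma is_adjoint_pull:
  assumes g: "partial_injection g" "partial_injection h"
    "\<And>w v. w \<noteq> [] \<Longrightarrow> v \<noteq> [] \<Longrightarrow> g w = Some v \<longleftrightarrow> h v = Some w"
  shows "is_adjoint (pull g) (pull h)"
  unfolding is_adjoint_def
proof (intro conjI bounded_op_pull g(1,2) allI)
  fix x y
  have nonempty: "v \<noteq> []" if "w \<noteq> []" "f w = Some v" "partial_injection f" for f w v
    using that unfolding partial_injection_def by blast
  have gh: "v \<noteq> [] \<and> h v = Some w" if "w \<noteq> []" "g w = Some v" for w v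
    using nonempty[OF that g(1)] g(3)[of w v] that by blast
  have hg: "v \<noteq> [] \<and> g v = Some w" if "w \<noteq> []" "h w = Some v" for w v
    using nonempty[OF that g(2)] g(3)[of v w] that by blast
  have "cinner (pull g x) y = (\<Sum>\<^sub>\<infinity>w\<in>{w. w \<noteq> [] \<and> g w \<noteq> None}. cnj (wc x (the (g w))) * wc y w)"
    unfolding cinner_wc by (rule infsum_cong_neutral) (auto simp: wc_pull[OF g(1)] split: option.splits)
  also have "\<dots> = (\<Sum>\<^sub>\<infinity>v\<in>{w. w \<noteq> [] \<and> h w \<noteq> None}. cnj (wc x v) * wc y (the (h v)))"
    by (rule infsum_reindex_bij_witness[of _ "\<lambda>v. the (h v)" "\<lambda>w. the (g w)"])
      (auto dest: gh hg)
  also have "\<dots> = cinner x (pull h y)"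
    unfolding cinner_wc by (rule infsum_cong_neutral) (auto simp: wc_pull[OF g(2)] split: option.splits)
  finally show "cinner (pull g x) y = cinner x (pull h y)" .
qed

lemma pull_kw:
  assumes "partial_injection g" "w \<noteq> []" "g w = Some v"
  shows "pull g (kw v) = kw w"
proof (rule wc_eqI)
  fix w' :: "int list" assume w': "w' \<noteq> []"
  have "v \<noteq> []" using assms unfolding partial_injection_def by blast
  moreover have "g w' = Some v \<longleftrightarrow> w' = w" using assms w' unfolding partial_injection_def by blast
  moreover have "v' \<noteq> []" if "g w' = Some v'" for v'
    using assms(1) w' that unfolding partial_injection_def by blast
  ultimately show "wc (pull g (kw v)) w' = wc (kw w) w'"
    using assms(2) w' by (auto simp: wc_pull[OF assms(1)] wc_kw split: option.splits)
qed

text \<open>The operators \<open>pull g\<close> act on coefficients, so the maps \<open>g\<close> are inverse to the action on basis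
  words: \<open>lsh k\<close> adds \<open>k\<close> to the first letter, \<open>lcr\<close> prepends \<open>0\<close>, and \<open>lan\<close> removes a leading \<open>0\<close>
  from words of length at least two; \<open>rsh\<close>, \<open>rcr\<close>, \<open>ran\<close> do the same at the end of the word.\<close>

definition lsh :: "int \<Rightarrow> nat op" where "lsh k = pull (\<lambda>w. Some ((hd w - k) # tl w))"
definition lcr :: "nat op" where "lcr = pull (\<lambda>w. if hd w = 0 \<and> tl w \<noteq> [] then Some (tl w) else None)"
definition lan :: "nat op" where "lan = pull (\<lambda>w. Some (0 # w))"
definition rsh :: "int \<Rightarrow> nat op" where "rsh k = pull (\<lambda>w. Some (butlast w @ [last w - k]))"
definition rcr :: "nat op" where "rcr = pull (\<lambda>w. if last w = 0 \<and> butlast w \<noteq> [] then Some (butlast w) else None)"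
definition ran :: "nat op" where "ran = pull (\<lambda>w. Some (w @ [0]))"

lemma list_hd_tl_eq: "w \<noteq> [] \<Longrightarrow> w' \<noteq> [] \<Longrightarrow> hd w = hd w' \<Longrightarrow> tl w = tl w' \<Longrightarrow> w = w'"
  by (cases w; cases w') auto

lemma list_last_butlast_eq: "w \<noteq> [] \<Longrightarrow> w' \<noteq> [] \<Longrightarrow> last w = last w' \<Longrightarrow> butlast w = butlast w' \<Longrightarrow> w = w'"
  by (cases w rule: rev_cases; cases w' rule: rev_cases) auto

lemma partial_injections:
  "partial_injection (\<lambda>w. Some ((hd w - k) # tl w))"
  "partial_injection (\<lambda>w. if hd w = 0 \<and> tl w \<noteq> [] then Some (tl w) else None)"
  "partial_injection (\<lambda>w. Some (0 # w))"
  "partial_injection (\<lambda>w. Some (butlast w @ [last w - k]))"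
  "partial_injection (\<lambda>w. if last w = 0 \<and> butlast w \<noteq> [] then Some (butlast w) else None)"
  "partial_injection (\<lambda>w. Some (w @ [0]))"
  unfolding partial_injection_def
  by (auto dest: list_hd_tl_eq[rotated 2] list_last_butlast_eq[rotated 2] split: if_splits)
    (metis list_hd_tl_eq, metis list_last_butlast_eq)

lemmas left_right_defs = lsh_def lcr_def lan_def rsh_def rcr_def ran_def

lemma wc_left_right:
  assumes "w \<noteq> []"
  shows "wc (lsh k x) w = wc x ((hd w - k) # tl w)"
    "wc (lcr x) w = (if hd w = 0 \<and> tl w \<noteq> [] then wc x (tl w) else 0)"
    "wc (lan x) w = wc x (0 # w)"
    "wc (rsh k x) w = wc x (butlast w @ [last w - k])"
    "wc (rcr x) w = (if last w = 0 \<and> butlast w \<noteq> [] then wc x (butlast w) else 0)"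
    "wc (ran x) w = wc x (w @ [0])"
  unfolding left_right_defs using assms by (simp_all add: wc_pull partial_injections)

lemma bounded_op_left_right [simp]:
  "bounded_op (lsh k)" "bounded_op lcr" "bounded_op lan" "bounded_op (rsh k)" "bounded_op rcr" "bounded_op ran"
  unfolding left_right_defs by (intro bounded_op_pull partial_injections)+

lemma norm_lsh_le: "norm (lsh k x) \<le> norm x"
  unfolding lsh_def by (intro norm_pull_le partial_injections)

lemma is_adjoint_left_right:
  "is_adjoint (lsh k) (lsh (- k))" "is_adjoint lcr lan" "is_adjoint (rsh k) (rsh (- k))" "is_adjoint rcr ran"
  unfolding left_right_defs
proof -
  have *: "w \<noteq> [] \<Longrightarrow> hd w = k \<Longrightarrow> k # tl w = w" "w \<noteq> [] \<Longrightarrow> last w = k \<Longrightarrow> butlast w @ [k] = w"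
    for w and k :: int by auto
  show "is_adjoint (pull (\<lambda>w. Some ((hd w - k) # tl w))) (pull (\<lambda>w. Some ((hd w - - k) # tl w)))"
    by (intro is_adjoint_pull partial_injections) (auto simp: *)
  show "is_adjoint (pull (\<lambda>w. if hd w = 0 \<and> tl w \<noteq> [] then Some (tl w) else None)) (pull (\<lambda>w. Some (0 # w)))"
    by (intro is_adjoint_pull partial_injections) (auto simp: *)
  show "is_adjoint (pull (\<lambda>w. Some (butlast w @ [last w - k]))) (pull (\<lambda>w. Some (butlast w @ [last w - - k])))"
    by (intro is_adjoint_pull partial_injections) (auto simp: *)
  show "is_adjoint (pull (\<lambda>w. if last w = 0 \<and> butlast w \<noteq> [] then Some (butlast w) else None))
      (pull (\<lambda>w. Some (w @ [0])))"
    by (intro is_adjoint_pull partial_injections) (auto simp: *)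
qed

lemma left_right_kw:
  "w \<noteq> [] \<Longrightarrow> lsh k (kw w) = kw ((hd w + k) # tl w)" "w \<noteq> [] \<Longrightarrow> lcr (kw w) = kw (0 # w)"
  "w \<noteq> [] \<Longrightarrow> rsh k (kw w) = kw (butlast w @ [last w + k])" "w \<noteq> [] \<Longrightarrow> rcr (kw w) = kw (w @ [0])"
  unfolding left_right_defs
  by (rule pull_kw[OF partial_injections(1)] pull_kw[OF partial_injections(2)]
      pull_kw[OF partial_injections(4)] pull_kw[OF partial_injections(5)]; force)+

lemma annihilation_kw:
  assumes "w \<noteq> []"
  shows "lan (kw w) = (if hd w = 0 \<and> tl w \<noteq> [] then kw (tl w) else 0)"
    "ran (kw w) = (if last w = 0 \<and> butlast w \<noteq> [] then kw (butlast w) else 0)"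
  using assms by (auto intro!: wc_eqI simp: wc_left_right wc_kw split: if_splits)
    (metis list.collapse, metis append_butlast_last_id)

section \<open>The left and right semicircular operators and the vacuum\<close>

definition lb :: "nat op" where "lb x = lcr x + lan x"
definition rb :: "nat op" where "rb x = rcr x + ran x"
text \<open>A word with \<open>n + 1\<close> letters is an elementary tensor at level
  \<open>n\<close>, the letters being exponents of the unitary generator of L(Z). The one-letter
  word 0 is thus the unit of L(Z) at level 0, and annihilation kills one-letter words.\<close>

definition \<Omega> :: "nat ell2" where "\<Omega> = kw [0]"

definition right_gens :: "nat op set" where "right_gens = insert rb (range rsh)"
definition fock_alg :: "nat op set" where "fock_alg = commutant right_gens"
definition vac :: "nat op \<Rightarrow> complex" where "vac T = cinner \<Omega> (T \<Omega>)"

lemma bounded_op_lb [simp]: "bounded_op lb" and bounded_op_rb [simp]: "bounded_op rb"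
  unfolding lb_def[abs_def] rb_def[abs_def] by (simp_all add: bounded_op_add)

lemma self_adjoint_lb: "is_adjoint lb lb" and self_adjoint_rb: "is_adjoint rb rb"
proof -
  show "is_adjoint lb lb" "is_adjoint rb rb"
    using is_adjoint_add[OF is_adjoint_left_right(2) is_adjoint_sym[OF is_adjoint_left_right(2)]]
      is_adjoint_add[OF is_adjoint_left_right(4) is_adjoint_sym[OF is_adjoint_left_right(4)]]
    by (simp_all add: lb_def[abs_def] rb_def[abs_def] add.commute)
qed

lemma wc_lb_rb:
  assumes "w \<noteq> []"
  shows "wc (lb x) w = (if hd w = 0 \<and> tl w \<noteq> [] then wc x (tl w) else 0) + wc x (0 # w)"
    "wc (rb x) w = (if last w = 0 \<and> butlast w \<noteq> [] then wc x (butlast w) else 0) + wc x (w @ [0])"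
  using assms by (simp_all add: lb_def rb_def wc_left_right)

lemma word_cases:
  obtains k where "w = [k]" | a m z where "w = a # m @ [z]" | "w = []"
  by (cases w; cases "tl w" rule: rev_cases) auto

text \<open>Left operators act at the first letter and right operators at the last. They can
  interfere on short words only; one-letter words, where both ends coincide, are split off.\<close>

lemma left_right_commute:
  "rsh j (lsh k x) = lsh k (rsh j x)" "rb (lsh k x) = lsh k (rb x)"
  "rsh j (lb x) = lb (rsh j x)" "rb (lb x) = lb (rb x)"
proof -
  have *: "u = v" if "\<And>k. wc u [k] = wc v [k]" "\<And>a m z. wc u (a # m @ [z]) = wc v (a # m @ [z])" for u v
    by (rule wc_eqI) (metis that word_cases)
  show "rsh j (lsh k x) = lsh k (rsh j x)"
    by (rule *) (simp_all add: wc_left_right algebra_simps)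
  show "rb (lsh k x) = lsh k (rb x)"
    by (rule *; simp only: wc_left_right wc_lb_rb list.distinct append_is_Nil_conv simp_thms;
        simp?; (auto simp: wc_left_right wc_lb_rb diff_right_commute)?)
  show "rsh j (lb x) = lb (rsh j x)"
    by (rule *; simp only: wc_left_right wc_lb_rb list.distinct append_is_Nil_conv simp_thms;
        simp?; (auto simp: wc_left_right wc_lb_rb diff_right_commute)?)
  show "rb (lb x) = lb (rb x)"
    by (rule *; simp only: wc_left_right wc_lb_rb list.distinct append_is_Nil_conv simp_thms;
        simp?; (auto simp: wc_left_right wc_lb_rb diff_right_commute)?)
qed

lemma fock_algI:
  assumes "bounded_op T" "\<And>k x. rsh k (T x) = T (rsh k x)" "\<And>x. rb (T x) = T (rb x)"
  shows "T \<in> fock_alg"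
  unfolding fock_alg_def using assms by (intro commutantI) (auto simp: right_gens_def)

lemma fock_algD:
  "T \<in> fock_alg \<Longrightarrow> bounded_op T" "T \<in> fock_alg \<Longrightarrow> rsh k (T x) = T (rsh k x)"
  "T \<in> fock_alg \<Longrightarrow> rb (T x) = T (rb x)"
  unfolding fock_alg_def by (rule commutantD, assumption; simp add: right_gens_def)+

lemma lsh_in_fock_alg: "lsh k \<in> fock_alg" and lb_in_fock_alg: "lb \<in> fock_alg"
  by (intro fock_algI; simp add: left_right_commute)+

lemma right_gens_adjoint: "S \<in> right_gens \<Longrightarrow> bounded_op S" "S \<in> right_gens \<Longrightarrow> \<exists>S'\<in>right_gens. is_adjoint S S'"
  using is_adjoint_left_right(3) self_adjoint_rb by (auto simp: right_gens_def)

text \<open>The modular conjugation on basis words: taking adjoints reverses a product and inverts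
  its unitary factors.\<close>

definition flip_word :: "int list \<Rightarrow> int list" where
  "flip_word w = rev (map uminus w)"

lemma flip_word_simps [simp]: "flip_word (w @ [k]) = - k # flip_word w" "flip_word w = [] \<longleftrightarrow> w = []"
  "flip_word (flip_word w) = w" "flip_word [k] = [- k]"
  by (simp_all add: flip_word_def rev_map map_idI)

lemma right_gens_commutant: "rsh k \<in> commutant fock_alg" "rb \<in> commutant fock_alg"
  by (intro commutantI; simp add: fock_algD(2,3))+

text \<open>Every basis vector is \<open>X \<Omega>\<close> for a polynomial \<open>X\<close> in the right operators, and the adjoint of \<open>X\<close>
  creates the reflected word.  This makes \<open>\<Omega>\<close> separating and yields the trace property.\<close>

lemma vacuum_cyclic:
  assumes "w \<noteq> []"
  shows "\<exists>X X'. is_adjoint X X' \<and> X \<in> commutant fock_alg \<and> X' \<in> commutant fock_alg \<and>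
    X \<Omega> = kw w \<and> X' \<Omega> = kw (flip_word w)"
  using assms
proof (induction "length w" arbitrary: w rule: less_induct)
  case less
  let ?Q = "\<lambda>w X X'. is_adjoint X X' \<and> X \<in> commutant fock_alg \<and> X' \<in> commutant fock_alg \<and>
    X \<Omega> = kw w \<and> X' \<Omega> = kw (flip_word w)"
  obtain v k where w: "w = v @ [k]" using less.prems by (cases w rule: rev_cases) auto
  show ?case
  proof (cases "v = []")
    case True
    have "?Q w (rsh k) (rsh (- k))"
      using w True by (simp add: is_adjoint_left_right right_gens_commutant \<Omega>_def left_right_kw)
    thus ?thesis by blast
  next
    case False
    have "length v < length w" using w by simp
    from less.hyps[OF this False] obtain X X' where X: "?Q v X X'" by blast
    define c where "c \<longleftrightarrow> last v = 0 \<and> butlast v \<noteq> []"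
    have "\<exists>Z Z'. is_adjoint Z Z' \<and> Z \<in> commutant fock_alg \<and> Z' \<in> commutant fock_alg \<and>
        Z \<Omega> = (if c then kw (butlast v) else 0) \<and> Z' \<Omega> = (if c then kw (flip_word (butlast v)) else 0)"
    proof (cases c)
      case True
      have "length (butlast v) < length w" "butlast v \<noteq> []" using w True by (simp_all add: c_def)
      from less.hyps[OF this] obtain Z Z' where "?Q (butlast v) Z Z'" by blast
      thus ?thesis using True by auto
    next
      case False
      have "is_adjoint (\<lambda>_. 0) (\<lambda>_ :: nat ell2. 0 :: nat ell2)" by (simp add: is_adjoint_def)
      moreover have "(\<lambda>_. 0) \<in> commutant fock_alg"
        by (rule commutantI) (simp_all add: bounded_opD(5)[OF fock_algD(1)])
      ultimately show ?thesis using False by (intro exI[of _ "\<lambda>_. 0"]) simp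
    qed
    then obtain Z Z' where Z: "is_adjoint Z Z'" "Z \<in> commutant fock_alg" "Z' \<in> commutant fock_alg"
      "Z \<Omega> = (if c then kw (butlast v) else 0)" "Z' \<Omega> = (if c then kw (flip_word (butlast v)) else 0)" by blast
    \<comment> \<open>\<open>rb\<close> both appends a 0 and removes a final 0; \<open>Z\<close>
      cancels the removed part, and the shift turns the new last letter into
      \<open>k\<close>.\<close>
    define Y where "Y x = rsh k (rb (X x) - Z x)" for x
    define Y' where "Y' x = X' (rb (rsh (- k) x)) - Z' (rsh (- k) x)" for x
    have Xb: "is_adjoint X X'" "bounded_op X" "bounded_op X'" "bounded_op Z" "bounded_op Z'"
      using X Z is_adjointD(3,4) by blast+
    have bd: "bounded_op Y" "bounded_op Y'"
    proof -
      have "bounded_op (rsh k \<circ> (\<lambda>x. (rb \<circ> X) x - Z x))"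
        "bounded_op (\<lambda>x. (X' \<circ> (rb \<circ> rsh (- k))) x - (Z' \<circ> rsh (- k)) x)"
        by (intro bounded_op_compose bounded_op_diff Xb bounded_op_left_right bounded_op_rb)+
      thus "bounded_op Y" "bounded_op Y'" by (simp_all add: Y_def[abs_def] Y'_def[abs_def] o_def)
    qed
    have "is_adjoint Y Y'"
      unfolding is_adjoint_def
    proof (intro conjI allI bd)
      show "cinner (Y x) y = cinner x (Y' y)" for x y
        by (simp add: Y_def Y'_def is_adjointD(1)[OF is_adjoint_left_right(3)] is_adjointD(1)[OF self_adjoint_rb]
            is_adjointD(1)[OF Xb(1)] is_adjointD(1)[OF Z(1)])
    qed
    moreover have "Y \<in> commutant fock_alg" "Y' \<in> commutant fock_alg"
    proof (safe intro!: commutantI bd)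
      fix T x assume T: "T \<in> fock_alg"
      have "T (X y) = X (T y)" "T (X' y) = X' (T y)" "T (Z y) = Z (T y)" "T (Z' y) = Z' (T y)" for y
        using X Z T by (auto intro: commutantD(2))
      thus "T (Y x) = Y (T x)" "T (Y' x) = Y' (T x)"
        by (simp_all add: Y_def Y'_def fock_algD(2,3)[OF T, symmetric] bounded_opD(3)[OF fock_algD(1)[OF T]])
    qed
    moreover have "Y \<Omega> = kw w"
      using X Z False by (simp add: Y_def rb_def left_right_kw annihilation_kw w c_def)
    moreover have "Y' \<Omega> = kw (flip_word w)"
    proof -
      have fl: "hd (flip_word v) = - last v" "tl (flip_word v) = flip_word (butlast v)"
        using False by (cases v rule: rev_cases; simp)+
      \<comment> \<open>On the vacuum left and right operators agree, so the right operators in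
        \<open>Y'\<close> can be traded for left ones, which commute with \<open>X'\<close> and
        \<open>Z'\<close>.\<close>
      have 1: "rsh (- k) \<Omega> = lsh (- k) \<Omega>" "rb \<Omega> = lb \<Omega>"
        by (simp_all add: \<Omega>_def left_right_kw rb_def lb_def annihilation_kw)
      have com: "lsh (- k) (X' x) = X' (lsh (- k) x)" "lb (X' x) = X' (lb x)" "lsh (- k) (Z' x) = Z' (lsh (- k) x)" for x
        using X Z lsh_in_fock_alg lb_in_fock_alg by (auto intro: commutantD(2))
      have "Y' \<Omega> = lsh (- k) (lb (X' \<Omega>) - Z' \<Omega>)"
        by (simp add: Y'_def 1 left_right_commute com bounded_opD(3)[OF bounded_op_left_right(1)])
      thus ?thesis
        using X Z(5) False by (simp add: lb_def left_right_kw annihilation_kw fl w c_def)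
    qed
    ultimately show ?thesis by blast
  qed
qed

text \<open>The coefficient at \<open>w\<close> is an inner product with \<open>X \<Omega>\<close>.
  Since \<open>X'\<close> commutes with \<open>T\<close>, it can be moved to the other side, where
  it creates the reflected word. Thus \<open>T' \<Omega>\<close> is the conjugate of
  \<open>T \<Omega>\<close>.\<close>

lemma fock_alg_vacuum_reflection:
  assumes "T \<in> fock_alg" "is_adjoint T T'" "w \<noteq> []"
  shows "wc (T \<Omega>) w = cnj (wc (T' \<Omega>) (flip_word w))"
proof -
  obtain X X' where X: "is_adjoint X X'" "\<And>x. X' (T x) = T (X' x)" "X \<Omega> = kw w" "X' \<Omega> = kw (flip_word w)"
    using vacuum_cyclic[OF assms(3)] commutantD(2)[OF _ assms(1)] by metis
  have "wc (T \<Omega>) w = cinner (X \<Omega>) (T \<Omega>)" by (simp add: X cinner_kw)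
  also have "\<dots> = cinner \<Omega> (T (X' \<Omega>))" by (simp add: is_adjointD(1)[OF X(1)] X(2))
  also have "\<dots> = cnj (wc (T' \<Omega>) (flip_word w))" by (simp add: is_adjointD(2)[OF assms(2)] X cinner_kw)
  finally show ?thesis .
qed

text \<open>By Parseval and the reflection formula, reindexing the words by \<open>flip_word\<close>
  exchanges the roles of \<open>S\<close> and \<open>T\<close>.\<close>

lemma vac_tracial: 
  assumes S: "S \<in> fock_alg" and T: "T \<in> fock_alg"
  shows "vac (S \<circ> T) = vac (T \<circ> S)"
proof -
  obtain S' where S': "is_adjoint S S'" using adjoint_exists[OF fock_algD(1)[OF S]] by blast
  obtain T' where T': "is_adjoint T T'" using adjoint_exists[OF fock_algD(1)[OF T]] by blast
  have "vac (S \<circ> T) = cinner (S' \<Omega>) (T \<Omega>)" by (simp add: vac_def is_adjointD(2)[OF S'])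
  also have "\<dots> = (\<Sum>\<^sub>\<infinity>w\<in>{w. w \<noteq> []}. cnj (wc (S' \<Omega>) w) * wc (T \<Omega>) w)" by (rule cinner_wc)
  also have "\<dots> = (\<Sum>\<^sub>\<infinity>w\<in>{w. w \<noteq> []}. cnj (wc (T' \<Omega>) w) * wc (S \<Omega>) w)"
    by (rule infsum_reindex_bij_witness[of _ flip_word flip_word])
      (simp_all add: fock_alg_vacuum_reflection[OF S S'] fock_alg_vacuum_reflection[OF T T'])
  also have "\<dots> = cinner (T' \<Omega>) (S \<Omega>)" by (rule cinner_wc[symmetric])
  also have "\<dots> = vac (T \<circ> S)" by (simp add: vac_def is_adjointD(2)[OF T'])
  finally show ?thesis .
qed

theorem tracial_vN_algebra_fock: "tracial_vN_algebra fock_alg vac"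
  unfolding tracial_vN_algebra_def
proof (intro conjI)
  show "von_neumann_algebra fock_alg"
    unfolding fock_alg_def by (intro von_neumann_algebra_commutant right_gens_adjoint)
  show "state_on fock_alg vac"
  proof -
    have "vac T \<in> \<real>\<^sub>\<ge>\<^sub>0" if "positive_op T" for T
      using that by (simp add: vac_def positive_op_def)
    moreover have "vac id = 1" by (simp add: vac_def \<Omega>_def cinner_kw wc_kw)
    ultimately show ?thesis by (simp add: state_on_def vac_def)
  qed
  show "normal_on fock_alg vac"
    unfolding vac_def[abs_def] by (rule normal_on_vector_state)
  show "tracial_on fock_alg vac" by (simp add: tracial_on_def vac_tracial)
  show "faithful_on fock_alg vac"
    unfolding faithful_on_def
  proof (intro ballI impI, elim conjE)
    fix T assume T: "T \<in> fock_alg" "positive_op T" "vac T = 0"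
    \<comment> \<open>A positive operator with vanishing form at the vacuum kills it, and operators
      commuting with \<open>T\<close> carry the vacuum to every basis vector.\<close>
    have T0: "T \<Omega> = 0" by (rule positive_op_null[OF T(2)]) (use T(3) in \<open>simp add: vac_def\<close>)
    show "T = (\<lambda>_. 0)"
    proof (rule op_eq_zeroI[OF fock_algD(1)[OF T(1)]])
      fix i
      obtain X X' where X: "is_adjoint X X'" "\<And>x. X (T x) = T (X x)" "X \<Omega> = kw (dec i)"
        using vacuum_cyclic[OF dec_nonempty[of i]] commutantD(2)[OF _ T(1)] by metis
      have "T (ket i) = X (T \<Omega>)" by (simp add: X kw_def)
      thus "T (ket i) = 0" using bounded_opD(5)[OF is_adjointD(3)[OF X(1)]] by (simp add: T0)
    qed
  qed
qed

subsection \<open>Convolution operators\<close>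

lemma lsh_lsh [simp]: "lsh j (lsh k x) = lsh (j + k) x"
  by (rule wc_eqI) (simp add: wc_left_right algebra_simps)

lemma lsh_0 [simp]: "lsh 0 x = x"
  by (rule wc_eqI) (simp add: wc_left_right)

lemma lan_lcr [simp]: "lan (lcr x) = x"
  by (rule wc_eqI) (simp add: wc_left_right)

lemma lan_\<Omega> [simp]: "lan \<Omega> = 0"
  by (simp add: \<Omega>_def annihilation_kw)

lemma cinner_\<Omega>_\<Omega> [simp]: "cinner \<Omega> \<Omega> = 1"
  by (simp add: \<Omega>_def cinner_kw wc_kw)

lemma cinner_\<Omega>_lcr [simp]: "cinner \<Omega> (lcr x) = 0"
  using is_adjointD(2)[OF is_adjoint_left_right(2), of \<Omega> x] by simp

lemma lan_lsh_lcr: "lan (lsh m (lcr y)) = (if m = 0 then y else 0)"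
  by (rule wc_eqI) (simp add: wc_left_right)

definition conv_op :: "(int \<Rightarrow> real) \<Rightarrow> nat op" where
  "conv_op p = op_series p lsh"

text \<open>Both the vacuum expectations of \<open>lsh m\<close> times the \<open>n\<close>-th power of \<open>conv_op p\<close> and the Fourier
  coefficients of the \<open>n\<close>-th power of the spectral density satisfy this recursion.\<close>

fun tmom :: "(int \<Rightarrow> real) \<Rightarrow> nat \<Rightarrow> int \<Rightarrow> complex" where
  "tmom p 0 m = (if m = 0 then 1 else 0)"
| "tmom p (Suc n) m = (\<Sum>\<^sub>\<infinity>k. of_real (p k) * tmom p n (m + k))"

section \<open>Symmetric partial sums and Toeplitz positivity\<close>

lemma has_sum_finite_sum:
  fixes f :: "'a \<Rightarrow> 'b \<Rightarrow> 'c :: topological_comm_monoid_add"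
  assumes "\<And>i. i \<in> I \<Longrightarrow> (f i has_sum s i) A"
  shows "((\<lambda>x. \<Sum>i\<in>I. f i x) has_sum (\<Sum>i\<in>I. s i)) A"
  using assms by (induction I rule: infinite_finite_induct) (auto intro!: has_sum_add)

text \<open>A negative limit of the increments would drive \<open>S\<close> to minus infinity at a
  linear rate.\<close>

lemma increment_limit_nonneg:
  fixes S s :: "nat \<Rightarrow> real"
  assumes S: "\<And>N. S N \<ge> 0" "\<And>N. S (Suc N) = S N + s N" and lim: "s \<longlonglongrightarrow> l"
  shows "l \<ge> 0"
proof (rule ccontr)
  assume "\<not> l \<ge> 0"
  hence "\<forall>\<^sub>F N in sequentially. s N < l / 2" by (intro order_tendstoD(2)[OF lim]) simp
  then obtain N0 where N0: "\<And>N. N \<ge> N0 \<Longrightarrow> s N < l / 2" by (auto simp: eventually_at_top_linorder)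
  have *: "S (N0 + k) \<le> S N0 + of_nat k * (l / 2)" for k
  proof (induction k)
    case (Suc k)
    show ?case using Suc.IH N0[of "N0 + k"] by (simp add: S(2) field_simps)
  qed simp
  obtain k :: nat where "of_nat k > S N0 / (- l / 2)" using reals_Archimedean2 by blast
  hence "S N0 + of_nat k * (l / 2) < 0" using \<open>\<not> l \<ge> 0\<close> by (simp add: field_simps)
  thus False using *[of k] S(1)[of "N0 + k"] by linarith
qed

lemma has_sum_symmetric_intervals:
  fixes f :: "int \<Rightarrow> 'a :: {topological_comm_monoid_add}"
  assumes "(f has_sum s) UNIV"
  shows "(\<lambda>N. \<Sum>k\<in>{- int N..int N}. f k) \<longlonglongrightarrow> s"
proof -
  have "filterlim (\<lambda>N. {- int N..int N}) (finite_subsets_at_top UNIV) sequentially"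
    unfolding filterlim_finite_subsets_at_top
  proof (intro allI impI, elim conjE)
    fix X :: "int set" assume "finite X"
    then obtain B where B: "\<And>x. x \<in> X \<Longrightarrow> \<bar>x\<bar> \<le> B" using finite_abs_int_segment
      by (metis Max_ge finite_imageI imageI)
    have "X \<subseteq> {- int N..int N}" if "N \<ge> nat B" for N
    proof
      fix x assume "x \<in> X"
      from B[OF this] that show "x \<in> {- int N..int N}" by auto
    qed
    thus "\<forall>\<^sub>F N in sequentially. finite {- int N..int N} \<and> X \<subseteq> {- int N..int N} \<and> {- int N..int N} \<subseteq> UNIV"
      by (intro eventually_sequentiallyI[of "nat B"]) auto
  qed
  thus ?thesis using assms unfolding has_sum_def by (rule filterlim_compose[rotated])
qed

text \<open>Bordering a Toeplitz matrix by a row and a column adds one entry for each difference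
  from \<open>- N\<close> to \<open>N\<close>.\<close>

lemma toeplitz_sum_Suc:
  fixes f :: "int \<Rightarrow> 'a :: comm_ring_1"
  shows "(\<Sum>i<Suc N. \<Sum>j<Suc N. f (int i - int j)) =
    (\<Sum>i<N. \<Sum>j<N. f (int i - int j)) + (\<Sum>k\<in>{- int N..int N}. f k)"
proof -
  have "{- int N..int N} = insert 0 ({1..int N} \<union> {- int N..-1})" by auto
  hence "(\<Sum>k\<in>{- int N..int N}. f k) = f 0 + ((\<Sum>k\<in>{1..int N}. f k) + (\<Sum>k\<in>{- int N..-1}. f k))"
    by (simp add: sum.union_disjoint)
  also have "(\<Sum>k\<in>{1..int N}. f k) = (\<Sum>j<N. f (int N - int j))"
    by (rule sum.reindex_bij_witness[of _ "\<lambda>j. int N - int j" "\<lambda>k. nat (int N - k)"]) auto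
  also have "(\<Sum>k\<in>{- int N..-1}. f k) = (\<Sum>i<N. f (int i - int N))"
    by (rule sum.reindex_bij_witness[of _ "\<lambda>i. int i - int N" "\<lambda>k. nat (k + int N)"]) auto
  finally show ?thesis by (simp add: sum.distrib algebra_simps)
qed

text \<open>The symmetric partial sums are the increments of a nonnegative sequence, so their limit
  cannot be negative. This yields positivity both of the convolution operator and of the spectral
  density.\<close>

lemma toeplitz_positive_infsum:
  fixes f :: "int \<Rightarrow> complex"
  assumes f: "f summable_on UNIV" and pos: "\<And>N. (\<Sum>i<N. \<Sum>j<N. f (int i - int j)) \<in> \<real>\<^sub>\<ge>\<^sub>0"
  shows "(\<Sum>\<^sub>\<infinity>k. f k) \<in> \<real>\<^sub>\<ge>\<^sub>0"
proof -
  define s where "s N = (\<Sum>k\<in>{- int N..int N}. f k)" for N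
  define S where "S N = (\<Sum>i<N. \<Sum>j<N. f (int i - int j))" for N
  have S: "S (Suc N) = S N + s N" for N unfolding S_def s_def by (rule toeplitz_sum_Suc)
  have S0: "Re (S N) \<ge> 0" "Im (S N) = 0" for N
    using pos[of N] by (simp_all add: S_def complex_nonneg_Reals_iff)
  have lim: "s \<longlonglongrightarrow> (\<Sum>\<^sub>\<infinity>k. f k)"
    unfolding s_def using f by (intro has_sum_symmetric_intervals has_sum_infsum)
  have "Im (s N) = 0" for N using S[of N] S0[of N] S0[of "Suc N"] by simp
  hence "Im (\<Sum>\<^sub>\<infinity>k. f k) = 0" using tendsto_Im[OF lim] by (simp add: LIMSEQ_const_iff)
  moreover have "Re (\<Sum>\<^sub>\<infinity>k. f k) \<ge> 0"
    by (rule increment_limit_nonneg[of "\<lambda>N. Re (S N)" "\<lambda>N. Re (s N)"]) 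
      (use S S0 tendsto_Re[OF lim] in auto)
  ultimately show ?thesis by (simp add: complex_nonneg_Reals_iff)
qed

context
  fixes p :: "int \<Rightarrow> real"
  assumes sp: "(\<lambda>k. \<bar>p k\<bar>) summable_on UNIV"
begin

lemmas conv_op_series = sp bounded_op_left_right(1) norm_lsh_le

lemma bounded_op_conv_op: "bounded_op (conv_op p)"
  unfolding conv_op_def by (rule bounded_op_series[OF conv_op_series])

lemma cinner_conv_op: "((\<lambda>k. of_real (p k) * cinner y (lsh k x)) has_sum cinner y (conv_op p x)) UNIV"
  unfolding conv_op_def by (rule cinner_op_series[OF conv_op_series])

lemma conv_op_in_fock_alg: "conv_op p \<in> fock_alg"
  unfolding conv_op_def
  by (intro fock_algI bounded_op_series op_series_commute conv_op_series) (simp_all add: left_right_commute)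

lemma cinner_lsh_conv_op:
  "cinner y (lsh m (conv_op p x)) = (\<Sum>\<^sub>\<infinity>k. of_real (p k) * cinner y (lsh (m + k) x))"
proof -
  have "cinner y (lsh m (conv_op p x)) = cinner (lsh (- m) y) (conv_op p x)"
    by (rule is_adjointD(2)[OF is_adjoint_left_right(1)])
  also have "\<dots> = (\<Sum>\<^sub>\<infinity>k. of_real (p k) * cinner (lsh (- m) y) (lsh k x))"
    by (rule infsumI[symmetric, OF cinner_conv_op])
  also have "\<dots> = (\<Sum>\<^sub>\<infinity>k. of_real (p k) * cinner y (lsh (m + k) x))"
    by (simp add: is_adjointD(2)[OF is_adjoint_left_right(1), of y m, symmetric])
  finally show ?thesis .
qed

text \<open>The free factor \<open>c\<close> covers three situations at once: two created vectors,
  the vacuum with itself (\<open>c = 1\<close>), and the vacuum with a created vector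
  (\<open>c = 0\<close>).\<close>

lemma cinner_lsh_conv_op_funpow:
  assumes "\<And>m. cinner y (lsh m x) = (if m = 0 then 1 else 0) * c"
  shows "cinner y (lsh m ((conv_op p ^^ n) x)) = tmom p n m * c"
proof (induction n arbitrary: m)
  case 0
  show ?case using assms[of m] by simp
next
  case (Suc n)
  show ?case by (simp add: cinner_lsh_conv_op Suc infsum_cmult_left' mult.assoc[symmetric])
qed

text \<open>Compressed by creation, a power of the convolution operator becomes the scalar that is
  also its vacuum moment. Hence a centred polynomial compresses to 0, which is what freeness
  uses.\<close>

lemma conv_op_moments:
  "cinner (lcr x) ((conv_op p ^^ n) (lcr y)) = tmom p n 0 * cinner x y"
  "vac (conv_op p ^^ n) = tmom p n 0"
  "cinner \<Omega> ((conv_op p ^^ n) (lcr y)) = 0"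
proof -
  have "cinner (lcr x) (lsh m (lcr y)) = (if m = 0 then 1 else 0) * cinner x y" for m
    by (simp add: is_adjointD(1)[OF is_adjoint_left_right(2)] lan_lsh_lcr)
  from cinner_lsh_conv_op_funpow[OF this, of 0 n]
  show "cinner (lcr x) ((conv_op p ^^ n) (lcr y)) = tmom p n 0 * cinner x y" by simp
  have "cinner \<Omega> (lsh m \<Omega>) = (if m = 0 then 1 else 0) * 1" for m
    by (simp add: \<Omega>_def left_right_kw cinner_kw wc_kw)
  from cinner_lsh_conv_op_funpow[OF this, of 0 n]
  show "vac (conv_op p ^^ n) = tmom p n 0" by (simp add: vac_def)
  have "cinner \<Omega> (lsh m (lcr y)) = (if m = 0 then 1 else 0) * 0" for m
    by (simp add: \<Omega>_def cinner_kw wc_left_right)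
  from cinner_lsh_conv_op_funpow[OF this, of 0 n]
  show "cinner \<Omega> ((conv_op p ^^ n) (lcr y)) = 0" by simp
qed

context
  assumes even: "\<And>k. p (- k) = p k"
begin

lemma conv_op_self_adjoint: "is_adjoint (conv_op p) (conv_op p)"
  unfolding is_adjoint_def
proof (intro conjI allI bounded_op_conv_op)
  fix x y
  have "cinner (conv_op p x) y = cnj (cinner y (conv_op p x))" by simp
  also have "\<dots> = (\<Sum>\<^sub>\<infinity>k. cnj (of_real (p k) * cinner y (lsh k x)))"
    by (simp only: infsumI[symmetric, OF cinner_conv_op] infsum_cnj)
  also have "\<dots> = (\<Sum>\<^sub>\<infinity>k. of_real (p k) * cinner x (lsh k y))"
    by (rule infsum_reindex_bij_witness[of _ uminus uminus])
      (simp_all add: even is_adjointD(1)[OF is_adjoint_left_right(1)])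
  also have "\<dots> = cinner x (conv_op p y)" by (rule infsumI[OF cinner_conv_op])
  finally show "cinner (conv_op p x) y = cinner x (conv_op p y)" .
qed

text \<open>In the Toeplitz sums \<open>cinner x (lsh (i - j) x)\<close> is an inner product of two
  shifted copies of \<open>x\<close>, so each coordinate contributes one instance of the
  hypothesis.\<close>

lemma positive_conv_op:
  assumes pos: "\<And>N c. (\<Sum>i<N. \<Sum>j<N. of_real (p (int i - int j)) * cnj (c i) * c j) \<in> \<real>\<^sub>\<ge>\<^sub>0"
  shows "positive_op (conv_op p)"
  unfolding positive_op_def
proof (intro conjI allI bounded_op_conv_op)
  fix x
  have "(\<Sum>i<N. \<Sum>j<N. of_real (p (int i - int j)) * cinner x (lsh (int i - int j) x)) \<in> \<real>\<^sub>\<ge>\<^sub>0" for N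
  proof -
    define c where "c u i = coord (lsh (- int i) x) u" for u i
    have hs: "((\<lambda>u. \<Sum>i<N. \<Sum>j<N. of_real (p (int i - int j)) * (cnj (c u i) * c u j)) has_sum
      (\<Sum>i<N. \<Sum>j<N. of_real (p (int i - int j)) * cinner (lsh (- int i) x) (lsh (- int j) x))) UNIV"
      unfolding c_def cinner.rep_eq
      by (intro has_sum_finite_sum has_sum_cmult_right has_sum_infsum summable_cinner)
    have nn: "0 \<le> (\<Sum>i<N. \<Sum>j<N. of_real (p (int i - int j)) * (cnj (c u i) * c u j))" for u
      using pos[where N = N and c = "c u"] by (simp add: mult.assoc complex_nonneg_Reals_iff less_eq_complex_def)
    have "0 \<le> (\<Sum>i<N. \<Sum>j<N. of_real (p (int i - int j)) * cinner (lsh (- int i) x) (lsh (- int j) x))"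
      unfolding infsumI[OF hs, symmetric] by (rule infsum_nonneg_complex[OF has_sum_imp_summable[OF hs] nn])
    hence "(\<Sum>i<N. \<Sum>j<N. of_real (p (int i - int j)) * cinner (lsh (- int i) x) (lsh (- int j) x)) \<in> \<real>\<^sub>\<ge>\<^sub>0"
      by (simp add: complex_nonneg_Reals_iff less_eq_complex_def)
    also have "(\<Sum>i<N. \<Sum>j<N. of_real (p (int i - int j)) * cinner (lsh (- int i) x) (lsh (- int j) x)) =
        (\<Sum>i<N. \<Sum>j<N. of_real (p (int i - int j)) * cinner x (lsh (int i - int j) x))"
      by (simp add: is_adjointD(1)[OF is_adjoint_left_right(1)])
    finally show ?thesis .
  qed
  from toeplitz_positive_infsum[OF has_sum_imp_summable[OF cinner_conv_op] this]
  show "cinner x (conv_op p x) \<in> \<real>\<^sub>\<ge>\<^sub>0" by (simp add: infsumI[OF cinner_conv_op])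
qed

end

end

subsection \<open>Freeness\<close>

text \<open>The number of paths with \<open>k\<close> steps up or down from height 0 to height
  \<open>n\<close> that never go below 0. It governs the powers of \<open>lb\<close> as well as the
  expansion of \<open>x ^ k\<close> in the orthogonal polynomials of \<open>mu_s\<close>, and so
  identifies the law of \<open>lb\<close>.\<close>

fun ballot :: "nat \<Rightarrow> nat \<Rightarrow> real" where
  "ballot 0 n = (if n = 0 then 1 else 0)"
| "ballot (Suc k) n = (if n = 0 then 0 else ballot k (n - 1)) + ballot k (Suc n)"

lemma ballot_eq_0: "n > k \<Longrightarrow> ballot k n = 0"
  by (induction k arbitrary: n) auto

lemma lb_funpow_ballot:
  assumes x: "lan x = 0" and N: "N \<ge> k"
  shows "(lb ^^ k) x = (\<Sum>n\<le>N. of_real (ballot k n) *\<^sub>C (lcr ^^ n) x)"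
  using N
proof (induction k arbitrary: N)
  case 0
  show ?case by (subst sum.remove[of _ 0]) auto
next
  case (Suc k)
  define L where "L n = (lcr ^^ n) x" for n
  have step: "lb (L n) = L (Suc n) + (if n = 0 then 0 else L (n - 1))" for n
    by (cases n) (simp_all add: L_def lb_def x)
  \<comment> \<open>No path of length \<open>k\<close> reaches these heights, so the sums can be
    lengthened by one term for the index shifts.\<close>
  have z: "ballot k (Suc N) = 0" "ballot k N = 0" using Suc.prems by (auto intro: ballot_eq_0)
  have "(lb ^^ Suc k) x = (\<Sum>n\<le>N. of_real (ballot k n) *\<^sub>C lb (L n))"
    using Suc.IH[of N] Suc.prems
    by (simp add: bounded_opD[OF bounded_op_lb] L_def)
  also have "\<dots> = (\<Sum>n\<le>N. of_real (ballot k n) *\<^sub>C L (Suc n)) +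
      (\<Sum>n\<le>N. of_real (ballot k n) *\<^sub>C (if n = 0 then 0 else L (n - 1)))"
    by (simp add: step scaleC_distribs sum.distrib)
  also have "(\<Sum>n\<le>N. of_real (ballot k n) *\<^sub>C L (Suc n)) =
      (\<Sum>n\<le>N. of_real (if n = 0 then 0 else ballot k (n - 1)) *\<^sub>C L n)"
  proof -
    have "(\<Sum>n\<le>Suc N. of_real (if n = 0 then 0 else ballot k (n - 1)) *\<^sub>C L n) =
        (\<Sum>n\<le>N. of_real (ballot k n) *\<^sub>C L (Suc n))"
      by (subst sum.atMost_Suc_shift) simp
    thus ?thesis using z by simp
  qed
  also have "(\<Sum>n\<le>N. of_real (ballot k n) *\<^sub>C (if n = 0 then 0 else L (n - 1))) =
      (\<Sum>n\<le>N. of_real (ballot k (Suc n)) *\<^sub>C L n)"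
  proof -
    have "(\<Sum>n\<le>Suc N. of_real (ballot k n) *\<^sub>C (if n = 0 then 0 else L (n - 1))) =
      (\<Sum>n\<le>N. of_real (ballot k (Suc n)) *\<^sub>C L n)"
      by (subst sum.atMost_Suc_shift) simp
    thus ?thesis using z by simp
  qed
  finally show ?case
    by (simp add: sum.distrib[symmetric] scaleC_distribs[symmetric] L_def)
qed

lemma vac_lb_funpow: "vac (lb ^^ k) = of_real (ballot k 0)"
proof -
  have "(\<Sum>n\<le>k. complex_of_real (ballot k n) * cinner \<Omega> ((lcr ^^ n) \<Omega>)) = of_real (ballot k 0)"
  proof -
    have *: "cinner \<Omega> ((lcr ^^ n) \<Omega>) = (if n = 0 then 1 else 0)" for n by (cases n) simp_all
    show ?thesis unfolding * by (simp add: if_distrib cong: if_cong)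
  qed
  thus ?thesis
    by (simp add: vac_def lb_funpow_ballot[OF lan_\<Omega> order_refl] cinner_sum)
qed

text \<open>On vectors killed by \<open>lan\<close>, \<open>T x\<close> is a multiple of
  \<open>x\<close> plus a created vector, and the multiple is \<open>vac T\<close>.\<close>

lemma generated_algebra_lb:
  assumes T: "T \<in> generated_algebra lb" "vac T = 0" and x: "lan x = 0"
  shows "\<exists>y. T x = lcr y"
proof -
  obtain N c where Tx: "\<And>x. T x = (\<Sum>k\<le>N. c k *\<^sub>C (lb ^^ k) x)"
    using T(1) by (auto simp: generated_algebra_def)
  define e where "e n = (\<Sum>k\<le>N. c k * of_real (ballot k n))" for n
  have ex: "T x = (\<Sum>n\<le>N. e n *\<^sub>C (lcr ^^ n) x)" if "lan x = 0" for x
  proof -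
    have "T x = (\<Sum>k\<le>N. \<Sum>n\<le>N. (c k * of_real (ballot k n)) *\<^sub>C (lcr ^^ n) x)"
      unfolding Tx by (rule sum.cong) (simp_all add: lb_funpow_ballot[OF that] scaleC_sum)
    also have "\<dots> = (\<Sum>n\<le>N. \<Sum>k\<le>N. (c k * of_real (ballot k n)) *\<^sub>C (lcr ^^ n) x)" by (rule sum.swap)
    also have "\<dots> = (\<Sum>n\<le>N. e n *\<^sub>C (lcr ^^ n) x)"
    proof -
      have "(\<Sum>k\<in>A. f k *\<^sub>C z) = (\<Sum>k\<in>A. f k) *\<^sub>C z" for A and f :: "nat \<Rightarrow> complex" and z :: "nat ell2"
        by (induction A rule: infinite_finite_induct) (simp_all add: scaleC_distribs)
      thus ?thesis by (simp add: e_def)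
    qed
    finally show ?thesis .
  qed
  have split: "(\<Sum>n\<le>N. e n *\<^sub>C (lcr ^^ n) x) = e 0 *\<^sub>C x + lcr (\<Sum>n<N. e (Suc n) *\<^sub>C (lcr ^^ n) x)" for x
    by (subst sum.atMost_shift) (simp add: bounded_opD[OF bounded_op_left_right(2)])
  have "vac T = e 0" by (simp add: vac_def ex split)
  thus ?thesis using T(2) by (auto simp: ex[OF x] split)
qed

text \<open>Centred polynomials in \<open>lb\<close> send \<open>V1\<close> and the vacuum into
  \<open>V2\<close>, those in \<open>conv_op p\<close> send \<open>V2\<close> and the vacuum into
  \<open>V1\<close>. An alternating product applied to the vacuum therefore ends in one of these
  spaces, and both are orthogonal to the vacuum.\<close>

lemma free_pair_conv_op_lb:
  assumes sp: "(\<lambda>k. \<bar>p k\<bar>) summable_on UNIV" and even: "\<And>k. p (- k) = p k"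
  shows "free_pair vac (conv_op p) lb"
  unfolding free_pair_def freely_independent_def
proof (intro allI impI, elim conjE)
  fix n :: nat and j :: "nat \<Rightarrow> bool" and T :: "nat \<Rightarrow> nat op"
  assume n: "1 \<le> n" and T: "\<forall>k<n. T k \<in> generated_algebra (if j k then conv_op p else lb) \<and> vac (T k) = 0"
    and alt: "\<forall>k. Suc k < n \<longrightarrow> j k \<noteq> j (Suc k)"
  define V1 where "V1 = {x. lan x = 0 \<and> cinner \<Omega> x = 0}"
  define V2 where "V2 = range lcr"
  have a: "S x \<in> V1" if S: "S \<in> generated_algebra (conv_op p)" "vac S = 0" and x: "x \<in> V2 \<or> x = \<Omega>" for S x
  proof -
    obtain N c where Sx: "\<And>x. S x = (\<Sum>k\<le>N. c k *\<^sub>C (conv_op p ^^ k) x)"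
      using S(1) by (auto simp: generated_algebra_def)
    have vacS: "(\<Sum>k\<le>N. c k * tmom p k 0) = 0"
      using S(2) conv_op_moments(2)[OF sp] by (simp add: vac_def Sx cinner_sum)
    have 1: "cinner (lcr y) ((conv_op p ^^ k) \<Omega>) = 0" for y k
    proof -
      have "cinner (lcr y) ((conv_op p ^^ k) \<Omega>) = cnj (cinner \<Omega> ((conv_op p ^^ k) (lcr y)))"
        by (simp add: is_adjointD(1)[OF is_adjoint_funpow[OF conv_op_self_adjoint[OF sp even]]])
      thus ?thesis by (simp only: conv_op_moments(3)[OF sp] complex_cnj_zero)
    qed
    show ?thesis
      using x
    proof
      assume "x \<in> V2"
      then obtain y where y: "x = lcr y" by (auto simp: V2_def)
      have "lan (S x) = 0"
      proof (rule cinner_eqI)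
        fix z
        have "cinner z (lan (S x)) = cinner (lcr z) (S x)"
          by (simp add: is_adjointD(1)[OF is_adjoint_left_right(2)])
        also have "\<dots> = (\<Sum>k\<le>N. c k * tmom p k 0) * cinner z y"
          by (simp add: Sx y cinner_sum conv_op_moments(1)[OF sp] sum_distrib_right mult.assoc)
        finally show "cinner z (lan (S x)) = cinner z 0" by (simp add: vacS)
      qed
      thus ?thesis by (simp add: V1_def Sx y cinner_sum conv_op_moments(3)[OF sp])
    next
      assume y: "x = \<Omega>"
      have "lan (S x) = 0"
      proof (rule cinner_eqI)
        fix z
        have "cinner z (lan (S x)) = cinner (lcr z) (S x)"
          by (simp add: is_adjointD(1)[OF is_adjoint_left_right(2)])
        thus "cinner z (lan (S x)) = cinner z 0" by (simp add: Sx y cinner_sum 1)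
      qed
      thus ?thesis using S(2) by (simp add: V1_def y vac_def)
    qed
  qed
  have b: "S x \<in> V2" if S: "S \<in> generated_algebra lb" "vac S = 0" and x: "x \<in> V1 \<or> x = \<Omega>" for S x
    using generated_algebra_lb[OF S, of x] x by (auto simp: V1_def V2_def)
  define v where "v i = foldr (\<circ>) (map T [i..<n]) id \<Omega>" for i
  have v: "v i = T i (v (Suc i))" if "i < n" for i
    using that by (simp add: v_def upt_conv_Cons)
  have vn: "v n = \<Omega>" by (simp add: v_def)
  have "v i \<in> (if j i then V1 else V2)" if "i < n" for i
    using that
  proof (induction "n - i" arbitrary: i)
    case (Suc m)
    have Ti: "T i \<in> generated_algebra (if j i then conv_op p else lb)" "vac (T i) = 0"
      using T Suc.prems by auto
    have "v (Suc i) \<in> (if j i then V2 else V1) \<or> v (Suc i) = \<Omega>"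
    proof (cases "Suc i < n")
      case True
      hence "v (Suc i) \<in> (if j (Suc i) then V1 else V2)" using Suc by auto
      thus ?thesis using alt True by (auto split: if_splits)
    next
      case False
      thus ?thesis using Suc.prems vn by (metis Suc_lessI)
    qed
    thus ?case using a[of "T i" "v (Suc i)"] b[of "T i" "v (Suc i)"] Ti v[OF Suc.prems] by (auto split: if_splits)
  qed simp
  from this[of 0] n have "v 0 \<in> V1 \<or> v 0 \<in> V2" by (auto split: if_splits)
  hence "cinner \<Omega> (v 0) = 0" by (auto simp: V1_def V2_def)
  thus "vac (foldr (\<circ>) (map T [0..<n]) id) = 0" by (simp add: vac_def v_def)
qed

subsection \<open>A Schwinger-Dyson recursion\<close>

definition bword :: "(nat \<Rightarrow> int) \<Rightarrow> nat \<Rightarrow> nat \<Rightarrow> nat op" where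
  "bword k l h x = foldr (\<lambda>i x. lb (lsh (k i) x)) [l..<h] x"

text \<open>The leading shift by \<open>c\<close> is needed for a closed recursion: cutting a word
  leaves shifts at the ends of the pieces.\<close>

definition gword :: "(nat \<Rightarrow> int) \<Rightarrow> nat \<Rightarrow> nat \<Rightarrow> int \<Rightarrow> complex" where
  "gword k l h c = cinner \<Omega> (lsh c (bword k l h \<Omega>))"

lemma bword_empty [simp]: "bword k l l x = x"
  by (simp add: bword_def)

lemma bword_rec: "l < h \<Longrightarrow> bword k l h x = lb (lsh (k l) (bword k (Suc l) h x))"
  by (simp add: bword_def upt_conv_Cons)

lemma bword_fock_alg: "bword k l h \<in> fock_alg"
proof (cases "l \<le> h")
  case True
  thus ?thesis
  proof (induction l rule: inc_induct)
    case base
    have "bword k h h = id" by (simp add: fun_eq_iff)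
    thus ?case unfolding fock_alg_def by (simp only: commutant_id)
  next
    case (step l)
    have "bword k l h = lb \<circ> (lsh (k l) \<circ> bword k (Suc l) h)"
      using step.hyps by (simp add: fun_eq_iff bword_rec)
    thus ?case
      using step.IH lb_in_fock_alg lsh_in_fock_alg unfolding fock_alg_def by (simp only: commutant_compose)
  qed
next
  case False
  have "bword k l h = id" using False by (simp add: fun_eq_iff bword_def)
  thus ?thesis unfolding fock_alg_def by (simp only: commutant_id)
qed

lemma ran_lb: "ran (lb x) = lb (ran x) + cinner \<Omega> x *\<^sub>C \<Omega>"
proof (rule wc_eqI)
  fix w :: "int list" assume "w \<noteq> []"
  thus "wc (ran (lb x)) w = wc (lb (ran x) + cinner \<Omega> x *\<^sub>C \<Omega>) w"
    by (cases w; cases "tl w") (auto simp: wc_left_right wc_lb_rb \<Omega>_def cinner_kw wc_kw)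
qed

lemma ran_lsh: "ran (lsh k x) = lsh k (ran x)"
  by (rule wc_eqI) (simp add: wc_left_right)

text \<open>Each \<open>lb\<close> that \<open>ran\<close> passes produces a vacuum projection,
  which cuts the word at its position \<open>j\<close>: the right part becomes a scalar, the left
  part a vector.\<close>

lemma ran_bword:
  assumes "l \<le> h"
  shows "ran (bword k l h x) = bword k l h (ran x) +
    (\<Sum>j\<in>{l..<h}. cinner \<Omega> (lsh (k j) (bword k (Suc j) h x)) *\<^sub>C bword k l j \<Omega>)"
  using assms
proof (induction l rule: inc_induct)
  case (step l)
  define c where "c j = cinner \<Omega> (lsh (k j) (bword k (Suc j) h x))" for j
  have "ran (bword k l h x) = lb (lsh (k l) (ran (bword k (Suc l) h x))) + c l *\<^sub>C \<Omega>"
    using step.hyps by (simp add: bword_rec ran_lb ran_lsh c_def)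
  also have "lb (lsh (k l) (ran (bword k (Suc l) h x))) = 
      bword k l h (ran x) + (\<Sum>j\<in>{Suc l..<h}. c j *\<^sub>C lb (lsh (k l) (bword k (Suc l) j \<Omega>)))"
    using step.hyps unfolding step.IH c_def[symmetric]
    by (simp add: bword_rec bounded_opD[OF bounded_op_left_right(1)] bounded_opD[OF bounded_op_lb])
  also have "(\<Sum>j\<in>{Suc l..<h}. c j *\<^sub>C lb (lsh (k l) (bword k (Suc l) j \<Omega>))) =
      (\<Sum>j\<in>{Suc l..<h}. c j *\<^sub>C bword k l j \<Omega>)"
    by (rule sum.cong) (simp_all add: bword_rec)
  finally show ?case
    using step.hyps unfolding c_def[symmetric]
    by (subst sum.atLeast_Suc_lessThan) simp_all
qed simp

text \<open>An instance of the trace property: on the vacuum the left and the right shift agree, and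
  the right shift commutes with \<open>T\<close>.\<close>

lemma cinner_\<Omega>_lsh:
  assumes "T \<in> fock_alg"
  shows "cinner \<Omega> (lsh c (T \<Omega>)) = cinner \<Omega> (T (lsh c \<Omega>))"
proof -
  have r: "rsh c \<Omega> = lsh c \<Omega>" for c by (simp add: \<Omega>_def left_right_kw)
  have "cinner \<Omega> (lsh c (T \<Omega>)) = cinner (lsh (- c) \<Omega>) (T \<Omega>)"
    by (rule is_adjointD(2)[OF is_adjoint_left_right(1)])
  also have "\<dots> = cinner \<Omega> (rsh c (T \<Omega>))"
    by (simp add: is_adjointD(2)[OF is_adjoint_left_right(3), of \<Omega> c] flip: r)
  also have "\<dots> = cinner \<Omega> (T (lsh c \<Omega>))" by (simp add: fock_algD(2)[OF assms] r)
  finally show ?thesis .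
qed

lemma gword_rec:
  assumes "l < h"
  shows "gword k l h c = (\<Sum>j\<in>{Suc l..<h}. gword k (Suc l) j (k l) * gword k (Suc j) h (c + k j))"
proof -
  define y where "y = lsh c \<Omega>"
  have y: "ran y = 0" by (simp add: y_def \<Omega>_def left_right_kw annihilation_kw)
  \<comment> \<open>On the vacuum \<open>lb\<close> agrees with \<open>rcr\<close>, so the leading
    \<open>lb\<close> turns into annihilation at the right end. The \<open>lb\<close> whose
    commutator with it is then picked up, at position \<open>j\<close>, is the partner of the one at
    \<open>l\<close>.\<close>
  have b: "cinner \<Omega> (lb z) = cinner \<Omega> (ran z)" for z
  proof -
    have "lb \<Omega> = rcr \<Omega>" by (simp add: lb_def \<Omega>_def left_right_kw annihilation_kw)
    thus ?thesis
      by (simp add: is_adjointD(2)[OF self_adjoint_lb] is_adjointD(1)[OF is_adjoint_left_right(4)])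
  qed
  have g: "cinner \<Omega> (lsh (k j) (bword k (Suc j) h y)) = gword k (Suc j) h (c + k j)" for j
  proof -
    have "lsh (k j) \<circ> bword k (Suc j) h \<in> fock_alg"
      using lsh_in_fock_alg bword_fock_alg unfolding fock_alg_def by (rule commutant_compose)
    from cinner_\<Omega>_lsh[OF this, of c] show ?thesis by (simp add: y_def gword_def)
  qed
  have "gword k l h c = cinner \<Omega> (lb (lsh (k l) (bword k (Suc l) h y)))"
    unfolding gword_def y_def cinner_\<Omega>_lsh[OF bword_fock_alg] unfolding bword_rec[OF assms] ..
  also have "\<dots> = cinner \<Omega> (lsh (k l) (ran (bword k (Suc l) h y)))" by (simp add: b ran_lsh)
  also have "ran (bword k (Suc l) h y) = (\<Sum>j\<in>{Suc l..<h}. gword k (Suc j) h (c + k j) *\<^sub>C bword k (Suc l) j \<Omega>)"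
    using assms by (subst ran_bword) (simp_all add: y g bounded_opD(5)[OF fock_algD(1)[OF bword_fock_alg]])
  also have "cinner \<Omega> (lsh (k l) \<dots>) = (\<Sum>j\<in>{Suc l..<h}. gword k (Suc l) j (k l) * gword k (Suc j) h (c + k j))"
    by (simp add: bounded_opD[OF bounded_op_left_right(1)] cinner_sum gword_def mult.commute)
  finally show ?thesis .
qed

lemma gword_empty: "gword k l l c = (if c = 0 then 1 else 0)"
  by (simp add: gword_def \<Omega>_def left_right_kw cinner_kw wc_kw)

text \<open>The bound is uniform in \<open>k\<close> because shifts are contractions; this makes the
  expansion over all \<open>k\<close> absolutely summable.\<close>

lemma norm_bword_le: "\<exists>K\<ge>0. \<forall>k l. norm (bword k l (l + n) x) \<le> K"
proof (induction n)
  case 0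
  show ?case by (rule exI[of _ "norm x"]) simp
next
  case (Suc n)
  then obtain K where K: "K \<ge> 0" "\<And>k l. norm (bword k l (l + n) x) \<le> K" by blast
  obtain L where L: "L > 0" "\<And>x. norm (lb x) \<le> L * norm x" using bounded_op_bound[OF bounded_op_lb] by blast
  have "norm (bword k l (l + Suc n) x) \<le> L * K" for k l
  proof -
    have "bword k l (l + Suc n) x = lb (lsh (k l) (bword k (Suc l) (Suc l + n) x))" by (simp add: bword_rec)
    also have "norm \<dots> \<le> L * norm (lsh (k l) (bword k (Suc l) (Suc l + n) x))" by (rule L)
    also have "\<dots> \<le> L * K"
      using L(1) K(2)[of k "Suc l"] norm_lsh_le[of "k l" "bword k (Suc l) (Suc l + n) x"]
      by (intro mult_left_mono) auto
    finally show ?thesis .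
  qed
  thus ?case using K L(1) by (intro exI[of _ "L * K"]) simp
qed

section \<open>Absolutely convergent sums over integer vectors\<close>

lemma bij_betw_PiE_insert:
  assumes "a \<notin> A"
  shows "bij_betw (\<lambda>(x, k). k(a := x)) (Sigma UNIV (\<lambda>_. PiE A (\<lambda>_. UNIV))) (PiE (insert a A) (\<lambda>_. UNIV))"
  by (rule bij_betw_byWitness[where f' = "\<lambda>k. (k a, k(a := undefined))"])
    (use assms in \<open>auto simp: PiE_def extensional_def fun_eq_iff\<close>)

lemma abs_summable_prod_PiE:
  fixes p :: "'b \<Rightarrow> real"
  assumes "finite A" "(\<lambda>k. \<bar>p k\<bar>) summable_on UNIV"
  shows "(\<lambda>k. \<Prod>i\<in>A. \<bar>p (k i)\<bar>) summable_on (PiE A (\<lambda>_. UNIV))"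
  using assms(1)
proof (induction A)
  case (insert a A)
  define s where "s = (\<Sum>\<^sub>\<infinity>k\<in>PiE A (\<lambda>_. UNIV). \<Prod>i\<in>A. \<bar>p (k i)\<bar>)"
  have "(\<lambda>(x, k). \<bar>p x\<bar> * (\<Prod>i\<in>A. \<bar>p (k i)\<bar>)) summable_on Sigma UNIV (\<lambda>_. PiE A (\<lambda>_. UNIV))"
  proof (rule summable_on_SigmaI[where g = "\<lambda>x. \<bar>p x\<bar> * s"])
    show "((\<lambda>k. case (x, k) of (x, k) \<Rightarrow> \<bar>p x\<bar> * (\<Prod>i\<in>A. \<bar>p (k i)\<bar>)) has_sum \<bar>p x\<bar> * s) (PiE A (\<lambda>_. UNIV))" for x
      unfolding s_def prod.case by (intro has_sum_cmult_right has_sum_infsum insert.IH)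
    show "(\<lambda>x. \<bar>p x\<bar> * s) summable_on UNIV" by (intro summable_on_cmult_left assms)
  qed (auto intro!: mult_nonneg_nonneg prod_nonneg)
  hence "(\<lambda>z. \<Prod>i\<in>insert a A. \<bar>p ((case z of (x, k) \<Rightarrow> k(a := x)) i)\<bar>) summable_on
      Sigma UNIV (\<lambda>_. PiE A (\<lambda>_. UNIV))"
  proof (rule summable_on_cong[THEN iffD1, rotated])
    fix z :: "'b \<times> ('a \<Rightarrow> 'b)"
    obtain x k where z: "z = (x, k)" by (cases z)
    have "(\<Prod>i\<in>A. \<bar>p ((k(a := x)) i)\<bar>) = (\<Prod>i\<in>A. \<bar>p (k i)\<bar>)"
      using insert.hyps by (intro prod.cong) auto
    thus "(case z of (x, k) \<Rightarrow> \<bar>p x\<bar> * (\<Prod>i\<in>A. \<bar>p (k i)\<bar>)) =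
        (\<Prod>i\<in>insert a A. \<bar>p ((case z of (x, k) \<Rightarrow> k(a := x)) i)\<bar>)"
      using insert.hyps by (simp add: z)
  qed
  thus ?case
    using summable_on_reindex_bij_betw[OF bij_betw_PiE_insert[OF insert.hyps(2)], 
        of "\<lambda>k. \<Prod>i\<in>insert a A. \<bar>p (k i)\<bar>"] by blast
qed simp

lemma infsum_PiE_insert:
  fixes f :: "('a \<Rightarrow> 'b) \<Rightarrow> complex"
  assumes a: "a \<notin> A" and f: "f summable_on (PiE (insert a A) (\<lambda>_. UNIV))"
  shows "infsum f (PiE (insert a A) (\<lambda>_. UNIV)) = (\<Sum>\<^sub>\<infinity>x. \<Sum>\<^sub>\<infinity>k\<in>PiE A (\<lambda>_. UNIV). f (k(a := x)))"
proof -
  let ?S = "Sigma UNIV (\<lambda>_. PiE A (\<lambda>_. UNIV)) :: ('b \<times> ('a \<Rightarrow> 'b)) set"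
  note bij = bij_betw_PiE_insert[OF a]
  have "infsum f (PiE (insert a A) (\<lambda>_. UNIV)) = (\<Sum>\<^sub>\<infinity>z\<in>?S. f (case z of (x, k) \<Rightarrow> k(a := x)))"
    by (rule infsum_reindex_bij_betw[OF bij, symmetric])
  also have "\<dots> = (\<Sum>\<^sub>\<infinity>(x, k)\<in>?S. f (k(a := x)))" by (simp add: case_prod_unfold)
  also have "\<dots> = (\<Sum>\<^sub>\<infinity>x. \<Sum>\<^sub>\<infinity>k\<in>PiE A (\<lambda>_. UNIV). f (k(a := x)))"
  proof (rule infsum_Sigma'_banach[symmetric])
    show "(\<lambda>(x, k). f (k(a := x))) summable_on ?S"
      using summable_on_reindex_bij_betw[OF bij, of f] f by (simp add: case_prod_unfold)
  qed
  finally show ?thesis .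
qed

text \<open>Both \<open>y\<close> and \<open>l\<close> vary in the induction: the leading factor is
  moved onto \<open>y\<close> by adjoints, and the remaining word starts at
  \<open>Suc l\<close>.\<close>

lemma expand_lb_conv_op_funpow:
  assumes sp: "(\<lambda>k. \<bar>p k\<bar>) summable_on UNIV"
  shows "cinner y (((lb \<circ> conv_op p) ^^ n) x) =
    (\<Sum>\<^sub>\<infinity>k\<in>PiE {l..<l + n} (\<lambda>_. UNIV). of_real (\<Prod>i\<in>{l..<l + n}. p (k i)) * cinner y (bword k l (l + n) x))"
proof (induction n arbitrary: y l)
  case (Suc n)
  let ?A = "{Suc l..<Suc l + n}"
  have A: "{l..<l + Suc n} = insert l ?A" "l \<notin> ?A" by auto
  define f where "f k = of_real (\<Prod>i\<in>insert l ?A. p (k i)) * cinner y (bword k l (l + Suc n) x)" for k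
  have f: "f summable_on (PiE (insert l ?A) (\<lambda>_. UNIV))"
  proof -
    obtain K where K: "K \<ge> 0" "\<And>k l. norm (bword k l (l + Suc n) x) \<le> K" using norm_bword_le by blast
    have "(\<lambda>k. norm (f k)) summable_on (PiE (insert l ?A) (\<lambda>_. UNIV))"
    proof (rule summable_on_comparison_test)
      show "(\<lambda>k. (\<Prod>i\<in>insert l ?A. \<bar>p (k i)\<bar>) * (norm y * K)) summable_on (PiE (insert l ?A) (\<lambda>_. UNIV))"
        by (intro summable_on_cmult_left abs_summable_prod_PiE sp) simp
      fix k
      have "cmod (cinner y (bword k l (l + Suc n) x)) \<le> norm y * K"
        by (rule order.trans[OF cmod_cinner_le]) (intro mult_left_mono K, simp)
      thus "norm (f k) \<le> (\<Prod>i\<in>insert l ?A. \<bar>p (k i)\<bar>) * (norm y * K)"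
        unfolding f_def norm_mult norm_of_real abs_prod by (intro mult_left_mono prod_nonneg) auto
    qed simp
    thus ?thesis by (rule abs_summable_summable)
  qed
  have bw: "bword (k(l := j)) (Suc l) h x = bword k (Suc l) h x" for k j h
    unfolding bword_def by (rule foldr_cong) auto
  have fj: "f (k(l := j)) = of_real (p j) * (of_real (\<Prod>i\<in>?A. p (k i)) *
        cinner (lsh (- j) (lb y)) (bword k (Suc l) (Suc l + n) x))" for k j
  proof -
    have "(\<Prod>i\<in>?A. p ((k(l := j)) i)) = (\<Prod>i\<in>?A. p (k i))"
      by (rule prod.cong) auto
    hence 1: "(\<Prod>i\<in>insert l ?A. p ((k(l := j)) i)) = p j * (\<Prod>i\<in>?A. p (k i))"
      using A(2) by (subst prod.insert) simp_all
    have 2: "bword (k(l := j)) l (l + Suc n) x = lb (lsh j (bword k (Suc l) (Suc l + n) x))"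
      by (simp add: bword_rec bw)
    have 3: "cinner y (lb (lsh j z)) = cinner (lsh (- j) (lb y)) z" for z
      by (simp add: is_adjointD(2)[OF self_adjoint_lb] is_adjointD(2)[OF is_adjoint_left_right(1)])
    show ?thesis unfolding f_def 1 2 3 by simp
  qed
  have "cinner y (((lb \<circ> conv_op p) ^^ Suc n) x) = cinner (lb y) (lsh 0 (conv_op p (((lb \<circ> conv_op p) ^^ n) x)))"
    by (simp add: is_adjointD(1)[OF self_adjoint_lb])
  also have "\<dots> = (\<Sum>\<^sub>\<infinity>j. of_real (p j) * cinner (lb y) (lsh (0 + j) (((lb \<circ> conv_op p) ^^ n) x)))"
    by (rule cinner_lsh_conv_op[OF sp])
  also have "\<dots> = (\<Sum>\<^sub>\<infinity>j. \<Sum>\<^sub>\<infinity>k\<in>PiE ?A (\<lambda>_. UNIV). f (k(l := j)))"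
  proof (rule infsum_cong)
    fix j
    have "cinner (lb y) (lsh (0 + j) z) = cinner (lsh (- j) (lb y)) z" for z
      by (simp add: is_adjointD(2)[OF is_adjoint_left_right(1)])
    hence "of_real (p j) * cinner (lb y) (lsh (0 + j) (((lb \<circ> conv_op p) ^^ n) x)) =
      (\<Sum>\<^sub>\<infinity>k\<in>PiE ?A (\<lambda>_. UNIV). of_real (p j) * (of_real (\<Prod>i\<in>?A. p (k i)) *
        cinner (lsh (- j) (lb y)) (bword k (Suc l) (Suc l + n) x)))"
      by (simp only: Suc.IH[of _ "Suc l"] infsum_cmult_right')
    also have "\<dots> = (\<Sum>\<^sub>\<infinity>k\<in>PiE ?A (\<lambda>_. UNIV). f (k(l := j)))"
      by (simp only: fj)
    finally show "of_real (p j) * cinner (lb y) (lsh (0 + j) (((lb \<circ> conv_op p) ^^ n) x)) =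
      (\<Sum>\<^sub>\<infinity>k\<in>PiE ?A (\<lambda>_. UNIV). f (k(l := j)))" .
  qed
  also have "\<dots> = infsum f (PiE (insert l ?A) (\<lambda>_. UNIV))"
    by (rule infsum_PiE_insert[OF A(2) f, symmetric])
  finally show ?case unfolding A(1)[symmetric] f_def .
qed simp

lemma vac_lb_conv_op_funpow:
  assumes sp: "(\<lambda>k. \<bar>p k\<bar>) summable_on UNIV"
  shows "vac ((lb \<circ> conv_op p) ^^ n) =
    (\<Sum>\<^sub>\<infinity>k\<in>PiE {1..n} (\<lambda>_. UNIV). of_real (\<Prod>i\<in>{1..n}. p (k i)) * gword k 1 (Suc n) 0)"
proof -
  have "{1..<1 + n} = {1..n}" by auto
  thus ?thesis
    using expand_lb_conv_op_funpow[OF sp, of \<Omega> n \<Omega> 1] by (simp add: vac_def gword_def)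
qed

section \<open>Non-crossing pairings\<close>

text \<open>Half-open intervals make both parts of a pairing, split at the partner of its first
  point, of the same kind, the empty part included.\<close>

definition NCI :: "nat \<Rightarrow> nat \<Rightarrow> nat set set set" where
  "NCI l h = {\<sigma>. partition_on {l..<h} \<sigma> \<and> (\<forall>B\<in>\<sigma>. card B = 2) \<and> noncrossing \<sigma>}"

lemma NC2_eq_NCI: "NC2 n = NCI 1 (Suc n)"
  unfolding NC2_def NCI_def by (simp add: atLeastLessThanSuc_atLeastAtMost)

lemma finite_NCI: "finite (NCI l h)"
  by (rule finite_subset[of _ "Pow (Pow {l..<h})"]) (auto simp: NCI_def partition_on_def)

lemma NCI_empty: "NCI l l = {{}}"
  by (auto simp: NCI_def partition_on_empty noncrossing_def)

lemma card_2_MinMax: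
  fixes B :: "nat set"
  assumes "card B = 2" shows "B = {Min B, Max B}" "Min B < Max B"
proof -
  obtain x y where B: "B = {x, y}" "x \<noteq> y" using assms by (auto simp: card_2_iff)
  thus "B = {Min B, Max B}" "Min B < Max B" by (cases "x < y"; force simp: min_def max_def)+
qed

lemma NCI_block:
  assumes "\<sigma> \<in> NCI l h" "B \<in> \<sigma>"
  shows "B = {Min B, Max B}" "Min B < Max B" "l \<le> Min B" "Max B < h" "B \<subseteq> {l..<h}"
proof -
  show s: "B \<subseteq> {l..<h}" using assms by (auto simp: NCI_def partition_on_def)
  show b: "B = {Min B, Max B}" "Min B < Max B" using card_2_MinMax assms by (auto simp: NCI_def)
  have "Min B \<in> B" "Max B \<in> B" using b(1) by blast+
  thus "l \<le> Min B" "Max B < h" using s by auto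
qed

lemma NCI_disjoint: "\<sigma> \<in> NCI l h \<Longrightarrow> B \<in> \<sigma> \<Longrightarrow> C \<in> \<sigma> \<Longrightarrow> x \<in> B \<Longrightarrow> x \<in> C \<Longrightarrow> B = C"
  unfolding NCI_def partition_on_def disjoint_def by blast

lemma noncrossingD:
  "noncrossing P \<Longrightarrow> A \<in> P \<Longrightarrow> B \<in> P \<Longrightarrow> a \<in> A \<Longrightarrow> b \<in> B \<Longrightarrow> c \<in> A \<Longrightarrow> d \<in> B \<Longrightarrow>
    a < b \<Longrightarrow> b < c \<Longrightarrow> c < d \<Longrightarrow> A = B"
  unfolding noncrossing_def by blast

lemma noncrossingI:
  "(\<And>A B a b c d. A \<in> P \<Longrightarrow> B \<in> P \<Longrightarrow> A \<noteq> B \<Longrightarrow> a \<in> A \<Longrightarrow> b \<in> B \<Longrightarrow> c \<in> A \<Longrightarrow> d \<in> B \<Longrightarrow>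
    a < b \<Longrightarrow> b < c \<Longrightarrow> c < d \<Longrightarrow> False) \<Longrightarrow> noncrossing P"
  unfolding noncrossing_def by blast

lemma noncrossing_subset: "noncrossing P \<Longrightarrow> Q \<subseteq> P \<Longrightarrow> noncrossing Q"
  unfolding noncrossing_def by blast

lemma NCI_decompose:
  assumes \<sigma>: "\<sigma> \<in> NCI l h" and lh: "l < h"
  shows "\<exists>j\<in>{Suc l..<h}. \<exists>\<sigma>1\<in>NCI (Suc l) j. \<exists>\<sigma>2\<in>NCI (Suc j) h. \<sigma> = insert {l, j} (\<sigma>1 \<union> \<sigma>2)"
proof -
  have part: "\<Union>\<sigma> = {l..<h}" "disjoint \<sigma>" "{} \<notin> \<sigma>" and nc: "noncrossing \<sigma>"
    using \<sigma> by (auto simp: NCI_def partition_on_def)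
  from part(1) lh obtain B where B: "B \<in> \<sigma>" "l \<in> B" by (metis UnionE atLeastLessThan_iff order_refl)
  note b = NCI_block[OF \<sigma> B(1)]
  have "Min B = l" using b B(2) by (metis insert_iff leD empty_iff order_antisym less_imp_le)
  define j where "j = Max B"
  have Bj: "B = {l, j}" "l < j" "j < h" using b \<open>Min B = l\<close> by (auto simp: j_def)
  \<comment> \<open>A block other than \<open>B\<close> with points on both sides of
    \<open>j\<close> would cross \<open>{l, j}\<close>.\<close>
  have two: "C \<subseteq> {Suc l..<j} \<or> C \<subseteq> {Suc j..<h}" if C: "C \<in> \<sigma>" "C \<noteq> B" for C
  proof -
    note c = NCI_block[OF \<sigma> C(1)]
    have ne: "l \<notin> C" "j \<notin> C" using NCI_disjoint[OF \<sigma> C(1) B(1)] C(2) Bj by auto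
    have mm: "Min C \<in> C" "Max C \<in> C" using c(1) by blast+
    have "\<not> (Min C < j \<and> j < Max C)"
    proof
      assume "Min C < j \<and> j < Max C"
      moreover have "l < Min C" using c(3) ne mm by (metis le_neq_implies_less)
      ultimately have "B = C" using noncrossingD[OF nc B(1) C(1) B(2) mm(1) _ mm(2), of j] Bj by auto
      thus False using C(2) by simp
    qed
    moreover have "Min C \<noteq> l" "Min C \<noteq> j" "Max C \<noteq> j" using ne mm by metis+
    ultimately have "Max C < j \<or> j < Min C" using c(2) by linarith
    moreover have "l < Min C" using c(3) \<open>Min C \<noteq> l\<close> by simp
    ultimately have "{Min C, Max C} \<subseteq> {Suc l..<j} \<or> {Min C, Max C} \<subseteq> {Suc j..<h}"
      using c(2,4) by auto
    thus ?thesis using c(1) by simp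
  qed
  define \<sigma>1 where "\<sigma>1 = {C \<in> \<sigma>. C \<subseteq> {Suc l..<j}}"
  define \<sigma>2 where "\<sigma>2 = {C \<in> \<sigma>. C \<subseteq> {Suc j..<h}}"
  have eq: "\<sigma> = insert {l, j} (\<sigma>1 \<union> \<sigma>2)"
    using two B(1) Bj(1) by (auto simp: \<sigma>1_def \<sigma>2_def)
  have U: "\<Union>\<sigma>1 = {Suc l..<j}" "\<Union>\<sigma>2 = {Suc j..<h}"
  proof -
    have "\<exists>C\<in>\<sigma>1. x \<in> C" if "x \<in> {Suc l..<j}" for x
    proof -
      have "x \<in> \<Union>\<sigma>" using part(1) that Bj by auto
      then obtain C where C: "C \<in> \<sigma>" "x \<in> C" by blast
      have "C \<noteq> B" using C(2) that Bj(1) by auto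
      hence "C \<subseteq> {Suc l..<j}" using two[OF C(1)] C(2) that by auto
      thus ?thesis using C by (auto simp: \<sigma>1_def)
    qed
    thus "\<Union>\<sigma>1 = {Suc l..<j}" by (auto simp: \<sigma>1_def)
    have "\<exists>C\<in>\<sigma>2. x \<in> C" if "x \<in> {Suc j..<h}" for x
    proof -
      have "x \<in> \<Union>\<sigma>" using part(1) that Bj by auto
      then obtain C where C: "C \<in> \<sigma>" "x \<in> C" by blast
      have "C \<noteq> B" using C(2) that Bj by auto
      hence "C \<subseteq> {Suc j..<h}" using two[OF C(1)] C(2) that by auto
      thus ?thesis using C by (auto simp: \<sigma>2_def)
    qed
    thus "\<Union>\<sigma>2 = {Suc j..<h}" by (auto simp: \<sigma>2_def)
  qed
  have sub: "\<sigma>1 \<subseteq> \<sigma>" "\<sigma>2 \<subseteq> \<sigma>" by (auto simp: \<sigma>1_def \<sigma>2_def)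
  have "\<sigma>1 \<in> NCI (Suc l) j" "\<sigma>2 \<in> NCI (Suc j) h"
  proof -
    have d: "disjoint \<sigma>1" "disjoint \<sigma>2" using part(2) sub unfolding disjoint_def by blast+
    have c: "\<forall>B\<in>\<sigma>. card B = 2" using \<sigma> by (simp add: NCI_def)
    show "\<sigma>1 \<in> NCI (Suc l) j"
      unfolding NCI_def partition_on_def using U(1) d(1) noncrossing_subset[OF nc sub(1)] part(3) c sub(1)
      by auto
    show "\<sigma>2 \<in> NCI (Suc j) h"
      unfolding NCI_def partition_on_def using U(2) d(2) noncrossing_subset[OF nc sub(2)] part(3) c sub(2)
      by auto
  qed
  moreover have "j \<in> {Suc l..<h}" using Bj by simp
  ultimately show ?thesis using eq by blast
qed

lemma NCI_compose:
  assumes j: "j \<in> {Suc l..<h}" and \<sigma>1: "\<sigma>1 \<in> NCI (Suc l) j" and \<sigma>2: "\<sigma>2 \<in> NCI (Suc j) h"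
  shows "insert {l, j} (\<sigma>1 \<union> \<sigma>2) \<in> NCI l h"
proof -
  have p1: "\<Union>\<sigma>1 = {Suc l..<j}" "disjoint \<sigma>1" "{} \<notin> \<sigma>1" "noncrossing \<sigma>1" "\<And>B. B \<in> \<sigma>1 \<Longrightarrow> card B = 2"
    using \<sigma>1 by (auto simp: NCI_def partition_on_def)
  have p2: "\<Union>\<sigma>2 = {Suc j..<h}" "disjoint \<sigma>2" "{} \<notin> \<sigma>2" "noncrossing \<sigma>2" "\<And>B. B \<in> \<sigma>2 \<Longrightarrow> card B = 2"
    using \<sigma>2 by (auto simp: NCI_def partition_on_def)
  have r1: "l < x \<and> x < j" if "C \<in> \<sigma>1" "x \<in> C" for C x
    using NCI_block(5)[OF \<sigma>1 that(1)] that(2) by auto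
  have r2: "j < x \<and> x < h" if "C \<in> \<sigma>2" "x \<in> C" for C x
    using NCI_block(5)[OF \<sigma>2 that(1)] that(2) by auto
  show ?thesis
    unfolding NCI_def partition_on_def
  proof (intro CollectI conjI)
    have "{l..<h} = {l, j} \<union> ({Suc l..<j} \<union> {Suc j..<h})" using j by auto
    thus "\<Union> (insert {l, j} (\<sigma>1 \<union> \<sigma>2)) = {l..<h}" using p1(1) p2(1) by simp
    show "disjoint (insert {l, j} (\<sigma>1 \<union> \<sigma>2))"
    proof (rule disjointI)
      fix A B assume AB: "A \<in> insert {l, j} (\<sigma>1 \<union> \<sigma>2)" "B \<in> insert {l, j} (\<sigma>1 \<union> \<sigma>2)" "A \<noteq> B"
      have "A = B" if x: "x \<in> A" "x \<in> B" for x
      proof -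
        have lj: "l < j" using j by simp
        have rA: "(A = {l, j} \<and> (x = l \<or> x = j)) \<or> (A \<in> \<sigma>1 \<and> l < x \<and> x < j) \<or> (A \<in> \<sigma>2 \<and> j < x)"
          using AB(1) r1[of A x] r2[of A x] x by blast
        have rB: "(B = {l, j} \<and> (x = l \<or> x = j)) \<or> (B \<in> \<sigma>1 \<and> l < x \<and> x < j) \<or> (B \<in> \<sigma>2 \<and> j < x)"
          using AB(2) r1[of B x] r2[of B x] x by blast
        show ?thesis
          using rA rB NCI_disjoint[OF \<sigma>1 _ _ x] NCI_disjoint[OF \<sigma>2 _ _ x] lj
          by (elim disjE conjE) simp_all
      qed
      thus "A \<inter> B = {}" using AB(3) by blast
    qed
    show "{} \<notin> insert {l, j} (\<sigma>1 \<union> \<sigma>2)" using p1 p2 by auto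
    show "\<forall>B\<in>insert {l, j} (\<sigma>1 \<union> \<sigma>2). card B = 2" using p1 p2 j by auto
    show "noncrossing (insert {l, j} (\<sigma>1 \<union> \<sigma>2))"
    proof (rule noncrossingI)
      fix A B a b c d
      assume AB: "A \<in> insert {l, j} (\<sigma>1 \<union> \<sigma>2)" "B \<in> insert {l, j} (\<sigma>1 \<union> \<sigma>2)" "A \<noteq> B"
        "a \<in> A" "b \<in> B" "c \<in> A" "d \<in> B" "a < b" "b < c" "c < d"
      have rA: "A = {l, j} \<or> (A \<in> \<sigma>1 \<and> l < a \<and> a < j \<and> l < c \<and> c < j) \<or> (A \<in> \<sigma>2 \<and> j < a \<and> j < c)"
        using AB(1) r1[of A a] r1[of A c] r2[of A a] r2[of A c] AB(4,6) by blast
      have rB: "B = {l, j} \<or> (B \<in> \<sigma>1 \<and> l < b \<and> b < j \<and> l < d \<and> d < j) \<or> (B \<in> \<sigma>2 \<and> j < b \<and> j < d)"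
        using AB(2) r1[of B b] r1[of B d] r2[of B b] r2[of B d] AB(5,7) by blast
      have "\<not> (A \<in> \<sigma>1 \<and> B \<in> \<sigma>1)" "\<not> (A \<in> \<sigma>2 \<and> B \<in> \<sigma>2)"
        using noncrossingD[OF p1(4) _ _ AB(4-10)] noncrossingD[OF p2(4) _ _ AB(4-10)] AB(3) by blast+
      moreover have "A = {l, j} \<Longrightarrow> (a = l \<or> a = j) \<and> (c = l \<or> c = j)" "B = {l, j} \<Longrightarrow> (b = l \<or> b = j) \<and> (d = l \<or> d = j)"
        using AB(4-7) by blast+
      moreover have "l < j" using j by simp
      ultimately show False using rA rB AB(3,8-10) by (elim disjE conjE) auto
    qed
  qed
qed

text \<open>The pairs passing over the barred point \<open>i\<close>. That point lies between
  \<open>i\<close> and \<open>i + 1\<close>, hence the weak inequality on the left and the strict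
  one on the right.\<close>

definition encl :: "nat set set \<Rightarrow> nat \<Rightarrow> nat set set" where
  "encl \<sigma> i = {B\<in>\<sigma>. Min B \<le> i \<and> i < Max B}"

text \<open>The block sums of the Kreweras complement vanish, when \<open>c\<close> is added to the outer block.\<close>

definition balanced :: "(nat \<Rightarrow> int) \<Rightarrow> nat \<Rightarrow> nat \<Rightarrow> int \<Rightarrow> nat set set \<Rightarrow> bool" where
  "balanced k l h c \<sigma> \<longleftrightarrow>
     (\<forall>E. (\<Sum>i\<in>{l..<h}. if encl \<sigma> i = E then k i else 0) + (if E = {} then c else 0) = 0)"

lemma encl_compose:
  assumes j: "j \<in> {Suc l..<h}" and \<sigma>1: "\<sigma>1 \<in> NCI (Suc l) j" and \<sigma>2: "\<sigma>2 \<in> NCI (Suc j) h"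
  defines "\<sigma> \<equiv> insert {l, j} (\<sigma>1 \<union> \<sigma>2)"
  shows "encl \<sigma> l = {{l, j}}" "encl \<sigma> j = {}"
    "i \<in> {Suc l..<j} \<Longrightarrow> encl \<sigma> i = insert {l, j} (encl \<sigma>1 i)"
    "i \<in> {Suc j..<h} \<Longrightarrow> encl \<sigma> i = encl \<sigma>2 i"
proof -
  have lj: "Min {l, j} = l" "Max {l, j} = j" using j by (auto simp: min_def max_def)
  have r1: "\<not> Min C \<le> l" "j \<le> i \<Longrightarrow> \<not> i < Max C" if "C \<in> \<sigma>1" for C i
    using NCI_block(3,4)[OF \<sigma>1 that] by auto
  have r2: "i \<le> j \<Longrightarrow> \<not> Min C \<le> i" if "C \<in> \<sigma>2" for C i
    using NCI_block(3)[OF \<sigma>2 that] by auto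
  show "encl \<sigma> l = {{l, j}}" "encl \<sigma> j = {}"
    "i \<in> {Suc l..<j} \<Longrightarrow> encl \<sigma> i = insert {l, j} (encl \<sigma>1 i)"
    "i \<in> {Suc j..<h} \<Longrightarrow> encl \<sigma> i = encl \<sigma>2 i"
    using j by (auto simp: encl_def \<sigma>_def lj r1 r2)
qed

text \<open>The new pair \<open>B\<close> covers exactly the barred points from \<open>l\<close> to
  \<open>j - 1\<close>. Sets \<open>E\<close> containing \<open>B\<close> therefore see only the
  inner pairing, whose outer block receives \<open>k l\<close>; the others see only the right
  pairing, whose outer block receives \<open>c + k j\<close>.\<close>

lemma balanced_compose:
  assumes j: "j \<in> {Suc l..<h}" and \<sigma>1: "\<sigma>1 \<in> NCI (Suc l) j" and \<sigma>2: "\<sigma>2 \<in> NCI (Suc j) h"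
  shows "balanced k l h c (insert {l, j} (\<sigma>1 \<union> \<sigma>2)) \<longleftrightarrow>
    balanced k (Suc l) j (k l) \<sigma>1 \<and> balanced k (Suc j) h (c + k j) \<sigma>2"
proof -
  define \<sigma> where "\<sigma> = insert {l, j} (\<sigma>1 \<union> \<sigma>2)"
  define B where "B = {l, j}"
  note e = encl_compose[OF j \<sigma>1 \<sigma>2, folded \<sigma>_def B_def]
  have B1: "B \<notin> encl \<sigma>1 i" and B2: "B \<notin> encl \<sigma>2 i" for i
    using NCI_block(5)[OF \<sigma>1, of B] NCI_block(5)[OF \<sigma>2, of B] j by (auto simp: B_def encl_def)
  define S1 where "S1 E = (\<Sum>i\<in>{Suc l..<j}. if encl \<sigma>1 i = E then k i else 0) + (if E = {} then k l else 0)" for E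
  define S2 where "S2 E = (\<Sum>i\<in>{Suc j..<h}. if encl \<sigma>2 i = E then k i else 0) + (if E = {} then c + k j else 0)" for E
  define S where "S E = (\<Sum>i\<in>{l..<h}. if encl \<sigma> i = E then k i else 0) + (if E = {} then c else 0)" for E
  have un: "{l..<h} = insert l (insert j ({Suc l..<j} \<union> {Suc j..<h}))" using j by auto
  have S: "S E = (if {B} = E then k l else 0) + (if {} = E then k j else 0) + 
      (\<Sum>i\<in>{Suc l..<j}. if insert B (encl \<sigma>1 i) = E then k i else 0) +
      (\<Sum>i\<in>{Suc j..<h}. if encl \<sigma>2 i = E then k i else 0) + (if E = {} then c else 0)" for E
  proof -
    have "(\<Sum>i\<in>{l..<h}. if encl \<sigma> i = E then k i else 0) = (if encl \<sigma> l = E then k l else 0) + 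
        ((if encl \<sigma> j = E then k j else 0) + ((\<Sum>i\<in>{Suc l..<j}. if encl \<sigma> i = E then k i else 0) +
        (\<Sum>i\<in>{Suc j..<h}. if encl \<sigma> i = E then k i else 0)))"
      unfolding un using j by (subst sum.insert; simp)+ (subst sum.union_disjoint; auto)
    moreover have "(\<Sum>i\<in>{Suc l..<j}. if encl \<sigma> i = E then k i else 0) =
        (\<Sum>i\<in>{Suc l..<j}. if insert B (encl \<sigma>1 i) = E then k i else 0)"
      by (rule sum.cong) (simp_all add: e)
    moreover have "(\<Sum>i\<in>{Suc j..<h}. if encl \<sigma> i = E then k i else 0) =
        (\<Sum>i\<in>{Suc j..<h}. if encl \<sigma>2 i = E then k i else 0)"
      by (rule sum.cong) (simp_all add: e)
    ultimately show ?thesis by (simp add: S_def e)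
  qed
  have in_B: "S E = S1 (E - {B}) \<and> S2 E = 0" if "B \<in> E" for E
  proof -
    have 1: "(insert B (encl \<sigma>1 i) = E) = (encl \<sigma>1 i = E - {B})" for i using that B1[of i] by blast
    have 2: "(encl \<sigma>2 i = E) = False" for i using that B2[of i] by blast
    have 3: "({B} = E) = (E - {B} = {})" "(E = {}) = False" "({} = E) = False" using that by auto
    show ?thesis unfolding S S1_def S2_def 1 2 3 by simp
  qed
  have notin_B: "S E = S2 E \<and> S1 (insert B E) = 0" if "B \<notin> E" for E
  proof -
    have 1: "(insert B (encl \<sigma>1 i) = E) = False" "(encl \<sigma>1 i = insert B E) = False" "({B} = E) = False" for i
      using that B1[of i] by blast+
    show ?thesis unfolding S S1_def S2_def 1 by (auto simp: eq_commute)
  qed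
  have "(\<forall>E. S E = 0) \<longleftrightarrow> (\<forall>E. S1 E = 0) \<and> (\<forall>E. S2 E = 0)"
  proof (intro iffI conjI allI)
    fix E
    assume *: "\<forall>E. S E = 0"
    show "S1 E = 0"
    proof (cases "B \<in> E")
      case True
      thus ?thesis using notin_B[of "E - {B}"] by (simp add: insert_absorb)
    next
      case False
      thus ?thesis using in_B[of "insert B E"] * by simp
    qed
    show "S2 E = 0" using in_B[of E] notin_B[of E] * by (cases "B \<in> E") auto
  next
    fix E
    assume "(\<forall>E. S1 E = 0) \<and> (\<forall>E. S2 E = 0)"
    thus "S E = 0" using in_B[of E] notin_B[of E] by (cases "B \<in> E") auto
  qed
  thus ?thesis unfolding balanced_def S_def S1_def S2_def \<sigma>_def .
qed

definition nbal :: "(nat \<Rightarrow> int) \<Rightarrow> nat \<Rightarrow> nat \<Rightarrow> int \<Rightarrow> nat" where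
  "nbal k l h c = card {\<sigma> \<in> NCI l h. balanced k l h c \<sigma>}"

lemma nbal_empty: "nbal k l l c = (if c = 0 then 1 else 0)"
proof -
  have "{\<sigma> \<in> NCI l l. balanced k l l c \<sigma>} = (if c = 0 then {{}} else {})"
    by (auto simp: NCI_empty balanced_def)
  thus ?thesis by (simp add: nbal_def)
qed

text \<open>The splitting is a bijection onto its image: \<open>j\<close> is read off the block of
  \<open>l\<close>, and the two parts consist of the blocks inside and beyond it.\<close>

lemma nbal_rec:
  assumes "l < h"
  shows "nbal k l h c = (\<Sum>j\<in>{Suc l..<h}. nbal k (Suc l) j (k l) * nbal k (Suc j) h (c + k j))"
proof -
  define G where "G j = {\<sigma> \<in> NCI (Suc l) j. balanced k (Suc l) j (k l) \<sigma>} \<times>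
    {\<sigma> \<in> NCI (Suc j) h. balanced k (Suc j) h (c + k j) \<sigma>}" for j
  define \<phi> where "\<phi> j z = insert {l, j} (fst z \<union> snd z)" for j :: nat and z :: "nat set set \<times> nat set set"
  have eq: "{\<sigma> \<in> NCI l h. balanced k l h c \<sigma>} = (\<Union>j\<in>{Suc l..<h}. \<phi> j ` G j)"
  proof (intro equalityI subsetI)
    fix \<sigma> assume "\<sigma> \<in> {\<sigma> \<in> NCI l h. balanced k l h c \<sigma>}"
    hence \<sigma>: "\<sigma> \<in> NCI l h" "balanced k l h c \<sigma>" by auto
    obtain j \<sigma>1 \<sigma>2 where d: "j \<in> {Suc l..<h}" "\<sigma>1 \<in> NCI (Suc l) j" "\<sigma>2 \<in> NCI (Suc j) h"
      "\<sigma> = insert {l, j} (\<sigma>1 \<union> \<sigma>2)" using NCI_decompose[OF \<sigma>(1) assms] by blast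
    have "(\<sigma>1, \<sigma>2) \<in> G j" "\<sigma> = \<phi> j (\<sigma>1, \<sigma>2)"
      using \<sigma>(2) d balanced_compose[OF d(1-3)] by (auto simp: G_def \<phi>_def)
    thus "\<sigma> \<in> (\<Union>j\<in>{Suc l..<h}. \<phi> j ` G j)" using d(1) by blast
  next
    fix \<sigma> assume "\<sigma> \<in> (\<Union>j\<in>{Suc l..<h}. \<phi> j ` G j)"
    then obtain j \<sigma>1 \<sigma>2 where "j \<in> {Suc l..<h}" "(\<sigma>1, \<sigma>2) \<in> G j" "\<sigma> = \<phi> j (\<sigma>1, \<sigma>2)" by auto
    thus "\<sigma> \<in> {\<sigma> \<in> NCI l h. balanced k l h c \<sigma>}"
      using NCI_compose[of j l h \<sigma>1 \<sigma>2] balanced_compose[of j l h \<sigma>1 \<sigma>2 k c] by (simp add: G_def \<phi>_def)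
  qed
  have parts: "l < x \<and> x < j" if "z \<in> G j" "C \<in> fst z" "x \<in> C" for z j C x
  proof -
    have "fst z \<in> NCI (Suc l) j" using that(1) by (auto simp: G_def)
    from NCI_block(5)[OF this that(2)] have "C \<subseteq> {Suc l..<j}" .
    thus ?thesis using that(3) by auto
  qed
  have parts2: "j < x" if "z \<in> G j" "C \<in> snd z" "x \<in> C" for z j C x
  proof -
    have "snd z \<in> NCI (Suc j) h" using that(1) by (auto simp: G_def)
    from NCI_block(5)[OF this that(2)] have "C \<subseteq> {Suc j..<h}" .
    thus ?thesis using that(3) by auto
  qed
  have ne: "C \<noteq> {}" if "z \<in> G j" "C \<in> fst z \<union> snd z" for C z j
    using that by (auto simp: G_def NCI_def partition_on_def)
  have recov: "fst z = {C \<in> \<phi> j z. C \<subseteq> {l<..<j}}" "snd z = {C \<in> \<phi> j z. C \<subseteq> {j<..}}" 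
    "{C \<in> \<phi> j z. l \<in> C} = {{l, j}}" if "z \<in> G j" "Suc l \<le> j" for z j
  proof -
    have "C \<subseteq> {l<..<j} \<and> \<not> C \<subseteq> {j<..} \<and> l \<notin> C" if C: "C \<in> fst z" for C
    proof -
      obtain x where x: "x \<in> C" using ne[OF \<open>z \<in> G j\<close>, of C] C by blast
      have "x \<notin> {j<..}" using parts[OF \<open>z \<in> G j\<close> C x] by simp
      moreover have "C \<subseteq> {l<..<j}" "l \<notin> C" using parts[OF \<open>z \<in> G j\<close> C] by auto
      ultimately show ?thesis using x by blast
    qed
    moreover have "C \<subseteq> {j<..} \<and> \<not> C \<subseteq> {l<..<j} \<and> l \<notin> C" if C: "C \<in> snd z" for C
    proof -
      obtain x where x: "x \<in> C" using ne[OF \<open>z \<in> G j\<close>, of C] C by blast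
      have "x \<notin> {l<..<j}" using parts2[OF \<open>z \<in> G j\<close> C x] by simp
      moreover have "C \<subseteq> {j<..}" "l \<notin> C" using parts2[OF \<open>z \<in> G j\<close> C] \<open>Suc l \<le> j\<close> by fastforce+
      ultimately show ?thesis using x by blast
    qed
    moreover have "\<not> {l, j} \<subseteq> {l<..<j}" "\<not> {l, j} \<subseteq> {j<..}" by auto
    ultimately show "fst z = {C \<in> \<phi> j z. C \<subseteq> {l<..<j}}" "snd z = {C \<in> \<phi> j z. C \<subseteq> {j<..}}" 
      "{C \<in> \<phi> j z. l \<in> C} = {{l, j}}" unfolding \<phi>_def by blast+
  qed
  have inj: "inj_on (\<phi> j) (G j)" if "Suc l \<le> j" for j
  proof (rule inj_onI)
    fix y z assume "y \<in> G j" "z \<in> G j" "\<phi> j y = \<phi> j z"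
    thus "y = z" using recov[of y j] recov[of z j] that by (metis prod_eqI)
  qed
  have dis: "\<phi> i ` G i \<inter> \<phi> j ` G j = {}" if "i \<noteq> j" "i \<in> {Suc l..<h}" "j \<in> {Suc l..<h}" for i j
  proof -
    have False if y: "y \<in> G i" and z: "z \<in> G j" and eq: "\<phi> i y = \<phi> j z" for y z
    proof -
      have "{{l, i}} = {{l, j}}"
        using recov(3)[OF y] recov(3)[OF z] eq \<open>i \<in> _\<close> \<open>j \<in> _\<close> by simp
      thus False using \<open>i \<noteq> j\<close> by (auto simp: doubleton_eq_iff)
    qed
    thus ?thesis by blast
  qed
  have fin: "finite (\<phi> j ` G j)" for j
    unfolding G_def by (intro finite_imageI finite_cartesian_product finite_subset[OF _ finite_NCI]) auto
  have "nbal k l h c = (\<Sum>j\<in>{Suc l..<h}. card (\<phi> j ` G j))"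
    unfolding nbal_def eq by (rule card_UN_disjoint) (use fin dis in auto)
  also have "\<dots> = (\<Sum>j\<in>{Suc l..<h}. nbal k (Suc l) j (k l) * nbal k (Suc j) h (c + k j))"
    by (rule sum.cong) (simp_all add: card_image inj, simp add: G_def card_cartesian_product nbal_def)
  finally show ?thesis .
qed

subsection \<open>The Kreweras complement\<close>

text \<open>A pair over one of two barred points but not the other separates them and crosses any
  block that joins them.\<close>

lemma encl_eq_if_noncrossing:
  assumes \<sigma>: "\<sigma> \<in> NC2 n" and nc: "noncrossing (interleave \<sigma> \<pi>)" and V: "V \<in> \<pi>" "i \<in> V" "j \<in> V"
  shows "encl \<sigma> i = encl \<sigma> j"
proof -
  have "B \<in> encl \<sigma> j" if V: "V \<in> \<pi>" "i \<in> V" "j \<in> V" and B: "B \<in> encl \<sigma> i" for i j B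
  proof (rule ccontr)
    assume "B \<notin> encl \<sigma> j"
    define x y where "x = Min B" and "y = Max B"
    have B': "B \<in> \<sigma>" "x \<le> i" "i < y" using B by (auto simp: encl_def x_def y_def)
    have xy: "x \<in> B" "y \<in> B" using NCI_block(1)[OF \<sigma>[unfolded NC2_eq_NCI] B'(1)] unfolding x_def y_def by blast+
    have out: "j < x \<or> y \<le> j" using \<open>B \<notin> encl \<sigma> j\<close> B'(1) by (auto simp: encl_def x_def y_def)
    define B2 V2 where "B2 = (\<lambda>i. 2 * i) ` B" and "V2 = (\<lambda>i. 2 * i + 1) ` V"
    have m: "B2 \<in> interleave \<sigma> \<pi>" "V2 \<in> interleave \<sigma> \<pi>"
      using B'(1) V(1) by (auto simp: interleave_def B2_def V2_def)
    have el: "2 * x \<in> B2" "2 * y \<in> B2" "2 * i + 1 \<in> V2" "2 * j + 1 \<in> V2"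
      using xy V by (auto simp: B2_def V2_def)
    have ne: "B2 \<noteq> V2" 
    proof
      assume "B2 = V2"
      hence "2 * x \<in> V2" using el by simp
      thus False unfolding V2_def by (auto, presburger)
    qed
    from out show False
    proof
      assume "j < x"
      thus False using noncrossingD[OF nc m(2,1) el(4,1,3,2)] B' ne by auto
    next
      assume "y \<le> j"
      thus False using noncrossingD[OF nc m(1,2) el(1,3,2,4)] B' ne by auto
    qed
  qed
  thus ?thesis using V by blast
qed

text \<open>The fibres of \<open>encl\<close> form a non-crossing complement, and
  \<open>encl_eq_if_noncrossing\<close> makes every competitor a refinement of it. Two coarsest
  complements refine each other, which gives the uniqueness required by \<open>THE\<close>.\<close>

lemma kreweras_eq:
  assumes \<sigma>: "\<sigma> \<in> NC2 n"
  shows "kreweras n \<sigma> = (\<lambda>i. {j\<in>{1..n}. encl \<sigma> j = encl \<sigma> i}) ` {1..n}"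
proof -
  define K where "K = (\<lambda>i. {j\<in>{1..n}. encl \<sigma> j = encl \<sigma> i}) ` {1..n}"
  have part: "partition_on {1..n} K"
    unfolding partition_on_def K_def disjoint_def by auto
  have encl_K: "encl \<sigma> i = encl \<sigma> j" if "V \<in> K" "i \<in> V" "j \<in> V" for V i j
    using that by (auto simp: K_def)
  have K_eq: "A = B" if "A \<in> K" "B \<in> K" "i \<in> A" "j \<in> B" "encl \<sigma> i = encl \<sigma> j" for A B i j
    using that by (auto simp: K_def)
  \<comment> \<open>The barred points covered by a pair \<open>C\<close> form an interval, so
    \<open>C\<close> cannot cover \<open>a\<close> and \<open>c\<close> without \<open>b\<close>,
    nor \<open>b\<close> and \<open>d\<close> without \<open>c\<close>.\<close>
  have sep: False if AB: "A \<in> K" "B \<in> K" "a \<in> A" "b \<in> B" "c \<in> A" "d \<in> B" "a < b" "b < c" "c < d" "A \<noteq> B" for A B a b c d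
  proof -
    have e: "encl \<sigma> a = encl \<sigma> c" "encl \<sigma> b = encl \<sigma> d" "encl \<sigma> a \<noteq> encl \<sigma> b"
      using encl_K[OF AB(1,3,5)] encl_K[OF AB(2,4,6)] K_eq[OF AB(1-4)] AB(10) by blast+
    then obtain C where "C \<in> encl \<sigma> a \<and> C \<notin> encl \<sigma> b \<or> C \<notin> encl \<sigma> a \<and> C \<in> encl \<sigma> b" by blast
    moreover have "C \<in> encl \<sigma> a \<longleftrightarrow> C \<in> encl \<sigma> c" "C \<in> encl \<sigma> b \<longleftrightarrow> C \<in> encl \<sigma> d" using e by auto
    ultimately show False using AB by (auto simp: encl_def)
  qed
  have nc: "noncrossing (interleave \<sigma> K)"
  proof (rule noncrossingI)
    fix A B a b c d
    assume AB: "A \<in> interleave \<sigma> K" "B \<in> interleave \<sigma> K" "A \<noteq> B"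
      "a \<in> A" "b \<in> B" "c \<in> A" "d \<in> B" "a < b" "b < c" "c < d"
    have sig: "2 * Min C \<le> x \<and> x \<le> 2 * Max C \<and> (x = 2 * Min C \<or> x = 2 * Max C) \<and> Min C < Max C"
      if C: "C \<in> \<sigma>" "x \<in> (\<lambda>i. 2 * i) ` C" for C x
    proof -
      note b = NCI_block[OF \<sigma>[unfolded NC2_eq_NCI] C(1)]
      obtain y where "x = 2 * y" "y \<in> C" using C(2) by blast
      moreover from this b(1) have "y = Min C \<or> y = Max C" by blast
      ultimately show ?thesis using b(2) by auto
    qed
    consider (ss) A' B' where "A' \<in> \<sigma>" "B' \<in> \<sigma>" "A = (\<lambda>i. 2 * i) ` A'" "B = (\<lambda>i. 2 * i) ` B'"
      | (sk) A' B' where "A' \<in> \<sigma>" "B' \<in> K" "A = (\<lambda>i. 2 * i) ` A'" "B = (\<lambda>i. 2 * i + 1) ` B'"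
      | (ks) A' B' where "A' \<in> K" "B' \<in> \<sigma>" "A = (\<lambda>i. 2 * i + 1) ` A'" "B = (\<lambda>i. 2 * i) ` B'"
      | (kk) A' B' where "A' \<in> K" "B' \<in> K" "A = (\<lambda>i. 2 * i + 1) ` A'" "B = (\<lambda>i. 2 * i + 1) ` B'"
      using AB(1,2) unfolding interleave_def by blast
    thus False
    proof cases
      case ss
      obtain a' b' c' d' where x: "a = 2 * a'" "b = 2 * b'" "c = 2 * c'" "d = 2 * d'"
        "a' \<in> A'" "b' \<in> B'" "c' \<in> A'" "d' \<in> B'" using AB ss by blast
      have "noncrossing \<sigma>" using \<sigma> by (simp add: NC2_def)
      from noncrossingD[OF this ss(1,2) x(5-8)] x AB ss show False by auto
    next
      case kk
      obtain a' b' c' d' where x: "a = 2 * a' + 1" "b = 2 * b' + 1" "c = 2 * c' + 1" "d = 2 * d' + 1"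
        "a' \<in> A'" "b' \<in> B'" "c' \<in> A'" "d' \<in> B'" using AB kk by blast
      from sep[OF kk(1,2) x(5-8)] x AB kk show False by auto
    next
      case sk
      obtain b' d' where x: "b = 2 * b' + 1" "d = 2 * d' + 1" "b' \<in> B'" "d' \<in> B'" using AB sk by blast
      have e: "A' \<in> encl \<sigma> b' \<longleftrightarrow> A' \<in> encl \<sigma> d'" using encl_K[OF sk(2) x(3,4)] by simp
      have "a = 2 * Min A'" "c = 2 * Max A'"
        using sig[OF sk(1), of a] sig[OF sk(1), of c] AB sk(3) by auto
      thus False using e x AB sk(1) by (auto simp: encl_def)
    next
      case ks
      obtain a' c' where x: "a = 2 * a' + 1" "c = 2 * c' + 1" "a' \<in> A'" "c' \<in> A'" using AB ks by blast
      have e: "B' \<in> encl \<sigma> a' \<longleftrightarrow> B' \<in> encl \<sigma> c'" using encl_K[OF ks(1) x(3,4)] by simp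
      have "b = 2 * Min B'" "d = 2 * Max B'"
        using sig[OF ks(2), of b] sig[OF ks(2), of d] AB ks(4) by auto
      thus False using e x AB ks(2) by (auto simp: encl_def)
    qed
  qed
  have max: "refines {1..n} \<pi> K" if \<pi>: "partition_on {1..n} \<pi>" "noncrossing (interleave \<sigma> \<pi>)" for \<pi>
    unfolding refines_def
  proof (intro conjI ballI \<pi> part)
    fix X assume X: "X \<in> \<pi>"
    hence "X \<noteq> {}" using \<pi>(1) unfolding partition_on_def by blast
    then obtain i where i: "i \<in> X" by blast
    have sub: "X \<subseteq> {1..n}" using X \<pi>(1) by (auto simp: partition_on_def)
    have "X \<subseteq> {j\<in>{1..n}. encl \<sigma> j = encl \<sigma> i}"
      using encl_eq_if_noncrossing[OF \<sigma> \<pi>(2) X _ i] sub by auto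
    thus "\<exists>Y\<in>K. X \<subseteq> Y" using i sub by (auto simp: K_def)
  qed
  show ?thesis
    unfolding kreweras_def K_def[symmetric]
  proof (rule the_equality)
    show "partition_on {1..n} K \<and> noncrossing (interleave \<sigma> K) \<and>
      (\<forall>\<pi>'. partition_on {1..n} \<pi>' \<and> noncrossing (interleave \<sigma> \<pi>') \<longrightarrow> refines {1..n} \<pi>' K)"
      using part nc max by blast
    fix \<pi> assume "partition_on {1..n} \<pi> \<and> noncrossing (interleave \<sigma> \<pi>) \<and>
      (\<forall>\<pi>'. partition_on {1..n} \<pi>' \<and> noncrossing (interleave \<sigma> \<pi>') \<longrightarrow> refines {1..n} \<pi>' \<pi>)"
    thus "\<pi> = K" using max part nc refines_asym by blast
  qed
qed

text \<open>\<open>balanced\<close> also quantifies over sets \<open>E\<close> that are not values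
  of \<open>encl\<close>; for \<open>c = 0\<close> their sums consist of zeros.\<close>

lemma S_set_iff_balanced:
  assumes \<sigma>: "\<sigma> \<in> NC2 n"
  shows "k \<in> S_set n \<sigma> \<longleftrightarrow> k \<in> {1..n} \<rightarrow>\<^sub>E UNIV \<and> balanced k 1 (Suc n) 0 \<sigma>"
proof -
  have s: "(\<Sum>j | j \<in> {1..n} \<and> encl \<sigma> j = E. k j) = (\<Sum>i\<in>{1..<Suc n}. if encl \<sigma> i = E then k i else 0)" for E
    unfolding atLeastLessThanSuc_atLeastAtMost by (rule sum.inter_filter) simp
  have "(\<forall>V\<in>kreweras n \<sigma>. (\<Sum>j\<in>V. k j) = 0) \<longleftrightarrow>
      (\<forall>i\<in>{1..n}. (\<Sum>j\<in>{1..<Suc n}. if encl \<sigma> j = encl \<sigma> i then k j else 0) = 0)"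
    unfolding kreweras_eq[OF \<sigma>] s[symmetric] by blast
  also have "\<dots> \<longleftrightarrow> balanced k 1 (Suc n) 0 \<sigma>"
    unfolding balanced_def
  proof (intro iffI allI ballI)
    fix E assume *: "\<forall>i\<in>{1..n}. (\<Sum>j\<in>{1..<Suc n}. if encl \<sigma> j = encl \<sigma> i then k j else 0) = 0"
    show "(\<Sum>i\<in>{1..<Suc n}. if encl \<sigma> i = E then k i else 0) + (if E = {} then 0 else 0) = 0"
    proof (cases "\<exists>i\<in>{1..n}. encl \<sigma> i = E")
      case True
      then obtain i where i: "i \<in> {1..n}" "encl \<sigma> i = E" by blast
      from *[rule_format, OF i(1)] show ?thesis unfolding i(2) by (simp only: if_cancel add_0_right)
    next
      case False
      thus ?thesis by (auto intro!: sum.neutral)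
    qed
  next
    fix i assume *: "\<forall>E. (\<Sum>i\<in>{1..<Suc n}. if encl \<sigma> i = E then k i else 0) + (if E = {} then 0 else 0) = 0"
    show "(\<Sum>j\<in>{1..<Suc n}. if encl \<sigma> j = encl \<sigma> i then k j else 0) = 0" using *[rule_format, of "encl \<sigma> i"] by simp
  qed
  finally show ?thesis by (auto simp: S_set_def)
qed

text \<open>Every point lies in exactly one pair. This is where a factorising \<open>R\<close> loses
  its dependence on the pairing.\<close>

lemma prod_NC2:
  fixes f :: "nat \<Rightarrow> 'a :: comm_monoid_mult"
  assumes \<sigma>: "\<sigma> \<in> NC2 n"
  shows "(\<Prod>B\<in>\<sigma>. f (Min B) * f (Max B)) = (\<Prod>i\<in>{1..n}. f i)"
proof -
  have p: "\<Union>\<sigma> = {1..n}" "disjoint \<sigma>" using \<sigma> by (auto simp: NC2_def partition_on_def)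
  have "(\<Prod>i\<in>\<Union>\<sigma>. f i) = (\<Prod>B\<in>\<sigma>. \<Prod>i\<in>B. f i)"
  proof (rule prod.Union_disjoint[unfolded comp_def])
    show "\<forall>A\<in>\<sigma>. finite A" using p(1) finite_subset[of _ "{1..n}"] by blast
    show "\<forall>A\<in>\<sigma>. \<forall>B\<in>\<sigma>. A \<noteq> B \<longrightarrow> A \<inter> B = {}" using p(2) by (auto simp: disjoint_def)
  qed
  also have "\<dots> = (\<Prod>B\<in>\<sigma>. f (Min B) * f (Max B))"
  proof (rule prod.cong[OF refl])
    fix B assume "B \<in> \<sigma>"
    note b = NCI_block[OF \<sigma>[unfolded NC2_eq_NCI] this]
    have "(\<Prod>i\<in>B. f i) = (\<Prod>i\<in>{Min B, Max B}. f i)" using b(1) by simp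
    also have "\<dots> = f (Min B) * f (Max B)" using b(2) by simp
    finally show "(\<Prod>i\<in>B. f i) = f (Min B) * f (Max B)" .
  qed
  finally show ?thesis using p(1) by simp
qed

text \<open>Makes \<open>beta\<close> vanish at odd arguments, in agreement with the odd moments of
  a symmetric law.\<close>

lemma NC2_odd: "odd n \<Longrightarrow> NC2 n = {}"
proof (rule ccontr)
  assume n: "odd n" "NC2 n \<noteq> {}"
  then obtain \<sigma> where \<sigma>: "\<sigma> \<in> NC2 n" by blast
  have "n = card (\<Union>\<sigma>)" using \<sigma> by (auto simp: NC2_def partition_on_def)
  also have "\<dots> = (\<Sum>B\<in>\<sigma>. card B)"
  proof (rule card_Union_disjoint)
    show "pairwise disjnt \<sigma>" using \<sigma> by (auto simp: NC2_def partition_on_def disjoint_def pairwise_def disjnt_def)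
    show "finite A" if "A \<in> \<sigma>" for A using that \<sigma> by (metis (mono_tags, lifting) NC2_def card_ge_0_finite mem_Collect_eq zero_less_numeral)
  qed
  also have "\<dots> = (\<Sum>B\<in>\<sigma>. 2)" using \<sigma> by (intro sum.cong) (auto simp: NC2_def)
  finally show False using n(1) by simp
qed

section \<open>Freeness determines the joint moments\<close>

lemma commutant_add:
  assumes "S \<in> commutant A" "T \<in> commutant A" "\<And>R. R \<in> A \<Longrightarrow> bounded_op R"
  shows "(\<lambda>x. S x + T x) \<in> commutant A"
proof (rule commutantI)
  show "bounded_op (\<lambda>x. S x + T x)" using assms by (intro bounded_op_add commutantD(1))
  show "R (S x + T x) = S (R x) + T (R x)" if "R \<in> A" for R x
    using commutantD(2)[OF assms(1) that] commutantD(2)[OF assms(2) that] bounded_opD(1)[OF assms(3)[OF that]]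
    by simp
qed

lemma commutant_scaleC:
  assumes "T \<in> commutant A" "\<And>R. R \<in> A \<Longrightarrow> bounded_op R"
  shows "(\<lambda>x. c *\<^sub>C T x) \<in> commutant A"
proof (rule commutantI)
  show "bounded_op (\<lambda>x. c *\<^sub>C T x)" using assms by (intro bounded_op_scaleC commutantD(1))
  show "R (c *\<^sub>C T x) = c *\<^sub>C T (R x)" if "R \<in> A" for R x
    using commutantD(2)[OF assms(1) that] bounded_opD(2)[OF assms(2)[OF that]] by simp
qed

text \<open>Horner's scheme on the polynomial type makes products available, so that neighbouring
  letters from the same algebra merge into one.\<close>

definition op_poly :: "'i op \<Rightarrow> complex poly \<Rightarrow> 'i op" where
  "op_poly T q = fold_coeffs (\<lambda>c f x. c *\<^sub>C x + T (f x)) q (\<lambda>_. 0)"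

lemma op_poly_0 [simp]: "op_poly T 0 x = 0"
  by (simp add: op_poly_def)

lemma op_poly_pCons [simp]:
  "bounded_op T \<Longrightarrow> op_poly T (pCons c q) x = c *\<^sub>C x + T (op_poly T q x)"
  by (cases "c = 0 \<and> q = 0") (auto simp: op_poly_def bounded_opD(5))

lemma op_poly_add: "bounded_op T \<Longrightarrow> op_poly T (p + q) x = op_poly T p x + op_poly T q x"
  by (induction p q arbitrary: x rule: poly_induct2) (simp_all add: bounded_opD scaleC_distribs)

lemma op_poly_smult: "bounded_op T \<Longrightarrow> op_poly T (smult c q) x = c *\<^sub>C op_poly T q x"
  by (induction q arbitrary: x) (simp_all add: bounded_opD scaleC_distribs)

lemma op_poly_mult: "bounded_op T \<Longrightarrow> op_poly T (p * q) x = op_poly T p (op_poly T q x)"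
  by (induction p arbitrary: x) (simp_all add: op_poly_add op_poly_smult)

lemma op_poly_altdef:
  assumes T: "bounded_op T"
  shows "op_poly T q x = (\<Sum>k\<le>degree q. coeff q k *\<^sub>C (T ^^ k) x)"
proof -
  have "op_poly T q x = (\<Sum>k\<le>n. coeff q k *\<^sub>C (T ^^ k) x)" if "n \<ge> degree q" for n
    using that
  proof (induction q arbitrary: n)
    case (pCons c q)
    show ?case
    proof (cases n)
      case 0
      hence "q = 0" using pCons.prems by (auto split: if_splits)
      thus ?thesis using 0 T by (simp add: bounded_opD(5))
    next
      case (Suc m)
      hence "degree q \<le> m" using pCons.prems by (auto split: if_splits)
      from pCons.IH[OF this] show ?thesis
        using T Suc by (simp add: sum.atMost_Suc_shift bounded_opD del: sum.atMost_Suc)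
    qed
  qed simp
  thus ?thesis by blast
qed

lemma op_poly_generated_algebra: "bounded_op T \<Longrightarrow> op_poly T q \<in> generated_algebra T"
  unfolding generated_algebra_def by (auto simp: op_poly_altdef fun_eq_iff)

locale vN_trace =
  fixes M :: "'i op set" and \<tau> :: "'i op \<Rightarrow> complex"
  assumes trace: "tracial_vN_algebra M \<tau>"
begin

lemma M_comm: "commutant (commutant M) = M"
  using trace by (simp add: tracial_vN_algebra_def von_neumann_algebra_def)

lemma M_closed:
  "T \<in> M \<Longrightarrow> bounded_op T" "id \<in> M" "S \<in> M \<Longrightarrow> T \<in> M \<Longrightarrow> S \<circ> T \<in> M"
  "S \<in> M \<Longrightarrow> T \<in> M \<Longrightarrow> (\<lambda>x. S x + T x) \<in> M" "T \<in> M \<Longrightarrow> (\<lambda>x. c *\<^sub>C T x) \<in> M"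
  using commutantD(1)[of _ "commutant M"] commutant_id[of "commutant M"]
    commutant_compose[of _ "commutant M"] commutant_add[of _ "commutant M"] 
    commutant_scaleC[of _ "commutant M"] commutantD(1)[of _ M]
  unfolding M_comm by blast+

lemma \<tau>_linear: "S \<in> M \<Longrightarrow> T \<in> M \<Longrightarrow> \<tau> (\<lambda>x. S x + T x) = \<tau> S + \<tau> T"
  "T \<in> M \<Longrightarrow> \<tau> (\<lambda>x. c *\<^sub>C T x) = c * \<tau> T" "\<tau> id = 1"
  "S \<in> M \<Longrightarrow> T \<in> M \<Longrightarrow> \<tau> (S \<circ> T) = \<tau> (T \<circ> S)"
  using trace by (simp_all add: tracial_vN_algebra_def state_on_def tracial_on_def)

lemma funpow_closed: "T \<in> M \<Longrightarrow> T ^^ n \<in> M"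
  by (induction n) (auto intro: M_closed simp del: comp_apply)

lemma zero_closed: "(\<lambda>_. 0) \<in> M" "\<tau> (\<lambda>_. 0) = 0"
  using M_closed(5)[OF M_closed(2), of 0] \<tau>_linear(2)[OF M_closed(2), of 0] by simp_all

lemma sum_closed: "(\<And>k. k \<in> K \<Longrightarrow> T k \<in> M) \<Longrightarrow>
    (\<lambda>x. \<Sum>k\<in>K. T k x) \<in> M \<and> \<tau> (\<lambda>x. \<Sum>k\<in>K. T k x) = (\<Sum>k\<in>K. \<tau> (T k))"
  by (induction K rule: infinite_finite_induct) (simp_all add: zero_closed M_closed(4) \<tau>_linear(1))

lemma op_poly_closed:
  assumes T: "T \<in> M"
  shows "op_poly T q \<in> M" "\<tau> (op_poly T q) = (\<Sum>k\<le>degree q. coeff q k * \<tau> (T ^^ k))"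
proof -
  have eq: "op_poly T q = (\<lambda>x. \<Sum>k\<le>degree q. coeff q k *\<^sub>C (T ^^ k) x)"
    by (simp add: fun_eq_iff op_poly_altdef[OF M_closed(1)[OF T]])
  have cl: "(\<lambda>x. coeff q k *\<^sub>C (T ^^ k) x) \<in> M" for k by (intro M_closed(5) funpow_closed T)
  show "op_poly T q \<in> M" "\<tau> (op_poly T q) = (\<Sum>k\<le>degree q. coeff q k * \<tau> (T ^^ k))"
    unfolding eq using sum_closed[of "{..degree q}" "\<lambda>k x. coeff q k *\<^sub>C (T ^^ k) x", OF cl]
    by (simp_all add: \<tau>_linear(2)[OF funpow_closed[OF T]])
qed

text \<open>The power on the left is \<open>c\<close> times a word ending in \<open>c\<close>; the
  trace moves the leading \<open>c\<close> to the end, where the two combine to the last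
  \<open>a\<close>.\<close>

lemma trace_sandwich:
  assumes c: "c \<in> M" and b: "b \<in> M" and a: "c \<circ> c = a" and n: "n \<ge> 1"
  shows "\<tau> ((c \<circ> b \<circ> c) ^^ n) = \<tau> ((b \<circ> a) ^^ n)"
proof -
  obtain m where m: "n = Suc m" using n by (cases n) auto
  have "(c \<circ> b \<circ> c) ^^ Suc m = c \<circ> ((b \<circ> a) ^^ m \<circ> b \<circ> c)"
  proof (induction m)
    case (Suc m)
    have "(c \<circ> b \<circ> c) ^^ Suc (Suc m) = (c \<circ> b \<circ> c) \<circ> (c \<circ> ((b \<circ> a) ^^ m \<circ> b \<circ> c))"
      by (subst funpow.simps(2), subst Suc.IH) (rule refl)
    also have "\<dots> = c \<circ> ((b \<circ> a) ^^ Suc m \<circ> b \<circ> c)"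
      by (simp add: a[symmetric] comp_assoc)
    finally show ?case .
  qed (simp add: comp_assoc)
  moreover have "(b \<circ> a) ^^ m \<circ> b \<circ> c \<in> M"
    by (intro M_closed(3) funpow_closed b c) (simp add: a[symmetric] M_closed(3) c)
  ultimately have "\<tau> ((c \<circ> b \<circ> c) ^^ n) = \<tau> (((b \<circ> a) ^^ m \<circ> b \<circ> c) \<circ> c)"
    using c by (simp only: m \<tau>_linear(4))
  also have "((b \<circ> a) ^^ m \<circ> b \<circ> c) \<circ> c = (b \<circ> a) ^^ n"
    by (simp only: m comp_assoc a funpow_Suc_right)
  finally show ?thesis .
qed

end

section \<open>Words in two free operators\<close>

definition word_op :: "'i op \<Rightarrow> 'i op \<Rightarrow> (bool \<times> complex poly) list \<Rightarrow> 'i op" where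
  "word_op a b ps = foldr (\<circ>) (map (\<lambda>(s, q). op_poly (if s then a else b) q) ps) id"

lemma word_op_Nil: "word_op a b [] = id"
  by (simp add: word_op_def)

lemma word_op_append: "word_op a b (ps @ qs) = word_op a b ps \<circ> word_op a b qs"
  by (induction ps) (simp_all add: word_op_def comp_assoc)

lemma word_op_Cons: "word_op a b (x # ps) = op_poly (if fst x then a else b) (snd x) \<circ> word_op a b ps"
  by (simp add: word_op_def case_prod_unfold)

locale vN_pair = vN_trace +
  fixes a b :: "'a op"
  assumes ab: "a \<in> M" "b \<in> M" and free: "free_pair \<tau> a b"
begin

lemma word_op_closed: "word_op a b ps \<in> M"
proof (induction ps)
  case Nil
  show ?case using M_closed(2) by (simp only: word_op_Nil)
next
  case (Cons x ps)
  have "(if fst x then a else b) \<in> M" using ab by simp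
  thus ?case unfolding word_op_Cons by (intro M_closed(3) op_poly_closed(1) Cons.IH)
qed

text \<open>Linearity in one letter: its scalar part drops out and leaves a word with one letter
  fewer.\<close>

lemma word_op_center:
  "\<tau> (word_op a b (cs @ (s, q) # qs)) =
     \<tau> (word_op a b (cs @ (s, q - [:c:]) # qs)) + c * \<tau> (word_op a b (cs @ qs))"
proof -
  let ?t = "if s then a else b"
  have t: "bounded_op ?t" using ab M_closed(1) by simp
  have q: "op_poly ?t q x = op_poly ?t (q - [:c:]) x + c *\<^sub>C x" for x
    using op_poly_add[OF t, of "q - [:c:]" "[:c:]" x] t by (simp add: bounded_opD(5))
  have "word_op a b (cs @ (s, q) # qs) =
      (\<lambda>x. word_op a b (cs @ (s, q - [:c:]) # qs) x + c *\<^sub>C word_op a b (cs @ qs) x)"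
    using M_closed(1)[OF word_op_closed, of cs]
    by (simp add: fun_eq_iff word_op_append word_op_Cons q bounded_opD)
  thus ?thesis
    using \<tau>_linear(1)[OF word_op_closed M_closed(5)[OF word_op_closed]] \<tau>_linear(2)[OF word_op_closed] by simp
qed

lemma word_op_merge:
  "word_op a b (xs @ (s, q) # (s, q') # ys) = word_op a b (xs @ (s, q * q') # ys)"
proof -
  have "bounded_op (if s then a else b)" using ab M_closed(1) by simp
  thus ?thesis by (simp add: fun_eq_iff word_op_append word_op_Cons op_poly_mult)
qed

lemma word_op_free:
  assumes "ps \<noteq> []" "\<And>s q. (s, q) \<in> set ps \<Longrightarrow> \<tau> (op_poly (if s then a else b) q) = 0"
    "\<And>k. Suc k < length ps \<Longrightarrow> fst (ps ! k) \<noteq> fst (ps ! Suc k)"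
  shows "\<tau> (word_op a b ps) = 0"
proof -
  define T where "T k = op_poly (if fst (ps ! k) then a else b) (snd (ps ! k))" for k
  have eq: "map T [0..<length ps] = map (\<lambda>(s, q). op_poly (if s then a else b) q) ps"
    by (rule nth_equalityI) (auto simp: T_def case_prod_unfold)
  have "\<tau> (foldr (\<circ>) (map T [0..<length ps]) id) = 0"
  proof (rule free[unfolded free_pair_def freely_independent_def, rule_format, where j = "\<lambda>k. fst (ps ! k)"],
      intro conjI allI impI)
    show "1 \<le> length ps" using assms(1) by (simp add: Suc_leI)
    fix k
    show "T k \<in> generated_algebra (if fst (ps ! k) then a else b)"
      unfolding T_def using ab by (intro op_poly_generated_algebra) (simp add: M_closed(1))
    show "\<tau> (T k) = 0" if "k < length ps"
      using assms(2)[of "fst (ps ! k)" "snd (ps ! k)"] that by (simp add: T_def)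
    show "fst (ps ! k) \<noteq> fst (ps ! Suc k)" if "Suc k < length ps" by (rule assms(3)[OF that])
  qed
  thus ?thesis by (simp add: word_op_def eq)
qed

end

text \<open>Neighbours from the same algebra are merged. In an alternating word the letters are
  centred one at a time, each at the cost of a shorter word, and the fully centred word has trace 0
  on both sides by freeness.\<close>

theorem free_joint_moments_unique:
  fixes M1 :: "'i op set" and M2 :: "'j op set"
  assumes "vN_pair M1 \<tau>1 a1 b1" "vN_pair M2 \<tau>2 a2 b2"
    and ma: "\<And>n. \<tau>1 (a1 ^^ n) = \<tau>2 (a2 ^^ n)" and mb: "\<And>n. \<tau>1 (b1 ^^ n) = \<tau>2 (b2 ^^ n)"
  shows "\<tau>1 (word_op a1 b1 ps) = \<tau>2 (word_op a2 b2 ps)"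
proof (induction "length ps" arbitrary: ps rule: less_induct)
  case less
  interpret A: vN_pair M1 \<tau>1 a1 b1 by fact
  interpret B: vN_pair M2 \<tau>2 a2 b2 by fact
  have single: "\<tau>1 (op_poly (if s then a1 else b1) q) = \<tau>2 (op_poly (if s then a2 else b2) q)" for s q
    using A.ab B.ab by (simp add: A.op_poly_closed(2) B.op_poly_closed(2) ma mb)
  show ?case
  proof (cases "\<exists>k. Suc k < length ps \<and> fst (ps ! k) = fst (ps ! Suc k)")
    case True
    then obtain k where k: "Suc k < length ps" "fst (ps ! k) = fst (ps ! Suc k)" by blast
    define s where "s = fst (ps ! k)"
    have "ps = take k ps @ ps ! k # ps ! Suc k # drop (Suc (Suc k)) ps"
      using k(1) by (metis Cons_nth_drop_Suc Suc_lessD append_take_drop_id)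
    also have "ps ! k = (s, snd (ps ! k))" by (simp add: s_def)
    also have "ps ! Suc k = (s, snd (ps ! Suc k))" using k(2) by (simp add: s_def)
    finally obtain xs q q' ys where ps: "ps = xs @ (s, q) # (s, q') # ys" by blast
    show ?thesis
      unfolding ps A.word_op_merge B.word_op_merge by (rule less.hyps) (simp add: ps)
  next
    case False
    \<comment> \<open>\<open>cs\<close> holds the letters already centred. The same constants centre
      the letters in both algebras, since single letters have equal expectations.\<close>
    have "\<tau>1 (word_op a1 b1 (cs @ qs)) = \<tau>2 (word_op a2 b2 (cs @ qs))"
      if "length (cs @ qs) = length ps" 
        "\<forall>k. Suc k < length (cs @ qs) \<longrightarrow> fst ((cs @ qs) ! k) \<noteq> fst ((cs @ qs) ! Suc k)"
        "\<forall>(s, q)\<in>set cs. \<tau>1 (op_poly (if s then a1 else b1) q) = 0" for cs qs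
      using that
    proof (induction qs arbitrary: cs)
      case Nil
      show ?case
      proof (cases "cs = []")
        case True
        thus ?thesis by (simp only: word_op_Nil append_Nil A.\<tau>_linear(3) B.\<tau>_linear(3))
      next
        case False
        have "\<tau>1 (word_op a1 b1 cs) = 0"
          using Nil.prems False by (intro A.word_op_free) auto
        moreover have "\<tau>2 (word_op a2 b2 cs) = 0"
          using Nil.prems False by (intro B.word_op_free) (auto simp: single)
        ultimately show ?thesis by simp
      qed
    next
      case (Cons x qs)
      obtain s q where x: "x = (s, q)" by (cases x)
      define c where "c = \<tau>1 (op_poly (if s then a1 else b1) q)"
      have c0: "\<tau>1 (op_poly (if s then a1 else b1) (q - [:c:])) = 0"
        using A.word_op_center[of "[]" s q "[]" c] by (simp add: word_op_def A.\<tau>_linear c_def)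
      have fsts: "fst ((cs @ x # qs) ! k) = fst ((cs @ (s, q - [:c:]) # qs) ! k)" for k
        by (auto simp: nth_append nth_Cons x split: nat.splits)
      have "\<tau>1 (word_op a1 b1 ((cs @ [(s, q - [:c:])]) @ qs)) = \<tau>2 (word_op a2 b2 ((cs @ [(s, q - [:c:])]) @ qs))"
        by (rule Cons.IH) (use Cons.prems c0 fsts in auto)
      moreover have "\<tau>1 (word_op a1 b1 (cs @ qs)) = \<tau>2 (word_op a2 b2 (cs @ qs))"
        by (rule less.hyps) (use Cons.prems in simp)
      ultimately show ?case
        unfolding x using A.word_op_center[of cs s q qs c] B.word_op_center[of cs s q qs c] by simp
    qed
    from this[of "[]" ps] False show ?thesis by simp
  qed
qed

lemma word_op_alternating:
  assumes "bounded_op a" "bounded_op b"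
  shows "word_op a b (concat (replicate n [(False, [:0, 1:]), (True, [:0, 1:])])) = (b \<circ> a) ^^ n"
proof (induction n)
  case (Suc n)
  have "op_poly T [:0, 1:] = T" if "bounded_op T" for T :: "'a op"
    using that by (simp add: fun_eq_iff bounded_opD(5))
  thus ?case using Suc assms by (simp add: word_op_append word_op_Cons comp_assoc)
qed (simp add: word_op_def)

corollary free_product_moments_unique:
  assumes "vN_pair M1 \<tau>1 a1 b1" "vN_pair M2 \<tau>2 a2 b2"
    and "\<And>n. \<tau>1 (a1 ^^ n) = \<tau>2 (a2 ^^ n)" "\<And>n. \<tau>1 (b1 ^^ n) = \<tau>2 (b2 ^^ n)"
  shows "\<tau>1 ((b1 \<circ> a1) ^^ n) = \<tau>2 ((b2 \<circ> a2) ^^ n)"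
proof -
  interpret A: vN_pair M1 \<tau>1 a1 b1 by fact
  interpret B: vN_pair M2 \<tau>2 a2 b2 by fact
  show ?thesis
    using free_joint_moments_unique[OF assms, of "concat (replicate n [(False, [:0, 1:]), (True, [:0, 1:])])"]
    by (simp only: word_op_alternating[OF A.M_closed(1) A.M_closed(1), OF A.ab]
        word_op_alternating[OF B.M_closed(1) B.M_closed(1), OF B.ab])
qed

section \<open>Moments of compactly supported measures\<close>

lemma integrable_bounded_borel:
  fixes f :: "real \<Rightarrow> 'b :: {banach, second_countable_topology}"
  assumes "prob_space \<nu>" "sets \<nu> = sets borel" "f \<in> borel_measurable borel" "AE x in \<nu>. norm (f x) \<le> K"
  shows "integrable \<nu> f"
proof -
  interpret prob_space \<nu> by fact
  have "f \<in> borel_measurable \<nu>" using assms(3) measurable_cong_sets[OF assms(2) refl] by blast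
  thus ?thesis using assms(4) by (intro integrable_const_bound)
qed

lemma integrable_power_compact:
  fixes \<nu> :: "real measure"
  assumes "prob_space \<nu>" "sets \<nu> = sets borel" "AE x in \<nu>. \<bar>x\<bar> \<le> K"
  shows "integrable \<nu> (\<lambda>x. x ^ n)"
proof (rule integrable_bounded_borel[OF assms(1,2), where K = "K ^ n"])
  show "AE x in \<nu>. norm (x ^ n) \<le> K ^ n"
    using assms(3) by eventually_elim (auto simp: power_abs intro: power_mono)
qed simp

text \<open>Compact support gives the dominating constant \<open>exp (\<bar>t\<bar> * K)\<close> for
  the partial sums of the exponential, so the moments determine the characteristic function.\<close>

lemma char_compact_LIMSEQ:
  fixes \<nu> :: "real measure"
  assumes "prob_space \<nu>" "sets \<nu> = sets borel" "AE x in \<nu>. \<bar>x\<bar> \<le> K"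
  shows "(\<lambda>N. \<Sum>n<N. (\<i> * of_real t) ^ n / fact n * of_real (\<integral>x. x ^ n \<partial>\<nu>)) \<longlonglongrightarrow> char \<nu> t"
proof -
  interpret prob_space \<nu> by fact
  define s where "s N x = (\<Sum>n<N. (\<i> * of_real (t * x)) ^ n / fact n)" for N x
  have m: "f \<in> borel_measurable \<nu>" if "f \<in> borel_measurable borel" for f :: "real \<Rightarrow> complex"
    using that measurable_cong_sets[OF assms(2) refl] by blast
  have "(\<lambda>N. \<integral>x. s N x \<partial>\<nu>) \<longlonglongrightarrow> (\<integral>x. iexp (t * x) \<partial>\<nu>)"
  proof (rule integral_dominated_convergence[where w = "\<lambda>_. exp (\<bar>t\<bar> * K)"])
    show "AE x in \<nu>. (\<lambda>N. s N x) \<longlonglongrightarrow> iexp (t * x)"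
      using exp_converges[of "\<i> * of_real (t * _)"]
      by (intro always_eventually allI) (simp add: s_def sums_def scaleR_conv_of_real divide_inverse mult.commute)
    show "AE x in \<nu>. norm (s N x) \<le> exp (\<bar>t\<bar> * K)" for N
      using assms(3)
    proof eventually_elim
      fix x assume x: "\<bar>x\<bar> \<le> K"
      have "norm (s N x) \<le> (\<Sum>n<N. norm ((\<i> * of_real (t * x)) ^ n / fact n))"
        unfolding s_def by (rule norm_sum)
      also have "\<dots> = (\<Sum>n<N. \<bar>t * x\<bar> ^ n / fact n)"
        by (simp add: norm_divide norm_power norm_mult abs_mult)
      also have "\<dots> \<le> exp \<bar>t * x\<bar>"
        using exp_converges[of "\<bar>t * x\<bar>"]
        by (intro sum_le_suminf[of "\<lambda>n. \<bar>t * x\<bar> ^ n / fact n", THEN order.trans])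
          (auto simp: sums_iff scaleR_conv_of_real divide_inverse mult.commute)
      also have "\<dots> \<le> exp (\<bar>t\<bar> * K)" using x by (simp add: abs_mult mult_left_mono)
      finally show "norm (s N x) \<le> exp (\<bar>t\<bar> * K)" .
    qed
  qed (auto intro!: m borel_measurable_continuous_onI continuous_intros simp: s_def)
  also have "(\<integral>x. iexp (t * x) \<partial>\<nu>) = char \<nu> t" by (simp add: char_def)
  also have "(\<lambda>N. \<integral>x. s N x \<partial>\<nu>) = (\<lambda>N. \<Sum>n<N. (\<i> * of_real t) ^ n / fact n * of_real (\<integral>x. x ^ n \<partial>\<nu>))"
  proof
    fix N
    have i: "integrable \<nu> (\<lambda>x. complex_of_real (x ^ n))" for n
      by (intro integrable_of_real integrable_power_compact[OF assms])
    have "s N = (\<lambda>x. \<Sum>n<N. ((\<i> * of_real t) ^ n / fact n) * of_real (x ^ n))"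
      by (simp add: s_def power_mult_distrib fun_eq_iff mult.assoc)
    hence "(\<integral>x. s N x \<partial>\<nu>) = (\<Sum>n<N. \<integral>x. ((\<i> * of_real t) ^ n / fact n) * complex_of_real (x ^ n) \<partial>\<nu>)"
      using i by (simp only: Bochner_Integration.integral_sum integrable_mult_right)
    thus "(\<integral>x. s N x \<partial>\<nu>) = (\<Sum>n<N. (\<i> * of_real t) ^ n / fact n * of_real (\<integral>x. x ^ n \<partial>\<nu>))"
      by (simp only: integral_mult_right_zero integral_complex_of_real)
  qed
  finally show ?thesis .
qed

lemma compact_moments_unique:
  fixes \<nu>1 \<nu>2 :: "real measure"
  assumes "prob_space \<nu>1" "sets \<nu>1 = sets borel" "compactly_supported \<nu>1"
    and "prob_space \<nu>2" "sets \<nu>2 = sets borel" "compactly_supported \<nu>2"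
    and "\<And>n. (\<integral>x. x ^ n \<partial>\<nu>1) = (\<integral>x. x ^ n \<partial>\<nu>2)"
  shows "\<nu>1 = \<nu>2"
proof (rule Levy_uniqueness)
  show "real_distribution \<nu>1" "real_distribution \<nu>2"
    using assms by (auto simp: real_distribution_def real_distribution_axioms_def)
  obtain K1 where "AE x in \<nu>1. \<bar>x\<bar> \<le> K1" using assms(3) by (auto simp: compactly_supported_def)
  note 1 = char_compact_LIMSEQ[OF assms(1,2) this]
  obtain K2 where "AE x in \<nu>2. \<bar>x\<bar> \<le> K2" using assms(6) by (auto simp: compactly_supported_def)
  note 2 = char_compact_LIMSEQ[OF assms(4,5) this]
  show "char \<nu>1 = char \<nu>2"
  proof
    fix t
    show "char \<nu>1 t = char \<nu>2 t" using 1[of t] 2[of t] unfolding assms(7) by (rule LIMSEQ_unique)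
  qed
qed

text \<open>Markov's inequality at the threshold \<open>K + 1\<close>: the mass beyond it is at most
  the \<open>2 * m\<close>-th power of \<open>K / (K + 1)\<close> for all \<open>m \<ge> 1\<close>,
  hence 0.\<close>

lemma compactly_supported_even_moments:
  fixes \<mu> :: "real measure"
  assumes "prob_space \<mu>" and s: "sets \<mu> = sets borel" and K: "K \<ge> 0"
    and int: "\<And>m. m \<ge> 1 \<Longrightarrow> integrable \<mu> (\<lambda>x. x ^ (2 * m))"
    and le: "\<And>m. m \<ge> 1 \<Longrightarrow> (\<integral>x. x ^ (2 * m) \<partial>\<mu>) \<le> K ^ (2 * m)"
  shows "compactly_supported \<mu>"
proof -
  interpret prob_space \<mu> by fact
  define A where "A = {x::real. \<bar>x\<bar> \<ge> K + 1}"
  have A: "A \<in> sets \<mu>" unfolding s A_def by measurable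
  have "measure \<mu> A \<le> (K / (K + 1)) ^ (2 * m)" if m: "m \<ge> 1" for m
  proof -
    have "measure \<mu> A * (K + 1) ^ (2 * m) = (\<integral>x. (K + 1) ^ (2 * m) * indicator A x \<partial>\<mu>)"
      using A by (simp add: mult.commute)
    also have "\<dots> \<le> (\<integral>x. x ^ (2 * m) \<partial>\<mu>)"
    proof (rule integral_mono)
      show "integrable \<mu> (\<lambda>x. (K + 1) ^ (2 * m) * indicator A x)"
        using A by (intro integrable_mult_right) (simp add: integrable_indicator_iff emeasure_eq_measure)
      show "(K + 1) ^ (2 * m) * indicator A x \<le> x ^ (2 * m)" for x
      proof (cases "x \<in> A")
        case True
        hence "(K + 1) ^ (2 * m) \<le> \<bar>x\<bar> ^ (2 * m)" using K by (intro power_mono) (auto simp: A_def)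
        thus ?thesis using True by (simp add: power_even_abs)
      qed simp
    qed (rule int[OF m])
    also have "\<dots> \<le> K ^ (2 * m)" by (rule le[OF m])
    finally show ?thesis using K by (simp add: power_divide field_simps)
  qed
  moreover have "(\<lambda>m. (K / (K + 1)) ^ (2 * m)) \<longlonglongrightarrow> 0"
    using K by (auto simp: power_mult intro!: LIMSEQ_power_zero power_less_one_iff[THEN iffD2])
  ultimately have "measure \<mu> A \<le> 0"
    by (intro LIMSEQ_le_const[of _ 0 "measure \<mu> A"]) blast+
  hence "AE x in \<mu>. x \<notin> A"
    using A by (intro AE_not_in) (auto simp: null_sets_def emeasure_eq_measure measure_le_0_iff)
  hence "AE x in \<mu>. \<bar>x\<bar> \<le> K + 1" by eventually_elim (auto simp: A_def)
  thus ?thesis by (auto simp: compactly_supported_def)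
qed

subsection \<open>The law of the spectral density\<close>

abbreviation unif :: "real measure" where "unif \<equiv> uniform_measure lborel {-pi<..<pi}"

lemma prob_space_unif: "prob_space unif"
  by (rule prob_space_uniform_measure) (simp_all add: emeasure_lborel_Ioo)

lemma sets_unif: "sets unif = sets borel"
  by simp

lemma integral_unif:
  fixes f :: "real \<Rightarrow> complex"
  assumes f[measurable]: "f \<in> borel_measurable borel"
  shows "(\<integral>x. f x \<partial>unif) = of_real (1 / (2 * pi)) * (\<integral>x. indicator {-pi..pi} x *\<^sub>R f x \<partial>lborel)"
proof -
  have "unif = density lborel (\<lambda>x. ennreal (indicator {-pi<..<pi} x / (2 * pi)))"
    unfolding uniform_measure_def
    by (rule density_cong) (auto simp: emeasure_lborel_Ioo indicator_def divide_ennreal ennreal_1[symmetric] 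
      simp del: ennreal_1)
  hence "(\<integral>x. f x \<partial>unif) = (\<integral>x. (indicator {-pi<..<pi} x / (2 * pi)) *\<^sub>R f x \<partial>lborel)"
    by (simp add: integral_density)
  also have "\<dots> = (\<integral>x. of_real (1 / (2 * pi)) * (indicator {-pi..pi} x *\<^sub>R f x) \<partial>lborel)"
  proof (rule integral_cong_AE)
    \<comment> \<open>The endpoints are null; the closed interval suits the fundamental theorem of
      calculus.\<close>
    have "AE x in lborel. x \<noteq> -pi \<and> x \<noteq> pi"
      using AE_lborel_singleton[of "-pi"] AE_lborel_singleton[of pi] by eventually_elim auto
    thus "AE x in lborel. (indicator {-pi<..<pi} x / (2 * pi)) *\<^sub>R f x =
        of_real (1 / (2 * pi)) * (indicator {-pi..pi} x *\<^sub>R f x)"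
      by eventually_elim (auto simp: indicator_def scaleR_conv_of_real)
  qed measurable
  also have "\<dots> = of_real (1 / (2 * pi)) * (\<integral>x. indicator {-pi..pi} x *\<^sub>R f x \<partial>lborel)"
    by (rule integral_mult_right_zero)
  finally show ?thesis .
qed

section \<open>Fourier coefficients of the powers of the spectral density\<close>

definition fexp :: "int \<Rightarrow> real \<Rightarrow> complex" where
  "fexp k x = exp (- \<i> * of_int k * of_real x)"

lemma fexp_simps [simp]: "norm (fexp k x) = 1" "fexp m x * fexp k x = fexp (m + k) x" "fexp 0 x = 1"
  by (simp_all add: fexp_def algebra_simps flip: exp_add)

lemma continuous_fexp: "continuous_on A (fexp k)"
  unfolding fexp_def[abs_def] by (intro continuous_intros)

lemma fexp_measurable [measurable]: "fexp k \<in> borel_measurable borel"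
  by (intro borel_measurable_continuous_onI continuous_fexp)

lemma fexp_cis: "fexp k x = cis (- (of_int k * x))"
  by (simp add: fexp_def cis_conv_exp mult.assoc)

lemma integral_fexp: "(\<integral>x. fexp m x \<partial>unif) = (if m = 0 then 1 else 0)"
proof (cases "m = 0")
  case True
  interpret prob_space unif by (rule prob_space_unif)
  show ?thesis using True prob_space by simp
next
  case False
  define F where "F x = fexp m x / (- \<i> * of_int m)" for x
  have "(\<integral>x. indicator {-pi..pi} x *\<^sub>R fexp m x \<partial>lborel) = F pi - F (-pi)"
  proof (rule integral_FTC_Icc)
    show "(F has_vector_derivative fexp m x) (at x within {-pi..pi})" for x
      unfolding F_def fexp_def using False
      by (auto intro!: derivative_eq_intros has_vector_derivative_real_field simp: field_simps)
  qed (auto simp: continuous_fexp)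
  also have "F pi - F (-pi) = 0"
  proof -
    have "cis (- (of_int m * pi)) = cis (of_int m * pi)"
      by (simp add: complex_eq_iff mult.commute[of _ pi])
    thus ?thesis by (simp add: F_def fexp_cis)
  qed
  finally show ?thesis using False by (simp add: integral_unif)
qed

context
  fixes R :: "int \<Rightarrow> int \<Rightarrow> real" and p :: "int \<Rightarrow> real"
  defines "p \<equiv> \<lambda>k. R k 0"
  assumes sp: "(\<lambda>k. \<bar>p k\<bar>) summable_on UNIV"
begin

lemma r_fun_abs_summable: "(\<lambda>k. norm (complex_of_real (p k) * fexp k x)) summable_on UNIV"
  using sp by (simp add: norm_mult)

lemma r_fun_has_sum: "((\<lambda>k. complex_of_real (p k) * fexp k x) has_sum r_fun R x) UNIV"
  using has_sum_infsum[OF abs_summable_summable[OF r_fun_abs_summable[of x]]]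
  by (simp add: r_fun_def fexp_def p_def)

lemma r_fun_LIMSEQ: "(\<lambda>N. \<Sum>k\<in>{- int N..int N}. complex_of_real (p k) * fexp k x) \<longlonglongrightarrow> r_fun R x"
  by (rule has_sum_symmetric_intervals[OF r_fun_has_sum])

lemma r_fun_measurable [measurable]: "r_fun R \<in> borel_measurable borel"
  by (rule borel_measurable_LIMSEQ_metric[OF _ r_fun_LIMSEQ]) measurable

lemma norm_r_fun_partial: "norm (\<Sum>k\<in>{- int N..int N}. complex_of_real (p k) * fexp k x) \<le> (\<Sum>\<^sub>\<infinity>k. \<bar>p k\<bar>)"
proof -
  have "norm (\<Sum>k\<in>{- int N..int N}. complex_of_real (p k) * fexp k x) \<le> (\<Sum>k\<in>{- int N..int N}. \<bar>p k\<bar>)"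
    by (rule order.trans[OF norm_sum]) (simp add: norm_mult)
  also have "\<dots> \<le> (\<Sum>\<^sub>\<infinity>k. \<bar>p k\<bar>)" by (rule finite_sum_le_infsum[OF sp]) auto
  finally show ?thesis .
qed

lemma norm_r_fun: "norm (r_fun R x) \<le> (\<Sum>\<^sub>\<infinity>k. \<bar>p k\<bar>)"
  by (rule LIMSEQ_le_const2[OF tendsto_norm[OF r_fun_LIMSEQ[of x]]]) (use norm_r_fun_partial in blast)

text \<open>One factor \<open>r_fun R x\<close> is a bounded limit of symmetric partial sums, and
  each exponential in them shifts the frequency \<open>m\<close>; this is the recursion of
  \<open>tmom\<close>. The integral also bounds \<open>tmom\<close>, which makes its series
  summable.\<close>

lemma integral_fexp_r_fun: "(\<integral>x. fexp m x * r_fun R x ^ n \<partial>unif) = tmom p n m"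
proof (induction n arbitrary: m)
  case 0
  show ?case by (simp add: integral_fexp)
next
  case (Suc n)
  define C where "C = (\<Sum>\<^sub>\<infinity>k. \<bar>p k\<bar>)"
  have C: "C \<ge> 0" unfolding C_def by (rule infsum_nonneg) simp
  interpret prob_space unif by (rule prob_space_unif)
  have bd: "norm (fexp m x * r_fun R x ^ n) \<le> C ^ n" for m x
    using norm_r_fun[of x] by (simp add: norm_mult norm_power C_def power_mono)
  have int: "integrable unif (\<lambda>x. fexp m x * r_fun R x ^ n)" for m
    by (rule integrable_bounded_borel[OF prob_space_unif sets_unif, where K = "C ^ n"]) 
      (measurable, intro always_eventually allI bd)
  have tm: "norm (tmom p n m) \<le> C ^ n" for m
  proof -
    have "norm (\<integral>x. fexp m x * r_fun R x ^ n \<partial>unif) \<le> (\<integral>x. norm (fexp m x * r_fun R x ^ n) \<partial>unif)"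
      by (rule integral_norm_bound)
    also have "\<dots> \<le> (\<integral>x. C ^ n \<partial>unif)"
      by (intro integral_mono integrable_norm int) (auto intro: bd)
    finally show ?thesis using prob_space by (simp add: Suc)
  qed
  define s where "s N x = (\<Sum>k\<in>{- int N..int N}. complex_of_real (p k) * fexp k x)" for N x
  have "(\<lambda>N. \<integral>x. fexp m x * r_fun R x ^ n * s N x \<partial>unif) \<longlonglongrightarrow> (\<integral>x. fexp m x * r_fun R x ^ n * r_fun R x \<partial>unif)"
  proof (rule integral_dominated_convergence[where w = "\<lambda>_. C ^ n * C"])
    show "AE x in unif. (\<lambda>N. fexp m x * r_fun R x ^ n * s N x) \<longlonglongrightarrow> fexp m x * r_fun R x ^ n * r_fun R x"
      unfolding s_def by (intro always_eventually allI tendsto_intros r_fun_LIMSEQ)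
    show "AE x in unif. norm (fexp m x * r_fun R x ^ n * s N x) \<le> C ^ n * C" for N
      unfolding norm_mult[of "_ * _"] using bd C norm_r_fun_partial
      by (intro always_eventually allI mult_mono) (auto simp: s_def C_def)
  qed (auto simp: s_def)
  also have "(\<lambda>N. \<integral>x. fexp m x * r_fun R x ^ n * s N x \<partial>unif) = 
      (\<lambda>N. \<Sum>k\<in>{- int N..int N}. of_real (p k) * tmom p n (m + k))"
  proof
    fix N
    have "(\<lambda>x. fexp m x * r_fun R x ^ n * s N x) =
        (\<lambda>x. \<Sum>k\<in>{- int N..int N}. complex_of_real (p k) * (fexp (m + k) x * r_fun R x ^ n))"
      by (simp add: s_def sum_distrib_left fun_eq_iff mult_ac flip: fexp_simps(2))
    hence "(\<integral>x. fexp m x * r_fun R x ^ n * s N x \<partial>unif) =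
        (\<Sum>k\<in>{- int N..int N}. \<integral>x. complex_of_real (p k) * (fexp (m + k) x * r_fun R x ^ n) \<partial>unif)"
      using int by (simp only: Bochner_Integration.integral_sum integrable_mult_right)
    thus "(\<integral>x. fexp m x * r_fun R x ^ n * s N x \<partial>unif) = (\<Sum>k\<in>{- int N..int N}. of_real (p k) * tmom p n (m + k))"
      by (simp only: integral_mult_right_zero Suc)
  qed
  finally have 1: "(\<lambda>N. \<Sum>k\<in>{- int N..int N}. of_real (p k) * tmom p n (m + k)) \<longlonglongrightarrow>
      (\<integral>x. fexp m x * r_fun R x ^ n * r_fun R x \<partial>unif)" .
  have "(\<lambda>k. norm (of_real (p k) * tmom p n (m + k))) summable_on UNIV"
    by (rule summable_on_comparison_test[OF summable_on_cmult_left[OF sp, of "C ^ n"]])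
      (auto simp: norm_mult intro!: mult_left_mono tm)
  from has_sum_symmetric_intervals[OF has_sum_infsum[OF abs_summable_summable[OF this]]]
  have "(\<lambda>N. \<Sum>k\<in>{- int N..int N}. of_real (p k) * tmom p n (m + k)) \<longlonglongrightarrow> tmom p (Suc n) m" by simp
  from LIMSEQ_unique[OF 1 this] show ?case by (simp add: mult_ac)
qed

lemma has_distribution_mu_r:
  assumes re: "\<And>x. r_fun R x = of_real (Re (r_fun R x))"
  shows "has_distribution vac (conv_op p) (mu_r R)"
  unfolding has_distribution_def
proof (intro conjI allI)
  interpret prob_space unif by (rule prob_space_unif)
  have m: "(\<lambda>x. Re (r_fun R x)) \<in> measurable unif borel" by measurable
  show "prob_space (mu_r R)" unfolding mu_r_def by (rule prob_space_distr[OF m])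
  show "sets (mu_r R) = sets borel" by (simp add: mu_r_def)
  have "AE x in mu_r R. \<bar>x\<bar> \<le> (\<Sum>\<^sub>\<infinity>k. \<bar>p k\<bar>)"
    unfolding mu_r_def
    by (subst AE_distr_iff[OF m]) (auto intro!: always_eventually order.trans[OF abs_Re_le_cmod norm_r_fun])
  thus "compactly_supported (mu_r R)" by (auto simp: compactly_supported_def)
  fix n
  have "(\<integral>x. x ^ n \<partial>mu_r R) = (\<integral>x. Re (r_fun R x) ^ n \<partial>unif)"
    unfolding mu_r_def by (subst integral_distr[OF m]) simp_all
  hence "complex_of_real (\<integral>x. x ^ n \<partial>mu_r R) = (\<integral>x. complex_of_real (Re (r_fun R x) ^ n) \<partial>unif)"
    by (simp only: integral_complex_of_real)
  also have "\<dots> = (\<integral>x. fexp 0 x * r_fun R x ^ n \<partial>unif)"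
    by (intro Bochner_Integration.integral_cong) (simp_all add: re[symmetric])
  also have "\<dots> = vac (conv_op p ^^ n)"
    by (simp only: integral_fexp_r_fun conv_op_moments(2)[OF sp])
  finally show "vac (conv_op p ^^ n) = complex_of_real (\<integral>x. x ^ n \<partial>mu_r R)" by simp
qed

end

subsection \<open>The semicircle law\<close>

text \<open>Chebyshev polynomials of the second kind at \<open>x / 2\<close>, orthogonal for the
  semicircle law.\<close>

fun cheb :: "nat \<Rightarrow> real \<Rightarrow> real" where
  "cheb 0 x = 1"
| "cheb (Suc 0) x = x"
| "cheb (Suc (Suc n)) x = x * cheb (Suc n) x - cheb n x"

lemma continuous_cheb: "continuous_on A (cheb n)"
proof (induction n rule: induct_nat_012)
  case (ge2 n)
  show ?case unfolding cheb.simps by (intro continuous_intros ge2)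
qed (simp_all add: cheb.simps[abs_def])

text \<open>The signs stem from the substitution \<open>x = - 2 * cos t\<close>, chosen to increase
  from -2 to 2 as \<open>t\<close> runs from 0 to \<open>pi\<close>.\<close>

lemma cheb_cos: "cheb n (- 2 * cos t) * sin t = (-1) ^ n * sin ((real n + 1) * t)"
proof (induction n rule: induct_nat_012)
  case (ge2 n)
  have "sin ((real n + 3) * t) + sin ((real n + 1) * t) = 2 * cos t * sin ((real n + 2) * t)"
    using sin_add[of "(real n + 2) * t" t] sin_diff[of "(real n + 2) * t" t] by (simp add: algebra_simps)
  hence sn: "2 * cos t * sin ((real n + 2) * t) - sin ((real n + 1) * t) = sin ((real n + 3) * t)" by simp
  have "cheb (Suc (Suc n)) (- 2 * cos t) * sin t =
      - 2 * cos t * (cheb (Suc n) (- 2 * cos t) * sin t) - cheb n (- 2 * cos t) * sin t"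
    by (simp add: algebra_simps)
  also have "\<dots> = (-1) ^ n * (2 * cos t * sin ((real n + 2) * t) - sin ((real n + 1) * t))"
    unfolding ge2 by (simp add: algebra_simps)
  finally show ?case unfolding sn by (simp add: algebra_simps)
qed (use sin_double[of t] in \<open>simp_all add: algebra_simps\<close>)

lemma mu_s_integral:
  fixes f :: "real \<Rightarrow> real"
  assumes f: "continuous_on UNIV f"
  shows "integrable mu_s f"
    "(\<integral>x. f x \<partial>mu_s) = (\<integral>t. (2 / pi * (f (- 2 * cos t) * (sin t)\<^sup>2)) * indicator {0..pi} t \<partial>lborel)"
proof -
  have f'[measurable]: "f \<in> borel_measurable borel" by (rule borel_measurable_continuous_onI[OF f])
  define g where "g x = sqrt (4 - x\<^sup>2) / (2 * pi) * indicator {x. \<bar>x\<bar> \<le> 2} x" for x :: real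
  have g[measurable]: "g \<in> borel_measurable borel" unfolding g_def by measurable
  have g0: "0 \<le> g x" for x
    using abs_square_le_1[of "x / 2"] by (auto simp: g_def indicator_def power_divide)
  have eq: "g x *\<^sub>R f x = sqrt (4 - x\<^sup>2) / (2 * pi) * f x * indicator {- 2 * cos 0..- 2 * cos pi} x" for x
    by (auto simp: g_def indicator_def)
  have si: "set_integrable lborel {- 2 * cos 0..- 2 * cos pi} (\<lambda>x. sqrt (4 - x\<^sup>2) / (2 * pi) * f x)"
    by (rule borel_integrable_atLeastAtMost') (intro continuous_intros continuous_on_subset[OF f]; simp)
  have "integrable lborel (\<lambda>x. g x *\<^sub>R f x)"
    unfolding eq using si unfolding set_integrable_def real_scaleR_def
    by (subst mult.commute)
  thus "integrable mu_s f"
    unfolding mu_s_def g_def[symmetric] using g0 by (subst integrable_density) simp_all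
  have "(\<integral>x. f x \<partial>mu_s) = (\<integral>x. g x *\<^sub>R f x \<partial>lborel)"
    unfolding mu_s_def g_def[symmetric] using g0 by (subst integral_density) simp_all
  also have "\<dots> = (\<integral>x. (sqrt (4 - x\<^sup>2) / (2 * pi) * f x) * indicator {- 2 * cos 0..- 2 * cos pi} x \<partial>lborel)"
    unfolding eq ..
  also have "\<dots> = (\<integral>t. (sqrt (4 - (- 2 * cos t)\<^sup>2) / (2 * pi) * f (- 2 * cos t)) * (2 * sin t) * indicator {0..pi} t \<partial>lborel)"
  proof (rule integral_substitution(2)[where g = "\<lambda>t. - 2 * cos t" and g' = "\<lambda>t. 2 * sin t" and a = 0 and b = pi,
        OF si])
    show "((\<lambda>t. - 2 * cos t) has_real_derivative 2 * sin t) (at t)" for t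
      by (auto intro!: derivative_eq_intros)
  qed (auto intro!: continuous_intros sin_ge_zero)
  also have "\<dots> = (\<integral>t. (2 / pi * (f (- 2 * cos t) * (sin t)\<^sup>2)) * indicator {0..pi} t \<partial>lborel)"
  proof (rule Bochner_Integration.integral_cong[OF refl])
    fix t
    have "sqrt (4 - (- 2 * cos t)\<^sup>2) = 2 * sin t" if "t \<in> {0..pi}"
    proof (rule real_sqrt_unique)
      show "(2 * sin t)\<^sup>2 = 4 - (- 2 * cos t)\<^sup>2" by (simp add: power_mult_distrib sin_squared_eq)
    qed (use that in \<open>auto intro: sin_ge_zero\<close>)
    thus "(sqrt (4 - (- 2 * cos t)\<^sup>2) / (2 * pi) * f (- 2 * cos t)) * (2 * sin t) * indicator {0..pi} t =
      (2 / pi * (f (- 2 * cos t) * (sin t)\<^sup>2)) * indicator {0..pi} t"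
      by (auto simp: indicator_def power2_eq_square)
  qed
  finally show "(\<integral>x. f x \<partial>mu_s) = (\<integral>t. (2 / pi * (f (- 2 * cos t) * (sin t)\<^sup>2)) * indicator {0..pi} t \<partial>lborel)" .
qed

lemma mu_s_cheb: "(\<integral>x. cheb n x \<partial>mu_s) = (if n = 0 then 1 else 0)"
proof -
  \<comment> \<open>An antiderivative from the product formula for two sines; \<open>n = 0\<close>
    is separate because the general form divides by \<open>n\<close>.\<close>
  define F where "F t = (if n = 0 then (t - sin t * cos t) / pi
    else (-1) ^ n / pi * (sin (real n * t) / real n - sin ((real n + 2) * t) / (real n + 2)))" for t
  have "(\<integral>x. cheb n x \<partial>mu_s) = (\<integral>t. (2 / pi * ((-1) ^ n * sin ((real n + 1) * t) * sin t)) * indicator {0..pi} t \<partial>lborel)"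
  proof -
    have "cheb n (- 2 * cos t) * (sin t)\<^sup>2 = (-1) ^ n * sin ((real n + 1) * t) * sin t" for t
      unfolding power2_eq_square mult.assoc[symmetric] cheb_cos ..
    thus ?thesis by (subst mu_s_integral(2)[OF continuous_cheb]) simp
  qed
  also have "\<dots> = F pi - F 0"
  proof (rule integral_FTC_Icc_real)
    fix t :: real
    have sq: "1 - (cos t * cos t - sin t * sin t) = 2 * (sin t * sin t)"
      using sin_cos_squared_add[of t] by (simp add: power2_eq_square algebra_simps)
    have pr: "cos (real n * t) - cos ((real n + 2) * t) = 2 * sin ((real n + 1) * t) * sin t"
      using cos_add[of "(real n + 1) * t" t] cos_diff[of "(real n + 1) * t" t] by (simp add: algebra_simps)
    show "DERIV F t :> 2 / pi * ((-1) ^ n * sin ((real n + 1) * t) * sin t)"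
    proof (cases "n = 0")
      case True
      have "((\<lambda>t. (t - sin t * cos t) / pi) has_real_derivative (1 - (cos t * cos t - sin t * sin t)) / pi) (at t)"
        by (rule DERIV_cdivide) (auto intro!: derivative_eq_intros simp: algebra_simps)
      thus ?thesis using True unfolding sq F_def by simp
    next
      case False
      have d: "((\<lambda>t. sin (c * t) / c) has_real_derivative cos (c * t)) (at t)" if "c \<noteq> 0" for c :: real
        using that by (auto intro!: derivative_eq_intros)
      have "((\<lambda>t. (-1) ^ n / pi * (sin (real n * t) / real n - sin ((real n + 2) * t) / (real n + 2)))
        has_real_derivative (-1) ^ n / pi * (cos (real n * t) - cos ((real n + 2) * t))) (at t)"
        by (rule DERIV_cmult[OF DERIV_diff[OF d d]]) (use False in auto)
      thus ?thesis using False unfolding pr F_def by (simp add: mult_ac)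
    qed
  qed (auto intro!: continuous_intros)
  also have "F pi - F 0 = (if n = 0 then 1 else 0)"
  proof -
    have "sin ((real n + 2) * pi) = 0" using sin_npi[of "n + 2"] by (simp add: add.commute)
    thus ?thesis by (simp add: F_def)
  qed
  finally show ?thesis .
qed

text \<open>Multiplication by \<open>x\<close> sends \<open>cheb n\<close> to the sum of its two
  neighbours (to \<open>cheb 1\<close> alone for \<open>n = 0\<close>), which is the recursion of
  \<open>ballot\<close>.\<close>

lemma mu_s_power_cheb: "(\<integral>x. x ^ k * cheb n x \<partial>mu_s) = ballot k n"
proof (induction k arbitrary: n)
  case 0
  show ?case by (simp add: mu_s_cheb)
next
  case (Suc k)
  have int: "integrable mu_s (\<lambda>x. x ^ k * cheb n x)" for n
    by (intro mu_s_integral(1) continuous_intros continuous_cheb)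
  show ?case
  proof (cases n)
    case 0
    thus ?thesis using Suc.IH[of 1] by (simp add: mult.commute)
  next
    case (Suc m)
    have "(\<lambda>x. x ^ Suc k * cheb n x) = (\<lambda>x. x ^ k * cheb (Suc n) x + x ^ k * cheb m x)"
      by (simp add: Suc fun_eq_iff algebra_simps)
    hence "(\<integral>x. x ^ Suc k * cheb n x \<partial>mu_s) = (\<integral>x. x ^ k * cheb (Suc n) x \<partial>mu_s) + (\<integral>x. x ^ k * cheb m x \<partial>mu_s)"
      by (simp only: Bochner_Integration.integral_add[OF int int])
    thus ?thesis unfolding Suc.IH by (simp add: Suc)
  qed
qed

lemma has_distribution_mu_s: "has_distribution vac lb mu_s"
  unfolding has_distribution_def
proof (intro conjI allI)
  have "(\<integral>x. 1 \<partial>mu_s) = (1::real)" using mu_s_cheb[of 0] by simp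
  moreover have i: "integrable mu_s (\<lambda>_. 1 :: real)" by (rule mu_s_integral(1)) simp
  ultimately have "(\<integral>\<^sup>+x. 1 \<partial>mu_s) = 1"
    using nn_integral_eq_integral[OF i] by simp
  thus "prob_space mu_s" by (intro prob_spaceI) simp
  show "sets mu_s = sets borel" by (simp add: mu_s_def)
  have "AE x in mu_s. \<bar>x\<bar> \<le> 2"
    unfolding mu_s_def by (subst AE_density) (auto simp: indicator_def)
  thus "compactly_supported mu_s" by (auto simp: compactly_supported_def)
  show "vac (lb ^^ n) = complex_of_real (\<integral>x. x ^ n \<partial>mu_s)" for n
    using mu_s_power_cheb[of n 0] by (simp add: vac_lb_funpow)
qed

section \<open>Free multiplicative convolution with the semicircle law\<close>

text \<open>The index \<open>j\<close> is the cut of the Fock word in one recursion and the partner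
  of the first point in the other. Both pieces are shorter, so induction on the length
  applies.\<close>

lemma gword_eq_nbal: "l \<le> h \<Longrightarrow> gword k l h c = of_nat (nbal k l h c)"
proof (induction "h - l" arbitrary: l h c rule: less_induct)
  case less
  show ?case
  proof (cases "l = h")
    case True
    thus ?thesis by (simp add: gword_empty nbal_empty)
  next
    case False
    hence lh: "l < h" using less.prems by simp
    have "gword k (Suc l) j (k l) * gword k (Suc j) h (c + k j) =
        of_nat (nbal k (Suc l) j (k l)) * of_nat (nbal k (Suc j) h (c + k j))" if "j \<in> {Suc l..<h}" for j
      using that less.hyps[of j "Suc l"] less.hyps[of h "Suc j"] lh by auto
    thus ?thesis by (simp add: gword_rec[OF lh] nbal_rec[OF lh])
  qed
qed

text \<open>Each sum over \<open>S_set\<close> is extended by zero to all vectors, so that the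
  finite sum over pairings can be taken inside, where it counts the balanced ones.\<close>

lemma beta_eq_vac:
  assumes sp: "(\<lambda>k. \<bar>R k 0\<bar>) summable_on UNIV"
    and R: "\<And>u v. R u v = R u 0 * R v 0"
  shows "complex_of_real (beta R n) = vac ((lb \<circ> conv_op (\<lambda>k. R k 0)) ^^ n)"
proof -
  define p where "p k = R k 0" for k
  define w where "w k = (\<Prod>i\<in>{1..n}. p (k i))" for k :: "nat \<Rightarrow> int"
  let ?P = "PiE {1..n} (\<lambda>_. UNIV :: int set)"
  have "(\<lambda>k. \<bar>w k\<bar>) summable_on ?P"
    unfolding w_def abs_prod p_def by (rule abs_summable_prod_PiE) (simp_all add: sp)
  hence sw: "w summable_on A" if "A \<subseteq> ?P" for A
    using abs_summable_summable[of w ?P] summable_on_subset_banach[OF _ that] by simp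
  have inner: "(\<Sum>\<^sub>\<infinity>k\<in>S_set n \<sigma>. \<Prod>B\<in>\<sigma>. R (k (Min B)) (k (Max B))) =
      (\<Sum>\<^sub>\<infinity>k\<in>?P. if balanced k 1 (Suc n) 0 \<sigma> then w k else 0)" if \<sigma>: "\<sigma> \<in> NC2 n" for \<sigma>
  proof -
    have "(\<Prod>B\<in>\<sigma>. R (k (Min B)) (k (Max B))) = w k" for k
    proof -
      have "(\<Prod>B\<in>\<sigma>. R (k (Min B)) (k (Max B))) = (\<Prod>B\<in>\<sigma>. p (k (Min B)) * p (k (Max B)))"
        unfolding p_def by (rule prod.cong[OF refl]) (rule R)
      also have "\<dots> = w k" unfolding w_def by (rule prod_NC2[OF \<sigma>])
      finally show ?thesis .
    qed
    thus ?thesis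
      by (intro infsum_cong_neutral) (auto simp: S_set_iff_balanced[OF \<sigma>])
  qed
  have fin: "finite (NC2 n)" by (simp add: NC2_eq_NCI finite_NCI)
  have hs: "((\<lambda>k. if balanced k 1 (Suc n) 0 \<sigma> then w k else 0) has_sum
      (\<Sum>\<^sub>\<infinity>k\<in>?P. if balanced k 1 (Suc n) 0 \<sigma> then w k else 0)) ?P" for \<sigma>
  proof (rule has_sum_infsum)
    have "w summable_on {k \<in> ?P. balanced k 1 (Suc n) 0 \<sigma>}" by (rule sw) auto
    thus "(\<lambda>k. if balanced k 1 (Suc n) 0 \<sigma> then w k else 0) summable_on ?P"
      by (rule summable_on_cong_neutral[THEN iffD1, rotated -1]) auto
  qed
  have card: "(\<Sum>\<sigma>\<in>NC2 n. if balanced k 1 (Suc n) 0 \<sigma> then w k else 0) = w k * real (nbal k 1 (Suc n) 0)" for k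
    using fin by (simp add: nbal_def NC2_eq_NCI sum.If_cases Int_def)
  have "((\<lambda>k. w k * real (nbal k 1 (Suc n) 0)) has_sum beta R n) ?P"
    unfolding beta_def card[symmetric] using has_sum_finite_sum[where I = "NC2 n", OF hs] by (simp add: inner)
  hence "((\<lambda>k. complex_of_real (w k * real (nbal k 1 (Suc n) 0))) has_sum of_real (beta R n)) ?P"
    by (rule has_sum_of_real)
  thus ?thesis
    unfolding vac_lb_conv_op_funpow[OF sp] w_def p_def
    by (intro infsumI[symmetric]) (simp add: gword_eq_nbal)
qed

text \<open>The sum is the expectation of the squared modulus of the linear combination of the
  \<open>X j\<close> with coefficients \<open>c j\<close>.\<close>

lemma covariance_positive:
  fixes P :: "'w measure" and X :: "nat \<Rightarrow> 'w \<Rightarrow> real"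
  assumes X[measurable]: "\<And>i. X i \<in> borel_measurable P" and sq: "\<And>i. integrable P (\<lambda>w. (X i w)\<^sup>2)"
  shows "(\<Sum>i<N. \<Sum>j<N. of_real (\<integral>w. X i w * X j w \<partial>P) * cnj (c i) * c j) \<in> \<real>\<^sub>\<ge>\<^sub>0"
proof -
  have int: "integrable P (\<lambda>w. X i w * X j w)" for i j
  proof (rule Bochner_Integration.integrable_bound[OF Bochner_Integration.integrable_add[OF sq[of i] sq[of j]]])
    show "AE w in P. norm (X i w * X j w) \<le> norm ((X i w)\<^sup>2 + (X j w)\<^sup>2)"
    proof (intro always_eventually allI)
      fix w
      have "2 * \<bar>X i w * X j w\<bar> \<le> (X i w)\<^sup>2 + (X j w)\<^sup>2"
        using sum_squares_bound[of "\<bar>X i w\<bar>" "\<bar>X j w\<bar>"] by (simp add: abs_mult)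
      thus "norm (X i w * X j w) \<le> norm ((X i w)\<^sup>2 + (X j w)\<^sup>2)" by simp
    qed
  qed measurable
  have ci: "integrable P (\<lambda>w. complex_of_real (X i w * X j w) * (cnj (c i) * c j))" for i j
    by (intro integrable_mult_left integrable_of_real int)
  define S where "S w = (\<Sum>j<N. of_real (X j w) * c j)" for w
  have "(\<Sum>i<N. \<Sum>j<N. of_real (\<integral>w. X i w * X j w \<partial>P) * cnj (c i) * c j) =
      (\<Sum>i<N. \<Sum>j<N. \<integral>w. complex_of_real (X i w * X j w) * (cnj (c i) * c j) \<partial>P)"
    by (simp only: integral_mult_left_zero integral_complex_of_real mult.assoc)
  also have "\<dots> = (\<integral>w. (\<Sum>i<N. \<Sum>j<N. complex_of_real (X i w * X j w) * (cnj (c i) * c j)) \<partial>P)"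
    by (subst Bochner_Integration.integral_sum, intro Bochner_Integration.integrable_sum ci,
        subst Bochner_Integration.integral_sum, intro ci) (rule refl)
  also have "\<dots> = (\<integral>w. complex_of_real ((cmod (S w))\<^sup>2) \<partial>P)"
  proof (rule Bochner_Integration.integral_cong[OF refl])
    fix w
    have "complex_of_real ((cmod (S w))\<^sup>2) = cnj (S w) * S w" by (simp only: complex_norm_square mult.commute)
    also have "\<dots> = (\<Sum>i<N. \<Sum>j<N. complex_of_real (X i w * X j w) * (cnj (c i) * c j))"
      unfolding S_def cnj_sum sum_product by (intro sum.cong refl) (simp add: mult_ac)
    finally show "(\<Sum>i<N. \<Sum>j<N. complex_of_real (X i w * X j w) * (cnj (c i) * c j)) = complex_of_real ((cmod (S w))\<^sup>2)" ..
  qed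
  also have "\<dots> = of_real (\<integral>w. (cmod (S w))\<^sup>2 \<partial>P)" by (rule integral_complex_of_real)
  finally show ?thesis by simp
qed

text \<open>Positive definiteness is tested on exponentials at \<open>x\<close>, which produces the
  Toeplitz sums of the Fourier series.\<close>

lemma r_fun_nonneg:
  assumes sp: "(\<lambda>k. \<bar>R k 0\<bar>) summable_on UNIV"
    and pos: "\<And>N c. (\<Sum>i<N. \<Sum>j<N. complex_of_real (R (int i - int j) 0) * cnj (c i) * c j) \<in> \<real>\<^sub>\<ge>\<^sub>0"
  shows "r_fun R x \<in> \<real>\<^sub>\<ge>\<^sub>0"
proof -
  have "(\<Sum>i<N. \<Sum>j<N. complex_of_real (R (int i - int j) 0) * fexp (int i - int j) x) \<in> \<real>\<^sub>\<ge>\<^sub>0" for N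
  proof -
    have "fexp (i - j) x = cnj (fexp (- i) x) * fexp (- j) x" for i j
      by (simp add: fexp_cis cis_cnj cis_mult algebra_simps)
    thus ?thesis using pos[where N = N and c = "\<lambda>j. fexp (- int j) x"] by (simp add: mult.assoc)
  qed
  from toeplitz_positive_infsum[OF has_sum_imp_summable[OF r_fun_has_sum[where R = R, OF sp]] this]
  show ?thesis by (simp add: infsumI[OF r_fun_has_sum[where R = R, OF sp]])
qed

theorem theorem7p1:
  fixes P :: "'w measure"
    and Y :: "int \<Rightarrow> int \<Rightarrow> 'w \<Rightarrow> real"
    and R :: "int \<Rightarrow> int \<Rightarrow> real"
    and \<mu> :: "real measure"
  assumes "prob_space P"
    and "\<And>i j. Y i j \<in> borel_measurable P"
    and "\<And>i j. integrable P (\<lambda>w. (Y i j w)\<^sup>2)"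
    and "\<And>i j. (\<integral>w. Y i j w \<partial>P) = 0"
    and "\<And>i j. (\<integral>w. (Y i j w)\<^sup>2 \<partial>P) = 1"
    and "\<And>i j u v. (\<integral>w. Y i j w * Y (i - u) (j + v) w \<partial>P) = R u v"
    and "\<And>u v. R u v = R v u"
    and "(\<lambda>(u, v). \<bar>R u v\<bar>) summable_on UNIV"
    and "prob_space \<mu>"
    and "sets \<mu> = sets borel"
    and "distr \<mu> borel uminus = \<mu>"
    and "\<And>m. m \<ge> 1 \<Longrightarrow> integrable \<mu> (\<lambda>x. x ^ (2 * m)) \<and> (\<integral>x. x ^ (2 * m) \<partial>\<mu>) = beta R (2 * m)"
    and "\<And>u v. R u v = R u 0 * R 0 v"
  shows "(\<forall>x\<in>{-pi..pi}. (\<lambda>k :: int. norm (complex_of_real (R k 0) * exp (- \<i> * of_int k * of_real x)))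
              summable_on UNIV \<and> r_fun R x \<in> \<real>\<^sub>\<ge>\<^sub>0) \<and>
         \<mu> = mu_r R \<boxtimes> mu_s"
proof -
  define p where "p k = R k 0" for k
  have sp: "(\<lambda>k. \<bar>p k\<bar>) summable_on UNIV"
  proof -
    have "(\<lambda>(u, v). \<bar>R u v\<bar>) summable_on ((\<lambda>k. (k, 0)) ` UNIV)"
      by (rule summable_on_subset_banach[OF assms(8)]) auto
    thus ?thesis by (subst (asm) summable_on_reindex) (auto simp: inj_on_def o_def p_def)
  qed
  note sp' = sp[unfolded p_def]
  have even: "p (- k) = p k" for k
    \<comment> \<open>The covariance of \<open>Y 0 0\<close> and \<open>Y k 0\<close>, read in both
      orders.\<close>
    using assms(6)[of 0 0 "- k" 0] assms(6)[of k 0 k 0] by (simp add: p_def mult.commute)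
  have Rp: "R u v = R u 0 * R v 0" for u v using assms(13)[of u v] assms(7)[of 0 v] by simp
  have pos: "(\<Sum>i<N. \<Sum>j<N. of_real (p (int i - int j)) * cnj (c i) * c j) \<in> \<real>\<^sub>\<ge>\<^sub>0" for N c
  proof -
    have "p (int i - int j) = (\<integral>w. Y (int i) 0 w * Y (int j) 0 w \<partial>P)" for i j
      using assms(6)[of "int i" 0 "int i - int j" 0] by (simp add: p_def)
    thus ?thesis using covariance_positive[of "\<lambda>i. Y (int i) 0" P c N, OF assms(2,3)] by simp
  qed
  have r: "r_fun R x \<in> \<real>\<^sub>\<ge>\<^sub>0" for x
    by (rule r_fun_nonneg[where R = R, OF sp']) (use pos in \<open>simp add: p_def\<close>)
  have re: "r_fun R x = of_real (Re (r_fun R x))" for x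
    using r[of x] by (auto simp: complex_nonneg_Reals_iff complex_eq_iff)

  define a where "a = conv_op p"
  have aM: "a \<in> fock_alg" unfolding a_def by (rule conv_op_in_fock_alg[OF sp])
  have pa: "positive_op a" unfolding a_def by (rule positive_conv_op[OF sp even pos])
  obtain c where c: "positive_op c" "c \<circ> c = a"
    and cc: "\<And>S. bounded_op S \<Longrightarrow> S \<circ> a = a \<circ> S \<Longrightarrow> S \<circ> c = c \<circ> S"
    using positive_op_sqrt[OF pa] by blast
  have cM: "c \<in> fock_alg"
  proof -
    \<comment> \<open>The right generators commute with \<open>a\<close> and hence with its
      root.\<close>
    have "S \<circ> c = c \<circ> S" if "S \<in> right_gens" for S
      using right_gens_adjoint(1)[OF that] aM that by (intro cc) (auto simp: fock_alg_def commutant_def)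
    thus ?thesis using c(1) by (auto simp: fock_alg_def commutant_def positive_op_def)
  qed
  have da: "has_distribution vac a (mu_r R)"
    unfolding a_def p_def[abs_def] by (rule has_distribution_mu_r[where R = R, OF sp' re])
  have free: "free_pair vac a lb" unfolding a_def by (rule free_pair_conv_op_lb[OF sp even])
  interpret F: vN_pair fock_alg vac a lb
    by unfold_locales (simp_all add: tracial_vN_algebra_fock aM lb_in_fock_alg free)

  define d where "d = c \<circ> lb \<circ> c"
  have beta_vac: "complex_of_real (beta R n) = vac ((lb \<circ> a) ^^ n)" for n
    unfolding a_def p_def[abs_def] by (rule beta_eq_vac[where R = R, OF sp' Rp])
  have dn: "vac (d ^^ n) = complex_of_real (beta R n)" if "n \<ge> 1" for n
    unfolding d_def beta_vac by (rule F.trace_sandwich[OF cM lb_in_fock_alg c(2) that])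
  have odd_mu: "(\<integral>x. x ^ n \<partial>\<mu>) = 0" if "odd n" for n
  proof -
    have "(\<integral>x. x ^ n \<partial>\<mu>) = (\<integral>x. x ^ n \<partial>(distr \<mu> borel uminus))" using assms(11) by simp
    also have "\<dots> = (\<integral>x. (- x) ^ n \<partial>\<mu>)"
      by (rule integral_distr) (auto simp: measurable_cong_sets[OF assms(10) refl])
    also have "\<dots> = - (\<integral>x. x ^ n \<partial>\<mu>)" using that by simp
    finally show ?thesis by simp
  qed
  have mu_moments: "(\<integral>x. x ^ n \<partial>\<mu>) = beta R n" if "n \<ge> 1" for n
  proof (cases "even n")
    case True
    then obtain m where "n = 2 * m" by blast
    thus ?thesis using assms(12)[of m] that by simp
  next
    case False
    thus ?thesis by (simp add: odd_mu beta_def NC2_odd)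
  qed
  have dbound: "bounded_op d"
    unfolding d_def using c(1) by (intro bounded_op_compose) (simp_all add: positive_op_def)
  obtain K where K: "K > 0" "\<And>x. norm (d x) \<le> K * norm x" using bounded_op_bound[OF dbound] by blast
  have dK: "norm ((d ^^ n) x) \<le> K ^ n * norm x" for n x
  proof (induction n)
    case (Suc n)
    have "norm (d ((d ^^ n) x)) \<le> K * norm ((d ^^ n) x)" by (rule K)
    also have "\<dots> \<le> K * (K ^ n * norm x)" using Suc K(1) by (intro mult_left_mono) auto
    finally show ?case by (simp add: mult_ac)
  qed simp
  \<comment> \<open>The even moments are vacuum moments of \<open>d\<close>, hence at most powers of
    the bound \<open>K\<close> for this operator.\<close>
  have cs: "compactly_supported \<mu>"
  proof (rule compactly_supported_even_moments[OF assms(9,10), of K])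
    fix m :: nat assume m: "m \<ge> 1"
    show "integrable \<mu> (\<lambda>x. x ^ (2 * m))" using assms(12)[OF m] by simp
    have "complex_of_real ((norm \<Omega>)\<^sup>2) = of_real 1"
      using cinner_self_norm[of \<Omega>] by (simp only: cinner_\<Omega>_\<Omega> of_real_1)
    hence "(norm \<Omega>)\<^sup>2 = 1" using of_real_eq_iff by blast
    hence "norm \<Omega> = 1" using norm_ge_zero[of \<Omega>] by (auto simp: power2_eq_1_iff)
    have "(\<integral>x. x ^ (2 * m) \<partial>\<mu>) = beta R (2 * m)" using assms(12)[OF m] by simp
    also have "\<dots> \<le> norm (complex_of_real (beta R (2 * m)))" by simp
    also have "\<dots> = norm (cinner \<Omega> ((d ^^ (2 * m)) \<Omega>))" using dn[of "2 * m"] m by (simp add: vac_def)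
    also have "\<dots> \<le> norm \<Omega> * (K ^ (2 * m) * norm \<Omega>)"
      by (rule order.trans[OF cmod_cinner_le]) (intro mult_left_mono dK, simp)
    finally show "(\<integral>x. x ^ (2 * m) \<partial>\<mu>) \<le> K ^ (2 * m)" using \<open>norm \<Omega> = 1\<close> by simp
  qed (use K(1) in simp)
  have mu0: "(\<integral>x. x ^ 0 \<partial>\<nu>) = 1" if "prob_space \<nu>" for \<nu> :: "real measure"
    using prob_space.prob_space[OF that] by simp
  have dmu: "has_distribution vac d \<mu>"
    unfolding has_distribution_def
  proof (intro conjI allI assms(9,10) cs)
    fix n
    show "vac (d ^^ n) = complex_of_real (\<integral>x. x ^ n \<partial>\<mu>)"
    proof (cases "n = 0")
      case True
      thus ?thesis using mu0[OF assms(9)] F.\<tau>_linear(3) by (simp only: funpow.simps of_real_1)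
    next
      case False
      thus ?thesis using dn[of n] mu_moments[of n] by simp
    qed
  qed

  have "\<mu> = mu_r R \<boxtimes> mu_s"
    unfolding free_mult_conv_def
  proof (rule the_equality[symmetric], goal_cases)
    case 1
    show ?case
      using tracial_vN_algebra_fock aM lb_in_fock_alg cM pa self_adjoint_lb free da has_distribution_mu_s c dmu
      unfolding d_def self_adjoint_def by blast
  next
    \<comment> \<open>In any realisation the trace reduces the moments to those of
      \<open>b' \<circ> a'\<close>, which freeness and the two given laws determine; compact support
      then identifies the measure.\<close>
    case (2 \<nu>)
    then obtain M :: "nat op set" and \<tau> a' b' c' where G: "tracial_vN_algebra M \<tau>" "a' \<in> M" "b' \<in> M" "c' \<in> M"
      "free_pair \<tau> a' b'" "has_distribution \<tau> a' (mu_r R)" "has_distribution \<tau> b' mu_s"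
      "c' \<circ> c' = a'" "has_distribution \<tau> (c' \<circ> b' \<circ> c') \<nu>" by blast
    interpret G: vN_pair M \<tau> a' b' by unfold_locales (use G in simp_all)
    have \<nu>: "prob_space \<nu>" "sets \<nu> = sets borel" "compactly_supported \<nu>"
      "\<And>n. \<tau> ((c' \<circ> b' \<circ> c') ^^ n) = complex_of_real (\<integral>x. x ^ n \<partial>\<nu>)"
      using G(9) unfolding has_distribution_def by blast+
    have "(\<integral>x. x ^ n \<partial>\<nu>) = (\<integral>x. x ^ n \<partial>\<mu>)" for n
    proof (cases "n = 0")
      case True
      thus ?thesis using mu0[OF assms(9)] mu0[OF \<nu>(1)] by simp
    next
      case False
      hence n: "n \<ge> 1" by simp
      have "complex_of_real (\<integral>x. x ^ n \<partial>\<nu>) = \<tau> ((b' \<circ> a') ^^ n)"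
        unfolding \<nu>(4)[symmetric] by (rule G.trace_sandwich[OF G(4,3,8) n])
      also have "\<dots> = vac ((lb \<circ> a) ^^ n)"
      proof (rule free_product_moments_unique[OF G.vN_pair_axioms F.vN_pair_axioms])
        show "\<tau> (a' ^^ k) = vac (a ^^ k)" for k using G(6) da by (simp add: has_distribution_def)
        show "\<tau> (b' ^^ k) = vac (lb ^^ k)" for k using G(7) has_distribution_mu_s by (simp add: has_distribution_def)
      qed
      also have "\<dots> = complex_of_real (\<integral>x. x ^ n \<partial>\<mu>)" by (simp only: beta_vac[symmetric] mu_moments[OF n])
      finally show ?thesis using of_real_eq_iff by blast
    qed
    thus ?case by (rule compact_moments_unique[OF \<nu>(1-3) assms(9,10) cs])
  qed
  moreover have "(\<lambda>k :: int. norm (complex_of_real (R k 0) * exp (- \<i> * of_int k * of_real x))) summable_on UNIV" for x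
    using r_fun_abs_summable[where R = R, OF sp', of x] by (simp only: fexp_def)
  ultimately show ?thesis using r by blast
qed

end
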